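(* Let $Q$ be a smooth manifold. A SODE $\Gamma$ on $TQ$ is variational if and only if there exists a local diffeomorphism $F:TQ\to T^*Q$ of fibre bundles over $Q$ (that is, $\pi_Q\circ F=\tau_Q$) such that $\mathrm{Im}(\mu_{\Gamma,F})$ is a Lagrangian submanifold of $(T^*TQ,\omega_{TQ})$, where $\mu_{\Gamma,F}=\alpha_Q\circ TF\circ\Gamma$.
   Context: Everything is smooth. $n=\dim Q$, $\tau_Q:TQ\to Q$ and $\pi_Q:T^*Q\to Q$ are the canonical projections, with induced coordinates $(q^i,\dot q^i)$ on $TQ$ and $(q^i,p_i)$ on $T^*Q$. Repeated indices are summed. Canonical forms: for a manifold $P$, $\theta_P$ is the Liouville 1-form on $T^*P$ and $\omega_P=-d\theta_P$; thus $\omega_{TQ}$ is the canonical symplectic form on $T^*TQ=T^*(TQ)$. A submanifold of a symplectic manifold is Lagrangian if the symplectic form pulls back to zero on it and its dimension is half that of the ambient manifold. SODE: a vector field $\Gamma$ on $TQ$ satisfying $S(\Gamma)=\Delta$, where $S=dq^i\otimes\frac{\partial}{\partial\dot q^i}$ is the vertical endomorphism and $\Delta=\dot q^i\frac{\partial}{\partial\dot q^i}$ the Liouville vector field; in coordinates $\Gamma=\dot q^i\frac{\partial}{\partial q^i}+\Gamma^i(q,\dot q)\frac{\partial}{\partial\dot q^i}$. Variational: $\Gamma$ is variational if it is equivalent to the Euler-Lagrange equations of a regular Lagrangian $L:TQ\to\mathbb R$ (regular meaning that the matrix $\left(\frac{\partial^2L}{\partial\dot q^i\partial\dot q^j}\right)$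 is invertible), in the sense that there is a non-singular multiplier matrix $(g_{ij}(q,\dot q))$ such that $g_{ij}(\ddot q^j-\Gamma^j(q,\dot q))=\frac{d}{dt}\left(\frac{\partial L}{\partial\dot q^i}\right)-\frac{\partial L}{\partial q^i}$, $i,j=1,\dots,n$, has a regular solution $L$ (then $g_{ij}=\frac{\partial^2L}{\partial\dot q^i\partial\dot q^j}$). Geometrically, this condition reads $\mathcal L_\Gamma\Theta_L=dL$, where $\Theta_L=S^*(dL)=\frac{\partial L}{\partial\dot q^i}dq^i$. Tulczyjew isomorphism: $\alpha_Q:TT^*Q\to T^*TQ$ is given in the induced coordinates $(q^i,p_i,\dot q^i,\dot p_i)$ of $TT^*Q$ by $\alpha_Q(q^i,p_i,\dot q^i,\dot p_i)=(q^i,\dot q^i,\dot p_i,p_i)$, i.e. it is the covector $\dot p_i\,dq^i+p_i\,d\dot q^i$ at the point $(q^i,\dot q^i)\in TQ$. Intrinsically $\langle\alpha_Q(z),w\rangle=\langle z,\kappa_Q(w)\rangle^T$, with $\kappa_Q$ the canonical involution of $TTQ$ and $\langle\cdot,\cdot\rangle^T$ the tangent lift of the pairing between $T^*Q$ and $TQ$. If $F(q^i,\dot q^i)=(q^i,F_i(q,\dot q))$, then $\mu_{\Gamma,F}$ is the 1-form on $TQ$ locally given by $\left(\frac{\partial F_i}{\partial q^j}\dot q^j+\frac{\partial F_i}{\partial\dot q^j}\Gamma^j\right)dq^i+F_i\,d\dot q^i$.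
   Formalization: With one global L, "if" fails (q''=1 on the circle, F=v dq); so for arbitrary Q "variational" means regular Lagrangians over an open cover of Q agreeing on overlaps up to local constants; with a single L:TQ→R the equivalence is stated when H^1_dR(Q)=0. Dimension n≥1. *)

theory Defs
  imports "HOL-Analysis.Analysis"
begin

section \<open>Smooth maps between Euclidean spaces\<close>

text \<open>Intended for open sets only: \<open>Ck_on k S f\<close> says that all iterated directional derivatives of
  \<open>f\<close> up to order \<open>k\<close> exist on \<open>S\<close>, those of order less than \<open>k\<close> being Frechet differentiable and
  those of order \<open>k\<close> continuous.\<close>

fun Ck_on :: "nat \<Rightarrow> 'a::euclidean_space set \<Rightarrow> ('a \<Rightarrow> 'b::euclidean_space) \<Rightarrow> bool" where
  "Ck_on 0 S f \<longleftrightarrow> continuous_on S f"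
| "Ck_on (Suc k) S f \<longleftrightarrow> (\<forall>x\<in>S. f differentiable (at x)) \<and>
     (\<forall>v. Ck_on k S (\<lambda>x. frechet_derivative f (at x) v))"

definition smooth_on :: "'a::euclidean_space set \<Rightarrow> ('a \<Rightarrow> 'b::euclidean_space) \<Rightarrow> bool" where
  "smooth_on S f \<longleftrightarrow> (\<forall>k. Ck_on k S f)"


section \<open>Smooth manifolds\<close>

text \<open>A manifold is given by a set of points and an atlas of charts indexed by \<open>idx\<close>; the topology is
  the one induced by the atlas. Indexing the charts lets the tangent and cotangent bundles, and
  their iterates, carry atlases with the same index set. The model space is \<open>'e\<close>, so the dimension
  is \<open>DIM('e)\<close>. Only the values of \<open>cmap M i\<close> on \<open>cdom M i\<close> matter.\<close>

record ('p, 'e, 'i) manifold =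
  pts :: "'p set"
  idx :: "'i set"
  cdom :: "'i \<Rightarrow> 'p set"
  cmap :: "'i \<Rightarrow> 'p \<Rightarrow> 'e"

definition cinv :: "('p, 'e, 'i) manifold \<Rightarrow> 'i \<Rightarrow> 'e \<Rightarrow> 'p" where
  "cinv M i = inv_into (cdom M i) (cmap M i)"

definition charts_at :: "('p, 'e, 'i) manifold \<Rightarrow> 'p \<Rightarrow> 'i set" where
  "charts_at M p = {i \<in> idx M. p \<in> cdom M i}"

definition chart_at :: "('p, 'e, 'i) manifold \<Rightarrow> 'p \<Rightarrow> 'i" where
  "chart_at M p = (SOME i. i \<in> charts_at M p)"

definition transition :: "('p, 'e, 'i) manifold \<Rightarrow> 'i \<Rightarrow> 'i \<Rightarrow> 'e \<Rightarrow> 'e" where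
  "transition M i j = cmap M j \<circ> cinv M i"

definition mtop :: "('p, 'e::topological_space, 'i) manifold \<Rightarrow> 'p topology" where
  "mtop M = topology (\<lambda>W. W \<subseteq> pts M \<and> (\<forall>i\<in>idx M. open (cmap M i ` (W \<inter> cdom M i))))"

definition smooth_manifold :: "('p, 'e::euclidean_space, 'i) manifold \<Rightarrow> bool" where
  "smooth_manifold M \<longleftrightarrow>
     (\<Union>i\<in>idx M. cdom M i) = pts M \<and>
     (\<forall>i\<in>idx M. inj_on (cmap M i) (cdom M i)) \<and>
     (\<forall>i\<in>idx M. \<forall>j\<in>idx M. open (cmap M i ` (cdom M i \<inter> cdom M j))) \<and>
     (\<forall>i\<in>idx M. \<forall>j\<in>idx M. smooth_on (cmap M i ` (cdom M i \<inter> cdom M j)) (transition M i j)) \<and>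
     Hausdorff_space (mtop M) \<and> second_countable (mtop M)"

definition open_sub :: "('p, 'e, 'i) manifold \<Rightarrow> 'p set \<Rightarrow> ('p, 'e, 'i) manifold" where
  "open_sub M U = M\<lparr>pts := pts M \<inter> U, cdom := (\<lambda>i. cdom M i \<inter> U)\<rparr>"

definition euclid :: "'e set \<Rightarrow> ('e, 'e, unit) manifold" where
  "euclid V = \<lparr>pts = V, idx = {()}, cdom = (\<lambda>_. V), cmap = (\<lambda>_ x. x)\<rparr>"

definition local_rep ::
  "('p, 'e, 'i) manifold \<Rightarrow> ('q, 'f, 'j) manifold \<Rightarrow> ('p \<Rightarrow> 'q) \<Rightarrow> 'i \<Rightarrow> 'j \<Rightarrow> 'e \<Rightarrow> 'f" where
  "local_rep M N f i j = cmap N j \<circ> f \<circ> cinv M i"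

definition smooth_map ::
  "('p, 'e::euclidean_space, 'i) manifold \<Rightarrow> ('q, 'f::euclidean_space, 'j) manifold \<Rightarrow> ('p \<Rightarrow> 'q) \<Rightarrow> bool"
  where "smooth_map M N f \<longleftrightarrow> f ` pts M \<subseteq> pts N \<and>
    (\<forall>p\<in>pts M. \<forall>i\<in>charts_at M p. \<forall>j\<in>charts_at N (f p).
      \<exists>V. open V \<and> cmap M i p \<in> V \<and> V \<subseteq> cmap M i ` cdom M i \<and>
          f ` cinv M i ` V \<subseteq> cdom N j \<and> smooth_on V (local_rep M N f i j))"

definition diffeomorphism ::
  "('p, 'e::euclidean_space, 'i) manifold \<Rightarrow> ('q, 'f::euclidean_space, 'j) manifold \<Rightarrow> ('p \<Rightarrow> 'q) \<Rightarrow> bool"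
  where "diffeomorphism M N f \<longleftrightarrow> bij_betw f (pts M) (pts N) \<and>
    smooth_map M N f \<and> smooth_map N M (inv_into (pts M) f)"

definition local_diffeomorphism ::
  "('p, 'e::euclidean_space, 'i) manifold \<Rightarrow> ('q, 'f::euclidean_space, 'j) manifold \<Rightarrow> ('p \<Rightarrow> 'q) \<Rightarrow> bool"
  where "local_diffeomorphism M N f \<longleftrightarrow>
    (\<forall>p\<in>pts M. \<exists>U V. openin (mtop M) U \<and> p \<in> U \<and> openin (mtop N) V \<and>
      diffeomorphism (open_sub M U) (open_sub N V) f)"


section \<open>Tangent and cotangent bundles\<close>

text \<open>A tangent vector at \<open>p\<close> is the family of its components in all charts around \<open>p\<close>, related by the
  derivatives of the transition maps, and normalised to 0 at the other indices so that equal vectors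
  are equal functions. Covectors are treated likewise; the component \<open>\<alpha> i\<close> of a covector is an element
  of the model space, paired with vectors by the inner product.\<close>

definition tangent_space :: "('p, 'e::euclidean_space, 'i) manifold \<Rightarrow> 'p \<Rightarrow> ('i \<Rightarrow> 'e) set" where
  "tangent_space M p = {v.
     (\<forall>i\<in>charts_at M p. \<forall>j\<in>charts_at M p.
        v j = frechet_derivative (transition M i j) (at (cmap M i p)) (v i)) \<and>
     (\<forall>i. i \<notin> charts_at M p \<longrightarrow> v i = 0)}"

definition cotangent_space :: "('p, 'e::euclidean_space, 'i) manifold \<Rightarrow> 'p \<Rightarrow> ('i \<Rightarrow> 'e) set" where
  "cotangent_space M p = {\<alpha>.
     (\<forall>i\<in>charts_at M p. \<forall>j\<in>charts_at M p. \<forall>w.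
        \<alpha> i \<bullet> w = \<alpha> j \<bullet> frechet_derivative (transition M i j) (at (cmap M i p)) w) \<and>
     (\<forall>i. i \<notin> charts_at M p \<longrightarrow> \<alpha> i = 0)}"

text \<open>The chart with index \<open>i\<close> gives the induced coordinates \<open>(q, v)\<close>, respectively \<open>(q, p)\<close>. The bundle
  projections are both \<open>fst\<close>.\<close>

definition tangent_bundle ::
  "('p, 'e::euclidean_space, 'i) manifold \<Rightarrow> ('p \<times> ('i \<Rightarrow> 'e), 'e \<times> 'e, 'i) manifold" where
  "tangent_bundle M =
     \<lparr>pts = {(p, v). p \<in> pts M \<and> v \<in> tangent_space M p}, idx = idx M,
      cdom = (\<lambda>i. {(p, v). p \<in> cdom M i \<and> v \<in> tangent_space M p}),
      cmap = (\<lambda>i (p, v). (cmap M i p, v i))\<rparr>"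

definition cotangent_bundle ::
  "('p, 'e::euclidean_space, 'i) manifold \<Rightarrow> ('p \<times> ('i \<Rightarrow> 'e), 'e \<times> 'e, 'i) manifold" where
  "cotangent_bundle M =
     \<lparr>pts = {(p, \<alpha>). p \<in> pts M \<and> \<alpha> \<in> cotangent_space M p}, idx = idx M,
      cdom = (\<lambda>i. {(p, \<alpha>). p \<in> cdom M i \<and> \<alpha> \<in> cotangent_space M p}),
      cmap = (\<lambda>i (p, \<alpha>). (cmap M i p, \<alpha> i))\<rparr>"

text \<open>The tangent map does not depend on the chart of the source manifold.\<close>

definition tangent_map ::
  "('p, 'e::euclidean_space, 'i) manifold \<Rightarrow> ('q, 'f::euclidean_space, 'j) manifold \<Rightarrow>
   ('p \<Rightarrow> 'q) \<Rightarrow> 'p \<times> ('i \<Rightarrow> 'e) \<Rightarrow> 'q \<times> ('j \<Rightarrow> 'f)" where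
  "tangent_map M N f = (\<lambda>(p, v). (f p, \<lambda>j.
     if j \<in> charts_at N (f p)
     then frechet_derivative (local_rep M N f (chart_at M p) j)
            (at (cmap M (chart_at M p) p)) (v (chart_at M p))
     else 0))"

definition vector_field ::
  "('p, 'e::euclidean_space, 'i) manifold \<Rightarrow> ('p \<Rightarrow> 'p \<times> ('i \<Rightarrow> 'e)) \<Rightarrow> bool" where
  "vector_field M X \<longleftrightarrow> smooth_map M (tangent_bundle M) X \<and> (\<forall>p\<in>pts M. fst (X p) = p)"

definition one_form ::
  "('p, 'e::euclidean_space, 'i) manifold \<Rightarrow> ('p \<Rightarrow> 'p \<times> ('i \<Rightarrow> 'e)) \<Rightarrow> bool" where
  "one_form M \<alpha> \<longleftrightarrow> smooth_map M (cotangent_bundle M) \<alpha> \<and> (\<forall>p\<in>pts M. fst (\<alpha> p) = p)"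

text \<open>The exterior derivative of a 1-form, evaluated at \<open>p\<close> on the tangent vectors \<open>u\<close> and \<open>w\<close>; it does
  not depend on the chart.\<close>

definition ext_deriv ::
  "('p, 'e::euclidean_space, 'i) manifold \<Rightarrow> ('p \<Rightarrow> 'p \<times> ('i \<Rightarrow> 'e)) \<Rightarrow>
   'p \<Rightarrow> ('i \<Rightarrow> 'e) \<Rightarrow> ('i \<Rightarrow> 'e) \<Rightarrow> real" where
  "ext_deriv M \<alpha> p u w =
     (let i = chart_at M p; D = frechet_derivative (\<lambda>y. snd (\<alpha> (cinv M i y)) i) (at (cmap M i p))
      in D (u i) \<bullet> w i - D (w i) \<bullet> u i)"

definition closed_form ::
  "('p, 'e::euclidean_space, 'i) manifold \<Rightarrow> ('p \<Rightarrow> 'p \<times> ('i \<Rightarrow> 'e)) \<Rightarrow> bool" where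
  "closed_form M \<alpha> \<longleftrightarrow> (\<forall>p\<in>pts M. \<forall>u\<in>tangent_space M p. \<forall>w\<in>tangent_space M p. ext_deriv M \<alpha> p u w = 0)"

definition smooth_function ::
  "('p, 'e::euclidean_space, 'i) manifold \<Rightarrow> ('p \<Rightarrow> real) \<Rightarrow> bool" where
  "smooth_function M f \<longleftrightarrow> smooth_map M (euclid UNIV) f"

definition exact_form ::
  "('p, 'e::euclidean_space, 'i) manifold \<Rightarrow> ('p \<Rightarrow> 'p \<times> ('i \<Rightarrow> 'e)) \<Rightarrow> bool" where
  "exact_form M \<alpha> \<longleftrightarrow> (\<exists>h. smooth_function M h \<and>
     (\<forall>p\<in>pts M. \<forall>i\<in>charts_at M p. \<forall>u.
        snd (\<alpha> p) i \<bullet> u = frechet_derivative (h \<circ> cinv M i) (at (cmap M i p)) u))"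

definition H1_deRham_zero :: "('p, 'e::euclidean_space, 'i) manifold \<Rightarrow> bool" where
  "H1_deRham_zero M \<longleftrightarrow> (\<forall>\<alpha>. one_form M \<alpha> \<and> closed_form M \<alpha> \<longrightarrow> exact_form M \<alpha>)"


section \<open>Symplectic geometry\<close>

text \<open>The Liouville form on the cotangent bundle is \<open>p dq\<close>: its \<open>dq\<close>-component is the momentum and its
  \<open>dp\<close>-component vanishes.\<close>

definition liouville_form ::
  "'p \<times> ('i \<Rightarrow> 'e::euclidean_space) \<Rightarrow> ('p \<times> ('i \<Rightarrow> 'e)) \<times> ('i \<Rightarrow> 'e \<times> 'e)" where
  "liouville_form z = (z, \<lambda>i. (snd z i, 0))"

definition canonical_symplectic ::
  "('p, 'e::euclidean_space, 'i) manifold \<Rightarrow>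
   'p \<times> ('i \<Rightarrow> 'e) \<Rightarrow> ('i \<Rightarrow> 'e \<times> 'e) \<Rightarrow> ('i \<Rightarrow> 'e \<times> 'e) \<Rightarrow> real" where
  "canonical_symplectic P z u w = - ext_deriv (cotangent_bundle P) liouville_form z u w"

text \<open>Embedded submanifolds, by slice charts.\<close>

definition submanifold :: "('p, 'e::euclidean_space, 'i) manifold \<Rightarrow> nat \<Rightarrow> 'p set \<Rightarrow> bool" where
  "submanifold M k N \<longleftrightarrow> N \<subseteq> pts M \<and>
     (\<forall>x\<in>N. \<exists>U V \<psi> W. openin (mtop M) U \<and> x \<in> U \<and> open (V :: 'e set) \<and>
        diffeomorphism (open_sub M U) (euclid V) \<psi> \<and>
        subspace W \<and> dim W = k \<and> \<psi> ` (N \<inter> U) = V \<inter> W)"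

text \<open>The vectors tangent to a submanifold \<open>N\<close> at \<open>x\<close>: the velocities at time 0 of the smooth curves of
  the ambient manifold that run in \<open>N\<close> and pass through \<open>x\<close> at time 0.\<close>

definition tangent_to ::
  "('p, 'e::euclidean_space, 'i) manifold \<Rightarrow> 'p set \<Rightarrow> 'p \<Rightarrow> ('i \<Rightarrow> 'e) set" where
  "tangent_to M N x = {u. \<exists>e c. e > 0 \<and> smooth_map (euclid {-e<..<e::real}) M c \<and>
     c ` {-e<..<e} \<subseteq> N \<and> c 0 = x \<and>
     u = snd (tangent_map (euclid {-e<..<e}) M c (0, \<lambda>_. 1))}"

definition lagrangian_submanifold ::
  "('p, 'e::euclidean_space, 'i) manifold \<Rightarrow> ('p \<Rightarrow> ('i \<Rightarrow> 'e) \<Rightarrow> ('i \<Rightarrow> 'e) \<Rightarrow> real) \<Rightarrow> 'p set \<Rightarrow> bool"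
  where "lagrangian_submanifold M \<omega> N \<longleftrightarrow>
    (\<exists>k. submanifold M k N \<and> 2 * k = DIM('e)) \<and>
    (\<forall>x\<in>N. \<forall>u\<in>tangent_to M N x. \<forall>w\<in>tangent_to M N x. \<omega> x u w = 0)"


section \<open>Second order differential equations\<close>

text \<open>A tangent vector \<open>w\<close> to the tangent bundle has components \<open>w i = (dq, dv)\<close>; the vertical
  endomorphism sends it to \<open>(0, dq)\<close>, and the Liouville vector field at \<open>(q, v)\<close> is \<open>(0, v)\<close>.\<close>

definition vertical_endo ::
  "('p \<times> ('i \<Rightarrow> 'e::euclidean_space)) \<times> ('i \<Rightarrow> 'e \<times> 'e) \<Rightarrow> ('p \<times> ('i \<Rightarrow> 'e)) \<times> ('i \<Rightarrow> 'e \<times> 'e)" where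
  "vertical_endo = (\<lambda>(x, w). (x, \<lambda>i. (0, fst (w i))))"

definition liouville_field ::
  "'p \<times> ('i \<Rightarrow> 'e::euclidean_space) \<Rightarrow> ('p \<times> ('i \<Rightarrow> 'e)) \<times> ('i \<Rightarrow> 'e \<times> 'e)" where
  "liouville_field x = (x, \<lambda>i. (0, snd x i))"

definition sode ::
  "('p, 'e::euclidean_space, 'i) manifold \<Rightarrow>
   ('p \<times> ('i \<Rightarrow> 'e) \<Rightarrow> ('p \<times> ('i \<Rightarrow> 'e)) \<times> ('i \<Rightarrow> 'e \<times> 'e)) \<Rightarrow> bool" where
  "sode Q \<Gamma> \<longleftrightarrow> vector_field (tangent_bundle Q) \<Gamma> \<and>
     (\<forall>x\<in>pts (tangent_bundle Q). vertical_endo (\<Gamma> x) = liouville_field x)"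

text \<open>The Tulczyjew isomorphism. An element of the double bundle over \<open>(q, p)\<close> has components
  \<open>w i = (dq, dp)\<close> and is sent to the covector with components \<open>(dp, p)\<close> at the point \<open>(q, dq)\<close>.\<close>

definition tulczyjew ::
  "('p \<times> ('i \<Rightarrow> 'e::euclidean_space)) \<times> ('i \<Rightarrow> 'e \<times> 'e) \<Rightarrow> ('p \<times> ('i \<Rightarrow> 'e)) \<times> ('i \<Rightarrow> 'e \<times> 'e)" where
  "tulczyjew = (\<lambda>((q, p), w). ((q, \<lambda>i. fst (w i)), \<lambda>i. (snd (w i), p i)))"

definition mu_form ::
  "('p, 'e::euclidean_space, 'i) manifold \<Rightarrow>
   ('p \<times> ('i \<Rightarrow> 'e) \<Rightarrow> ('p \<times> ('i \<Rightarrow> 'e)) \<times> ('i \<Rightarrow> 'e \<times> 'e)) \<Rightarrow>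
   ('p \<times> ('i \<Rightarrow> 'e) \<Rightarrow> 'p \<times> ('i \<Rightarrow> 'e)) \<Rightarrow>
   'p \<times> ('i \<Rightarrow> 'e) \<Rightarrow> ('p \<times> ('i \<Rightarrow> 'e)) \<times> ('i \<Rightarrow> 'e \<times> 'e)" where
  "mu_form Q \<Gamma> F = tulczyjew \<circ> tangent_map (tangent_bundle Q) (cotangent_bundle Q) F \<circ> \<Gamma>"


section \<open>The inverse problem\<close>

text \<open>Expressions in the coordinates \<open>(q, v)\<close> of a tangent bundle.\<close>

definition d_q :: "((real^'n) \<times> (real^'n) \<Rightarrow> real) \<Rightarrow> (real^'n) \<times> (real^'n) \<Rightarrow> real^'n" where
  "d_q l y = (\<chi> j. frechet_derivative l (at y) (axis j 1, 0))"

definition d_v :: "((real^'n) \<times> (real^'n) \<Rightarrow> real) \<Rightarrow> (real^'n) \<times> (real^'n) \<Rightarrow> real^'n" where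
  "d_v l y = (\<chi> j. frechet_derivative l (at y) (0, axis j 1))"

definition hessian_v :: "((real^'n) \<times> (real^'n) \<Rightarrow> real) \<Rightarrow> (real^'n) \<times> (real^'n) \<Rightarrow> real^'n^'n" where
  "hessian_v l y = (\<chi> j k. frechet_derivative (\<lambda>z. d_v l z $ k) (at y) (0, axis j 1))"

text \<open>The Euler-Lagrange expression as a function of position, velocity and acceleration \<open>a\<close>; the
  first term is the total time derivative of the momenta.\<close>

definition euler_lagrange ::
  "((real^'n) \<times> (real^'n) \<Rightarrow> real) \<Rightarrow> (real^'n) \<times> (real^'n) \<Rightarrow> real^'n \<Rightarrow> real^'n" where
  "euler_lagrange l y a = frechet_derivative (d_v l) (at y) (snd y, a) - d_q l y"

text \<open>\<open>L\<close> is a regular Lagrangian defined over the open subset \<open>U\<close> of the configuration manifold whose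
  Euler-Lagrange equations are equivalent to \<open>\<Gamma>\<close> there, with multiplier matrix \<open>g\<close> in each chart.\<close>

definition lagrangian_for ::
  "('q, real^'n, 'i) manifold \<Rightarrow>
   ('q \<times> ('i \<Rightarrow> real^'n) \<Rightarrow> ('q \<times> ('i \<Rightarrow> real^'n)) \<times> ('i \<Rightarrow> (real^'n) \<times> (real^'n))) \<Rightarrow>
   'q set \<Rightarrow> ('q \<times> ('i \<Rightarrow> real^'n) \<Rightarrow> real) \<Rightarrow> bool" where
  "lagrangian_for Q \<Gamma> U L \<longleftrightarrow>
     smooth_function (open_sub (tangent_bundle Q) (fst -` U)) L \<and>
     (\<forall>i\<in>idx Q. \<exists>g :: (real^'n) \<times> (real^'n) \<Rightarrow> real^'n^'n.
       \<forall>x \<in> cdom (tangent_bundle Q) i \<inter> fst -` U.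
         let l = L \<circ> cinv (tangent_bundle Q) i; y = cmap (tangent_bundle Q) i x in
           invertible (hessian_v l y) \<and> invertible (g y) \<and>
           (\<forall>a. g y *v (a - snd (snd (\<Gamma> x) i)) = euler_lagrange l y a))"

definition variational ::
  "('q, real^'n, 'i) manifold \<Rightarrow>
   ('q \<times> ('i \<Rightarrow> real^'n) \<Rightarrow> ('q \<times> ('i \<Rightarrow> real^'n)) \<times> ('i \<Rightarrow> (real^'n) \<times> (real^'n))) \<Rightarrow> bool" where
  "variational Q \<Gamma> \<longleftrightarrow> (\<exists>L. lagrangian_for Q \<Gamma> (pts Q) L)"

text \<open>The local version: the Lagrangian need only be given over the members of an open cover of the
  configuration manifold, the Lagrangians agreeing on overlaps up to locally constant functions (a
  ``multivalued'' Lagrangian, whose differential is globally defined). For instance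
  \<open>L = v\<^sup>2 / 2 + q\<close> is such a Lagrangian for the equation \<open>q'' = 1\<close> on the circle, which does not
  admit a single-valued regular one.\<close>

definition locally_variational ::
  "('q, real^'n, 'i) manifold \<Rightarrow>
   ('q \<times> ('i \<Rightarrow> real^'n) \<Rightarrow> ('q \<times> ('i \<Rightarrow> real^'n)) \<times> ('i \<Rightarrow> (real^'n) \<times> (real^'n))) \<Rightarrow> bool" where
  "locally_variational Q \<Gamma> \<longleftrightarrow> (\<exists>\<U> L.
     (\<forall>U\<in>\<U>. openin (mtop Q) U \<and> lagrangian_for Q \<Gamma> U (L U)) \<and> \<Union>\<U> = pts Q \<and>
     (\<forall>U\<in>\<U>. \<forall>V\<in>\<U>. \<forall>q \<in> U \<inter> V. \<exists>W c. openin (mtop Q) W \<and> q \<in> W \<and> W \<subseteq> U \<inter> V \<and>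
        (\<forall>x\<in>pts (tangent_bundle Q). fst x \<in> W \<longrightarrow> L U x - L V x = c)))"

lemma istopology_mtop:
  assumes "smooth_manifold M"
  shows "istopology (\<lambda>W. W \<subseteq> pts M \<and> (\<forall>i\<in>idx M. open (cmap M i ` (W \<inter> cdom M i))))"
proof -
  have inj: "\<And>i. i \<in> idx M \<Longrightarrow> inj_on (cmap M i) (cdom M i)"
    using assms by (auto simp: smooth_manifold_def)
  have int: "cmap M i ` (S \<inter> T \<inter> cdom M i)
      = cmap M i ` (S \<inter> cdom M i) \<inter> cmap M i ` (T \<inter> cdom M i)" if "i \<in> idx M" for i S T
    using inj[OF that] by (auto simp: inj_on_def)
  have un: "cmap M i ` (\<Union>K \<inter> cdom M i) = (\<Union>S\<in>K. cmap M i ` (S \<inter> cdom M i))" for i K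
    by blast
  show ?thesis
    unfolding istopology_def
  proof (intro conjI allI impI)
    fix S T
    assume "S \<subseteq> pts M \<and> (\<forall>i\<in>idx M. open (cmap M i ` (S \<inter> cdom M i)))"
      and "T \<subseteq> pts M \<and> (\<forall>i\<in>idx M. open (cmap M i ` (T \<inter> cdom M i)))"
    then show "S \<inter> T \<subseteq> pts M" "\<forall>i\<in>idx M. open (cmap M i ` (S \<inter> T \<inter> cdom M i))"
      using int by auto
  next
    fix K
    assume "\<forall>S\<in>K. S \<subseteq> pts M \<and> (\<forall>i\<in>idx M. open (cmap M i ` (S \<inter> cdom M i)))"
    then show "\<Union>K \<subseteq> pts M" "\<forall>i\<in>idx M. open (cmap M i ` (\<Union>K \<inter> cdom M i))"
      unfolding un by (auto intro!: open_UN)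
  qed
qed

lemma openin_mtop:
  assumes "smooth_manifold M"
  shows "openin (mtop M) W \<longleftrightarrow> W \<subseteq> pts M \<and> (\<forall>i\<in>idx M. open (cmap M i ` (W \<inter> cdom M i)))"
  unfolding mtop_def using istopology_mtop[OF assms] by (simp add: topology_inverse')

lemma variational_imp_locally_variational:
  assumes "smooth_manifold Q" and "variational Q \<Gamma>"
  shows "locally_variational Q \<Gamma>"
proof -
  obtain L where L: "lagrangian_for Q \<Gamma> (pts Q) L"
    using assms(2) by (auto simp: variational_def)
  have "open (cmap Q i ` (pts Q \<inter> cdom Q i))" if "i \<in> idx Q" for i
  proof -
    have "pts Q \<inter> cdom Q i = cdom Q i \<inter> cdom Q i"
      using assms(1) that by (auto simp: smooth_manifold_def)
    moreover have "open (cmap Q i ` (cdom Q i \<inter> cdom Q i))"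
      using assms(1) that unfolding smooth_manifold_def by blast
    ultimately show ?thesis by metis
  qed
  then have o: "openin (mtop Q) (pts Q)"
    unfolding openin_mtop[OF assms(1)] by simp
  show ?thesis
    unfolding locally_variational_def
    by (rule exI[of _ "{pts Q}"], rule exI[of _ "\<lambda>_. L"]) (use L o in auto)
qed

end

theory Submission
  imports Defs
begin

text \<open>
  In a chart write \<open>F (q, v) = (q, f (q, v))\<close>. Then \<open>\<mu>\<close> has the components \<open>(\<Gamma> f, f)\<close>, and the image of
  a 1-form is Lagrangian iff the form is closed, i.e. locally \<open>\<mu> = dL\<close>. The \<open>dv\<close>-part of this equation
  says that \<open>F\<close> is the Legendre map of \<open>L\<close>, and given this the \<open>dq\<close>-part says that the
  Euler-Lagrange expression vanishes along \<open>\<Gamma>\<close>; as that expression is affine in the acceleration with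
  linear part the Hessian, it is the Hessian applied to \<open>a - \<Gamma>\<close>. Finally \<open>F\<close> is a local
  diffeomorphism iff the Hessian is invertible. The Poincare lemma is applied on \<open>B \<times> \<real>\<^sup>n\<close> with \<open>B\<close> a
  coordinate ball of \<open>Q\<close>, so that the Lagrangians live over open sets of \<open>Q\<close> and two of them differ by
  a constant over small balls; the pullback of \<open>\<mu>\<close> along the zero section carries the only obstruction
  to a global one, a class in \<open>H\<^sup>1(Q)\<close>.
\<close>

text \<open>That \<open>mu_form\<close> is a covector field at all has to be proved: differentiating
  the transformation law of f along \<Gamma> produces a second derivative of the transition map of
  Q, and this matches the one in the transition map of TQ thanks to the equality of mixed
  derivatives and to the \<open>sode\<close> condition that the base part of \<Gamma> is the
  velocity itself. The same equality makes closedness independent of the chart, which matters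
  because \<open>ext_deriv\<close> is evaluated in one arbitrarily chosen chart. The condition on F
  is carried through the proof as triviality of the kernel of its fibre derivative: F is the
  identity on the base, so its full derivative is block triangular, and the fibre block is the
  transposed Hessian. A class on Q suffices to control the gluing because a fibre of TQ is a vector
  space, on which two local primitives differ by a constant; subtracting the value at the zero
  vector removes that constant, and a primitive of the pulled back form restores the variation along
  Q that is lost by the subtraction.\<close>

abbreviation fderiv :: "('a::real_normed_vector \<Rightarrow> 'b::real_normed_vector) \<Rightarrow> 'a \<Rightarrow> 'a \<Rightarrow> 'b" where
  "fderiv f x \<equiv> frechet_derivative f (at x)"

section \<open>Calculus of smooth maps\<close>

lemma fderiv_eqI: "(f has_derivative f') (at x) \<Longrightarrow> fderiv f x = f'"
  by (metis frechet_derivative_at)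

lemma fderiv_works: "f differentiable (at x) \<Longrightarrow> (f has_derivative fderiv f x) (at x)"
  by (simp add: frechet_derivative_works)

text \<open>\<open>frechet_derivative\<close> is a choice among the derivatives at a point; near
  \<open>x\<close> the two functions have the same candidates, so the choices coincide even where
  there is no derivative.\<close>

lemma fderiv_cong_open:
  assumes "open S" "x \<in> S" "\<And>y. y \<in> S \<Longrightarrow> f y = g y"
  shows "fderiv f x = fderiv g x"
proof -
  have "(f has_derivative D) (at x) \<longleftrightarrow> (g has_derivative D) (at x)" for D
    using has_derivative_transform_within_open[OF _ assms(1,2), of f D UNIV g]
      has_derivative_transform_within_open[OF _ assms(1,2), of g D UNIV f] assms(3) by auto
  then show ?thesis
    by (simp add: frechet_derivative_def)
qed

section \<open>Closure properties of the classes C^k, by induction on the order\<close>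

lemma Ck_on_SucI:
  assumes "\<And>x. x \<in> S \<Longrightarrow> (f has_derivative f' x) (at x)"
    and "\<And>v. Ck_on k S (\<lambda>x. fderiv f x v)"
  shows "Ck_on (Suc k) S f"
  using assms by (auto simp: differentiable_def)

text \<open>Chart inverses are arbitrary off the chart image, so two coordinate expressions agree on
  an open set at best; derivatives there see only that set.\<close>

lemma Ck_on_cong:
  assumes "open S" "\<And>x. x \<in> S \<Longrightarrow> f x = g x" "Ck_on k S f"
  shows "Ck_on k S g"
  using assms(2,3)
proof (induction k arbitrary: f g)
  case 0
  then show ?case by (simp cong: continuous_on_cong)
next
  case (Suc k)
  have "g differentiable (at x)" if "x \<in> S" for x
  proof -
    have "f differentiable (at x)"
      using Suc.prems that by simp
    then show ?thesis
      using has_derivative_transform_within_open[OF fderiv_works assms(1) that] Suc.prems(1)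
      unfolding differentiable_def by blast
  qed
  moreover have "Ck_on k S (\<lambda>x. fderiv g x v)" for v
    by (rule Suc.IH[of "\<lambda>x. fderiv f x v"])
      (use Suc.prems fderiv_cong_open[OF assms(1) _ Suc.prems(1)] in auto)
  ultimately show ?case by simp
qed

text \<open>Replaces the chosen derivative by an explicit formula. The closure properties that
  follow use it for the step from order k to k + 1, with the functions generalised in the
  induction.\<close>

lemma Ck_on_Suc_has_derivativeI:
  assumes "open S" "\<And>x. x \<in> S \<Longrightarrow> (f has_derivative f' x) (at x)"
    and "\<And>v. Ck_on k S (\<lambda>x. f' x v)"
  shows "Ck_on (Suc k) S f"
proof (rule Ck_on_SucI)
  show "Ck_on k S (\<lambda>x. fderiv f x v)" for v
    by (rule Ck_on_cong[OF assms(1) _ assms(3)]) (simp add: fderiv_eqI[OF assms(2)])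
qed (use assms(2) in auto)

lemma Ck_on_subset: "Ck_on k S f \<Longrightarrow> T \<subseteq> S \<Longrightarrow> Ck_on k T f"
  by (induction k arbitrary: f) (auto intro: continuous_on_subset)

lemma Ck_on_local:
  assumes "\<And>x. x \<in> S \<Longrightarrow> \<exists>V. open V \<and> x \<in> V \<and> Ck_on k V f"
  shows "Ck_on k S f"
  using assms
proof (induction k arbitrary: f)
  case 0
  show ?case
    unfolding Ck_on.simps
    by (rule continuous_at_imp_continuous_on)
      (use 0 in \<open>metis Ck_on.simps(1) continuous_on_eq_continuous_at\<close>)
next
  case (Suc k)
  show ?case
    unfolding Ck_on.simps
  proof (intro conjI ballI allI)
    show "f differentiable (at x)" if "x \<in> S" for x
      using Suc.prems[OF that] by auto
    show "Ck_on k S (\<lambda>x. fderiv f x v)" for v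
      by (rule Suc.IH) (use Suc.prems in \<open>fastforce\<close>)
  qed
qed

lemma Ck_on_SucD: "Ck_on (Suc k) S f \<Longrightarrow> Ck_on k S f"
proof (induction k arbitrary: f)
  case 0
  then show ?case
    by (auto intro!: continuous_at_imp_continuous_on differentiable_imp_continuous_within)
qed auto

lemma Ck_on_const: "Ck_on k S (\<lambda>_. c)"
proof (induction k arbitrary: c)
  case (Suc k)
  then show ?case by simp
qed simp

lemma Ck_on_linear_comp:
  fixes h :: "'b::euclidean_space \<Rightarrow> 'c::euclidean_space"
  assumes "open S" "bounded_linear h" "Ck_on k S f"
  shows "Ck_on k S (\<lambda>x. h (f x))"
  using assms(3)
proof (induction k arbitrary: f)
  case 0
  then show ?case
    using continuous_on_compose2[OF linear_continuous_on[OF assms(2)]] by auto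
next
  case (Suc k)
  have "((\<lambda>x. h (f x)) has_derivative (\<lambda>v. h (fderiv f x v))) (at x)" if "x \<in> S" for x
    using Suc.prems that by (auto intro!: bounded_linear.has_derivative[OF assms(2)] fderiv_works)
  then show ?case
    by (rule Ck_on_Suc_has_derivativeI[OF assms(1)]) (use Suc in auto)
qed

lemma Ck_on_linear:
  fixes h :: "'b::euclidean_space \<Rightarrow> 'c::euclidean_space"
  assumes "bounded_linear h"
  shows "Ck_on k S h"
proof (cases k)
  case 0
  then show ?thesis using assms by (simp add: linear_continuous_on)
next
  case (Suc m)
  have "fderiv h x = h" for x
    by (rule fderiv_eqI) (rule bounded_linear_imp_has_derivative[OF assms])
  then show ?thesis
    using Suc bounded_linear_imp_differentiable[OF assms] by (auto simp: Ck_on_const)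
qed

lemma Ck_on_add:
  assumes "open S" "Ck_on k S f" "Ck_on k S g"
  shows "Ck_on k S (\<lambda>x. f x + g x)"
  using assms(2,3)
proof (induction k arbitrary: f g)
  case 0
  then show ?case by (simp add: continuous_on_add)
next
  case (Suc k)
  have "((\<lambda>x. f x + g x) has_derivative (\<lambda>v. fderiv f x v + fderiv g x v)) (at x)" if "x \<in> S" for x
    using Suc.prems that by (auto intro!: has_derivative_add fderiv_works)
  then show ?case
    by (rule Ck_on_Suc_has_derivativeI[OF assms(1)]) (use Suc in auto)
qed

lemma Ck_on_bilinear:
  fixes h :: "'b::euclidean_space \<Rightarrow> 'c::euclidean_space \<Rightarrow> 'd::euclidean_space"
  assumes "open S" "bounded_bilinear h" "Ck_on k S f" "Ck_on k S g"
  shows "Ck_on k S (\<lambda>x. h (f x) (g x))"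
  using assms(3,4)
proof (induction k arbitrary: f g)
  case 0
  then show ?case by (simp add: bounded_bilinear.continuous_on[OF assms(2)])
next
  case (Suc k)
  have "((\<lambda>x. h (f x) (g x)) has_derivative
      (\<lambda>v. h (f x) (fderiv g x v) + h (fderiv f x v) (g x))) (at x)" if "x \<in> S" for x
    using Suc.prems that by (auto intro!: bounded_bilinear.FDERIV[OF assms(2)] fderiv_works)
  moreover have "Ck_on k S (\<lambda>x. h (f x) (fderiv g x v) + h (fderiv f x v) (g x))" for v
    by (intro Ck_on_add[OF assms(1)] Suc.IH) (use Suc.prems Ck_on_SucD in auto)
  ultimately show ?case
    by (rule Ck_on_Suc_has_derivativeI[OF assms(1)])
qed

lemma Ck_on_sum:
  assumes "open S" "\<And>i. i \<in> I \<Longrightarrow> Ck_on k S (f i)"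
  shows "Ck_on k S (\<lambda>x. \<Sum>i\<in>I. f i x)"
  using assms(2)
  by (induction I rule: infinite_finite_induct) (auto simp: Ck_on_const intro!: Ck_on_add[OF assms(1)])

lemma linear_eq_sum_Basis:
  fixes f :: "'a::euclidean_space \<Rightarrow> 'b::real_vector"
  assumes "linear f"
  shows "f v = (\<Sum>b\<in>Basis. (v \<bullet> b) *\<^sub>R f b)"
  by (subst euclidean_representation[of v, symmetric])
    (simp add: linear_sum[OF assms] linear_scale[OF assms])

lemma Ck_on_compose:
  assumes "open S" "open T" "f ` S \<subseteq> T" "Ck_on k S f" "Ck_on k T g"
  shows "Ck_on k S (\<lambda>x. g (f x))"
  using assms(4,5)
proof (induction k arbitrary: g)
  case 0
  then show ?case
    using assms(3) by (auto intro!: continuous_on_compose2[of T g S f])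
next
  case (Suc k)
  have d: "((\<lambda>x. g (f x)) has_derivative (\<lambda>v. fderiv g (f x) (fderiv f x v))) (at x)"
    and l: "linear (fderiv g (f x))" if "x \<in> S" for x
  proof -
    have g: "g differentiable (at (f x))" and f: "f differentiable (at x)"
      using Suc.prems that assms(3) by auto
    show "((\<lambda>x. g (f x)) has_derivative (\<lambda>v. fderiv g (f x) (fderiv f x v))) (at x)"
      using has_derivative_compose[OF fderiv_works[OF f] fderiv_works[OF g]] by simp
    show "linear (fderiv g (f x))"
      using g by (rule linear_frechet_derivative)
  qed
  \<comment> \<open>The induction hypothesis covers \<open>fderiv g (f x) b\<close> only for a fixed
    direction \<open>b\<close>, while the direction \<open>fderiv f x v\<close> moves with
    \<open>x\<close>. Expanding it in the basis separates the two dependences.\<close>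
  have "Ck_on k S (\<lambda>x. \<Sum>b\<in>Basis. (fderiv f x v \<bullet> b) *\<^sub>R fderiv g (f x) b)" for v
    by (intro Ck_on_sum Ck_on_bilinear[OF assms(1) bounded_bilinear_scaleR]
          Ck_on_linear_comp[OF assms(1) bounded_linear_inner_left] assms(1) Suc.IH
          Ck_on_SucD[OF Suc.prems(1)])
      (use Suc.prems in simp_all)
  then have c: "Ck_on k S (\<lambda>x. fderiv g (f x) (fderiv f x v))" for v
    by (rule Ck_on_cong[OF assms(1), rotated]) (rule linear_eq_sum_Basis[OF l, symmetric])
  show ?case
    by (rule Ck_on_Suc_has_derivativeI[where f' = "\<lambda>x v. fderiv g (f x) (fderiv f x v)", OF assms(1) d c])
qed

lemma Ck_on_Pair:
  assumes "open S" "Ck_on k S f" "Ck_on k S g"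
  shows "Ck_on k S (\<lambda>x. (f x, g x))"
proof -
  have "Ck_on k S (\<lambda>x. (f x, 0) + (0, g x))"
    by (intro Ck_on_add Ck_on_linear_comp[of S "\<lambda>y. (y, 0)"] Ck_on_linear_comp[of S "\<lambda>y. (0, y)"] assms
        bounded_linear_Pair bounded_linear_ident bounded_linear_zero)
  then show ?thesis by simp
qed

text \<open>The derivative \<open>- (inverse x * v * inverse x)\<close> is again built from
  \<open>inverse\<close>, so the induction closes.\<close>

lemma Ck_on_inverse: "Ck_on k {x. x \<noteq> 0} (inverse :: real \<Rightarrow> real)"
proof (induction k)
  case (Suc k)
  have o: "open {x::real. x \<noteq> 0}"
    by (rule open_Collect_neq) (auto intro: continuous_intros)
  have "Ck_on k {x. x \<noteq> 0} (\<lambda>x::real. - (inverse x * v * inverse x))" for v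
    by (intro Ck_on_linear_comp[OF o bounded_linear_minus[OF bounded_linear_ident]]
        Ck_on_bilinear[OF o bounded_bilinear_mult] Ck_on_const Suc)
  then show ?case
    by (rule Ck_on_Suc_has_derivativeI[OF o has_derivative_inverse', rotated]) auto
qed (auto intro: continuous_intros)

section \<open>The closure properties for smooth maps\<close>

lemma smooth_onD: "smooth_on S f \<Longrightarrow> Ck_on k S f"
  by (simp add: smooth_on_def)

lemma smooth_on_differentiable: "smooth_on S f \<Longrightarrow> x \<in> S \<Longrightarrow> f differentiable (at x)"
  by (metis smooth_onD Ck_on.simps(2))

lemma smooth_on_has_derivative: "smooth_on S f \<Longrightarrow> x \<in> S \<Longrightarrow> (f has_derivative fderiv f x) (at x)"
  by (simp add: smooth_on_differentiable fderiv_works)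

lemma smooth_on_continuous: "smooth_on S f \<Longrightarrow> continuous_on S f"
  by (metis smooth_onD Ck_on.simps(1))

lemma smooth_on_linear_fderiv: "smooth_on S f \<Longrightarrow> x \<in> S \<Longrightarrow> linear (fderiv f x)"
  by (simp add: smooth_on_differentiable linear_frechet_derivative)

lemma smooth_on_fderiv: "smooth_on S f \<Longrightarrow> smooth_on S (\<lambda>x. fderiv f x v)"
  by (metis smooth_on_def Ck_on.simps(2))

lemma smooth_on_has_derivativeI:
  assumes "open S" "\<And>x. x \<in> S \<Longrightarrow> (f has_derivative f' x) (at x)"
    and "\<And>v. smooth_on S (\<lambda>x. f' x v)"
  shows "smooth_on S f"
proof -
  have "Ck_on (Suc k) S f" for k
    using assms by (intro Ck_on_Suc_has_derivativeI[of S f f']) (auto simp: smooth_on_def)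
  then show ?thesis
    by (auto simp: smooth_on_def intro: Ck_on_SucD)
qed

lemma smooth_on_cong:
  "open S \<Longrightarrow> (\<And>x. x \<in> S \<Longrightarrow> f x = g x) \<Longrightarrow> smooth_on S f \<Longrightarrow> smooth_on S g"
  unfolding smooth_on_def by (metis Ck_on_cong)

lemma smooth_on_subset: "smooth_on S f \<Longrightarrow> T \<subseteq> S \<Longrightarrow> smooth_on T f"
  unfolding smooth_on_def by (metis Ck_on_subset)

lemma smooth_on_local:
  "(\<And>x. x \<in> S \<Longrightarrow> \<exists>V. open V \<and> x \<in> V \<and> smooth_on V f) \<Longrightarrow> smooth_on S f"
  unfolding smooth_on_def by (meson Ck_on_local)

lemma smooth_on_const: "smooth_on S (\<lambda>_. c)"
  by (simp add: smooth_on_def Ck_on_const)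

lemma smooth_on_linear:
  fixes h :: "'b::euclidean_space \<Rightarrow> 'c::euclidean_space"
  shows "bounded_linear h \<Longrightarrow> smooth_on S h"
  by (simp add: smooth_on_def Ck_on_linear)

lemma smooth_on_ident: "smooth_on S (\<lambda>x. x)"
  by (intro smooth_on_linear bounded_linear_ident)

lemma smooth_on_fst: "smooth_on S fst" and smooth_on_snd: "smooth_on S snd"
  by (intro smooth_on_linear bounded_linear_fst bounded_linear_snd)+

lemma smooth_on_linear_comp:
  fixes h :: "'b::euclidean_space \<Rightarrow> 'c::euclidean_space"
  shows "open S \<Longrightarrow> bounded_linear h \<Longrightarrow> smooth_on S f \<Longrightarrow> smooth_on S (\<lambda>x. h (f x))"
  unfolding smooth_on_def by (metis Ck_on_linear_comp)

lemma smooth_on_compose: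
  "open S \<Longrightarrow> open T \<Longrightarrow> f ` S \<subseteq> T \<Longrightarrow> smooth_on S f \<Longrightarrow> smooth_on T g \<Longrightarrow> smooth_on S (\<lambda>x. g (f x))"
  unfolding smooth_on_def by (metis Ck_on_compose)

lemma smooth_on_bilinear:
  fixes h :: "'b::euclidean_space \<Rightarrow> 'c::euclidean_space \<Rightarrow> 'd::euclidean_space"
  shows "open S \<Longrightarrow> bounded_bilinear h \<Longrightarrow> smooth_on S f \<Longrightarrow> smooth_on S g
    \<Longrightarrow> smooth_on S (\<lambda>x. h (f x) (g x))"
  unfolding smooth_on_def by (metis Ck_on_bilinear)

lemma smooth_on_add:
  "open S \<Longrightarrow> smooth_on S f \<Longrightarrow> smooth_on S g \<Longrightarrow> smooth_on S (\<lambda>x. f x + g x)"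
  unfolding smooth_on_def by (metis Ck_on_add)

lemma smooth_on_diff:
  assumes "open S" "smooth_on S f" "smooth_on S g"
  shows "smooth_on S (\<lambda>x. f x - g x)"
  using smooth_on_add[OF assms(1,2)
      smooth_on_linear_comp[OF assms(1) bounded_linear_minus[OF bounded_linear_ident] assms(3)]]
  by simp

lemma smooth_on_sum:
  "open S \<Longrightarrow> (\<And>i. i \<in> I \<Longrightarrow> smooth_on S (f i)) \<Longrightarrow> smooth_on S (\<lambda>x. \<Sum>i\<in>I. f i x)"
  unfolding smooth_on_def by (metis Ck_on_sum)

lemma smooth_on_Pair:
  "open S \<Longrightarrow> smooth_on S f \<Longrightarrow> smooth_on S g \<Longrightarrow> smooth_on S (\<lambda>x. (f x, g x))"
  unfolding smooth_on_def by (metis Ck_on_Pair)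

text \<open>Base point and direction both move, as they do in the tangent lift of a transition map;
  the basis expansion reduces this to fixed directions.\<close>

lemma smooth_on_fderiv_apply:
  assumes "open S" "open T" "smooth_on T f" "smooth_on S g" "smooth_on S h" "g ` S \<subseteq> T"
  shows "smooth_on S (\<lambda>x. fderiv f (g x) (h x))"
proof -
  have "smooth_on S (\<lambda>x. \<Sum>b\<in>Basis. (h x \<bullet> b) *\<^sub>R fderiv f (g x) b)"
    by (intro smooth_on_sum smooth_on_bilinear[OF assms(1) bounded_bilinear_scaleR]
        smooth_on_linear_comp[OF assms(1) bounded_linear_inner_left] assms
        smooth_on_compose[OF assms(1,2,6,4) smooth_on_fderiv])
  moreover have "linear (fderiv f (g x))" if "x \<in> S" for x
    using that assms by (auto intro: smooth_on_linear_fderiv)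
  ultimately show ?thesis
    by (elim smooth_on_cong[OF assms(1), rotated]) (simp add: linear_eq_sum_Basis[symmetric])
qed

subsection \<open>Symmetry of the second derivative\<close>

text \<open>The mean value theorem is applied twice, to the difference of \<open>f\<close> in the
  direction \<open>w\<close> as a function of \<open>s\<close>, then to its derivative as a function
  of \<open>t\<close>. The left side is symmetric in \<open>u\<close> and \<open>w\<close>, the
  right side is not visibly so.\<close>

lemma second_difference_mvt:
  fixes f :: "'a::euclidean_space \<Rightarrow> real"
  assumes "smooth_on (ball x r) f" "0 < h" "h * (norm u + norm w) < r"
  shows "\<exists>s t. 0 < s \<and> s < h \<and> 0 < t \<and> t < h \<and>
    f (x + h *\<^sub>R u + h *\<^sub>R w) - f (x + h *\<^sub>R u) - f (x + h *\<^sub>R w) + f x =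
    h * h * fderiv (\<lambda>y. fderiv f y u) (x + s *\<^sub>R u + t *\<^sub>R w) w"
proof -
  have mem: "x + s *\<^sub>R u + t *\<^sub>R w \<in> ball x r" if "0 \<le> s" "s \<le> h" "0 \<le> t" "t \<le> h" for s t
  proof -
    have "norm (s *\<^sub>R u + t *\<^sub>R w) \<le> s * norm u + t * norm w"
      using that by (metis abs_of_nonneg norm_scaleR norm_triangle_ineq)
    also have "\<dots> \<le> h * (norm u + norm w)"
      using that by (simp add: distrib_left add_mono mult_right_mono)
    finally have "norm (s *\<^sub>R u + t *\<^sub>R w) < r" using assms(3) by simp
    moreover have "dist x (x + s *\<^sub>R u + t *\<^sub>R w) = norm (s *\<^sub>R u + t *\<^sub>R w)"
      by (metis dist_norm add.assoc add_diff_cancel_left' norm_minus_commute)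
    ultimately show ?thesis by simp
  qed
  have df: "((\<lambda>s. f (x + s *\<^sub>R u + t *\<^sub>R w)) has_real_derivative fderiv f (x + s *\<^sub>R u + t *\<^sub>R w) u) (at s)"
    if "0 \<le> s" "s \<le> h" "0 \<le> t" "t \<le> h" for s t
  proof -
    have *: "((\<lambda>s. x + s *\<^sub>R u + t *\<^sub>R w) has_derivative (\<lambda>d. d *\<^sub>R u)) (at s)"
      by (auto intro!: derivative_eq_intros)
    have "((\<lambda>s. f (x + s *\<^sub>R u + t *\<^sub>R w)) has_derivative
        (\<lambda>d. fderiv f (x + s *\<^sub>R u + t *\<^sub>R w) (d *\<^sub>R u))) (at s)"
      using has_derivative_compose[OF * smooth_on_has_derivative[OF assms(1) mem[OF that]]] .
    then show ?thesis
      by (rule has_derivative_imp_has_field_derivative)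
        (simp add: linear_scale[OF smooth_on_linear_fderiv[OF assms(1) mem[OF that]]])
  qed
  have dg: "((\<lambda>t. fderiv f (x + s *\<^sub>R u + t *\<^sub>R w) u) has_real_derivative
      fderiv (\<lambda>y. fderiv f y u) (x + s *\<^sub>R u + t *\<^sub>R w) w) (at t)"
    if "0 \<le> s" "s \<le> h" "0 \<le> t" "t \<le> h" for s t
  proof -
    note sm = smooth_on_fderiv[OF assms(1), of u]
    have *: "((\<lambda>t. x + s *\<^sub>R u + t *\<^sub>R w) has_derivative (\<lambda>d. d *\<^sub>R w)) (at t)"
      by (auto intro!: derivative_eq_intros)
    have "((\<lambda>t. fderiv f (x + s *\<^sub>R u + t *\<^sub>R w) u) has_derivative
        (\<lambda>d. fderiv (\<lambda>y. fderiv f y u) (x + s *\<^sub>R u + t *\<^sub>R w) (d *\<^sub>R w))) (at t)"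
      using has_derivative_compose[OF * smooth_on_has_derivative[OF sm mem[OF that]]] .
    then show ?thesis
      by (rule has_derivative_imp_has_field_derivative)
        (simp add: linear_scale[OF smooth_on_linear_fderiv[OF sm mem[OF that]]])
  qed
  have h0: "0 \<le> h" using assms(2) by simp
  have df2: "((\<lambda>s. f (x + s *\<^sub>R u + h *\<^sub>R w) - f (x + s *\<^sub>R u + 0 *\<^sub>R w)) has_real_derivative
      fderiv f (x + s *\<^sub>R u + h *\<^sub>R w) u - fderiv f (x + s *\<^sub>R u + 0 *\<^sub>R w) u) (at s)"
    if "0 \<le> s" "s \<le> h" for s
    using that h0 by (intro DERIV_diff df) auto
  obtain s where s: "0 < s" "s < h" and es:
    "(f (x + h *\<^sub>R u + h *\<^sub>R w) - f (x + h *\<^sub>R u + 0 *\<^sub>R w))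
      - (f (x + 0 *\<^sub>R u + h *\<^sub>R w) - f (x + 0 *\<^sub>R u + 0 *\<^sub>R w))
     = (h - 0) * (fderiv f (x + s *\<^sub>R u + h *\<^sub>R w) u - fderiv f (x + s *\<^sub>R u + 0 *\<^sub>R w) u)"
    using MVT2[OF assms(2) df2] by blast
  obtain t where t: "0 < t" "t < h" and et:
    "fderiv f (x + s *\<^sub>R u + h *\<^sub>R w) u - fderiv f (x + s *\<^sub>R u + 0 *\<^sub>R w) u
      = (h - 0) * fderiv (\<lambda>y. fderiv f y u) (x + s *\<^sub>R u + t *\<^sub>R w) w"
    using MVT2[OF assms(2), of "\<lambda>t. fderiv f (x + s *\<^sub>R u + t *\<^sub>R w) u"
        "\<lambda>t. fderiv (\<lambda>y. fderiv f y u) (x + s *\<^sub>R u + t *\<^sub>R w) w"]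
      dg s by auto
  show ?thesis
    using s t es et by (intro exI[of _ s] exI[of _ t]) (simp add: algebra_simps)
qed

lemma second_derivative_symmetric_real:
  fixes f :: "'a::euclidean_space \<Rightarrow> real"
  assumes "open S" "smooth_on S f" "x \<in> S"
  shows "fderiv (\<lambda>y. fderiv f y u) x w = fderiv (\<lambda>y. fderiv f y w) x u"
proof (rule ccontr)
  let ?A = "\<lambda>z. fderiv (\<lambda>y. fderiv f y u) z w"
  let ?B = "\<lambda>z. fderiv (\<lambda>y. fderiv f y w) z u"
  assume ne: "?A x \<noteq> ?B x"
  \<comment> \<open>Half the gap: values of the two mixed derivatives within \<open>e\<close> of
    their values at \<open>x\<close> cannot be equal.\<close>
  define e where "e = \<bar>?A x - ?B x\<bar> / 2"
  have e: "e > 0" using ne by (simp add: e_def)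
  have "isCont ?A x" "isCont ?B x"
    using smooth_on_continuous[OF smooth_on_fderiv[OF smooth_on_fderiv[OF assms(2)]]] assms(1,3)
    by (auto simp: continuous_on_eq_continuous_at)
  then obtain d1 d2 where d: "d1 > 0" "\<And>z. dist z x < d1 \<Longrightarrow> dist (?A z) (?A x) < e"
    "d2 > 0" "\<And>z. dist z x < d2 \<Longrightarrow> dist (?B z) (?B x) < e"
    using e unfolding continuous_at_eps_delta by metis
  obtain r0 where r0: "r0 > 0" "ball x r0 \<subseteq> S"
    using assms(1,3) by (meson open_contains_ball)
  define r where "r = min r0 (min d1 d2)"
  have r: "r > 0" "r \<le> d1" "r \<le> d2" "ball x r \<subseteq> S"
    using d r0 by (auto simp: r_def)
  \<comment> \<open>Keeps the parallelogram spanned by \<open>h *\<^sub>R u\<close> and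
    \<open>h *\<^sub>R w\<close> inside the ball of radius \<open>r\<close>; the summand 1 keeps the
    denominator positive when both vectors vanish.\<close>
  define h where "h = r / (norm u + norm w + 1)"
  have np: "0 < norm u + norm w + 1"
    by (simp add: add_nonneg_pos)
  have h: "h > 0"
    using r np by (simp add: h_def)
  have "h * (norm u + norm w) < h * (norm u + norm w + 1)"
    using h by simp
  also have "\<dots> = r" using np by (simp add: h_def)
  finally have hr: "h * (norm u + norm w) < r" .
  then have hr': "h * (norm w + norm u) < r" by (simp add: add.commute)
  note sm = smooth_on_subset[OF assms(2) r(4)]
  have close: "dist (x + s *\<^sub>R u + t *\<^sub>R w) x < r" if "0 < s" "s < h" "0 < t" "t < h" for s t
  proof -
    have "norm (s *\<^sub>R u + t *\<^sub>R w) \<le> s * norm u + t * norm w"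
      using that by (metis abs_of_nonneg less_imp_le norm_scaleR norm_triangle_ineq)
    also have "\<dots> \<le> h * (norm u + norm w)"
      using that by (simp add: distrib_left add_mono mult_right_mono)
    finally show ?thesis using hr by (simp add: dist_norm add.assoc)
  qed
  obtain s t where st: "0 < s" "s < h" "0 < t" "t < h" and A:
    "f (x + h *\<^sub>R u + h *\<^sub>R w) - f (x + h *\<^sub>R u) - f (x + h *\<^sub>R w) + f x
      = h * h * ?A (x + s *\<^sub>R u + t *\<^sub>R w)"
    using second_difference_mvt[OF sm h hr] by blast
  obtain s' t' where st': "0 < s'" "s' < h" "0 < t'" "t' < h" and B:
    "f (x + h *\<^sub>R w + h *\<^sub>R u) - f (x + h *\<^sub>R w) - f (x + h *\<^sub>R u) + f x
      = h * h * ?B (x + s' *\<^sub>R w + t' *\<^sub>R u)"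
    using second_difference_mvt[OF sm h hr'] by blast
  have "?A (x + s *\<^sub>R u + t *\<^sub>R w) = ?B (x + t' *\<^sub>R u + s' *\<^sub>R w)"
  proof -
    have sw: "x + h *\<^sub>R w + h *\<^sub>R u = x + h *\<^sub>R u + h *\<^sub>R w"
      "x + s' *\<^sub>R w + t' *\<^sub>R u = x + t' *\<^sub>R u + s' *\<^sub>R w"
      by simp_all
    have "h * h * ?A (x + s *\<^sub>R u + t *\<^sub>R w) = h * h * ?B (x + t' *\<^sub>R u + s' *\<^sub>R w)"
      using A B[unfolded sw] by linarith
    then show ?thesis using h by simp
  qed
  moreover have "\<bar>?A (x + s *\<^sub>R u + t *\<^sub>R w) - ?A x\<bar> < e"
    using d(2) close[OF st] r unfolding dist_real_def by (meson less_le_trans)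
  moreover have "\<bar>?B (x + t' *\<^sub>R u + s' *\<^sub>R w) - ?B x\<bar> < e"
    using d(4) close[OF st'(3,4,1,2)] r unfolding dist_real_def by (meson less_le_trans)
  ultimately show False
    unfolding e_def abs_if by (auto split: if_splits)
qed

lemma second_derivative_symmetric:
  assumes "open S" "smooth_on S f" "x \<in> S"
  shows "fderiv (\<lambda>y. fderiv f y u) x w = fderiv (\<lambda>y. fderiv f y w) x u"
proof (rule euclidean_eqI)
  fix b :: 'b assume "b \<in> Basis"
  have sm: "smooth_on S (\<lambda>y. f y \<bullet> b)"
    by (intro smooth_on_linear_comp[OF assms(1) bounded_linear_inner_left] assms)
  have 1: "fderiv (\<lambda>y. g y \<bullet> b) z v = fderiv g z v \<bullet> b" if "smooth_on S g" "z \<in> S" for g :: "'a \<Rightarrow> 'b" and z v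
    using fderiv_eqI[OF bounded_linear.has_derivative[OF bounded_linear_inner_left
          smooth_on_has_derivative[OF that]]] by metis
  have 2: "fderiv (\<lambda>y. fderiv f y v \<bullet> b) x v' = fderiv (\<lambda>y. fderiv (\<lambda>y. f y \<bullet> b) y v) x v'" for v v'
    by (rule fun_cong[OF fderiv_cong_open[OF assms(1,3)]]) (simp add: 1[OF assms(2)])
  show "fderiv (\<lambda>y. fderiv f y u) x w \<bullet> b = fderiv (\<lambda>y. fderiv f y w) x u \<bullet> b"
    using second_derivative_symmetric_real[OF assms(1) sm assms(3), of u w]
    unfolding 1[OF smooth_on_fderiv[OF assms(2)] assms(3), symmetric] 2 .
qed

subsection \<open>The Poincare lemma\<close>

text \<open>The primitive is the line integral of \<alpha> along the segment from a fixed point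
  \<open>a\<close> to \<open>x\<close>, differentiated under the integral sign.\<close>

lemma poincare_lemma:
  fixes \<alpha> :: "'a::euclidean_space \<Rightarrow> 'a"
  assumes S: "open S" "convex S" and sm: "smooth_on S \<alpha>"
    and sym: "\<And>x u w. x \<in> S \<Longrightarrow> fderiv \<alpha> x u \<bullet> w = fderiv \<alpha> x w \<bullet> u"
  shows "\<exists>l. smooth_on S l \<and> (\<forall>x\<in>S. (l has_derivative (\<lambda>u. \<alpha> x \<bullet> u)) (at x))"
proof (cases "S = {}")
  case True
  then show ?thesis using smooth_on_const by blast
next
  case False
  then obtain a where a: "a \<in> S" by blast
  define z where "z x t = a + t *\<^sub>R (x - a)" for x and t :: real
  \<comment> \<open>By the symmetry of the derivative of \<alpha>, this is the gradient in
    \<open>x\<close> of the integrand; it is also the derivative in \<open>t\<close> of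
    \<open>t *\<^sub>R \<alpha> (z x t)\<close>. The coincidence of the two is the proof.\<close>
  define V where "V x t = t *\<^sub>R fderiv \<alpha> (z x t) (x - a) + \<alpha> (z x t)" for x t
  define l where "l x = integral (cbox 0 1) (\<lambda>t. \<alpha> (z x t) \<bullet> (x - a))" for x
  have zS: "z x t \<in> S" if "x \<in> S" "t \<in> cbox 0 1" for x t
  proof -
    have "z x t = (1 - t) *\<^sub>R a + t *\<^sub>R x"
      by (simp add: z_def algebra_simps)
    then show ?thesis
      using S(2) a that by (simp add: convex_alt)
  qed
  have contz: "continuous_on (S \<times> cbox 0 1) (\<lambda>(x, t). z x t)"
    unfolding z_def split_beta by (intro continuous_intros)
  have cont_\<alpha>: "continuous_on (S \<times> cbox 0 1) (\<lambda>(x, t). \<alpha> (z x t))"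
    using continuous_on_compose2[OF smooth_on_continuous[OF sm] contz] zS
    unfolding split_beta by fastforce
  have cont_V: "continuous_on (S \<times> cbox 0 1) (\<lambda>(x, t). V x t)"
  proof -
    have "continuous_on (S \<times> UNIV) (\<lambda>(x, v). fderiv \<alpha> x v)"
      unfolding split_beta
      by (intro smooth_on_continuous smooth_on_fderiv_apply[OF _ S(1) sm] open_Times S smooth_on_fst
          smooth_on_snd) auto
    then have "continuous_on (S \<times> cbox 0 1) (\<lambda>p. fderiv \<alpha> (z (fst p) (snd p)) (fst p - a))"
      using contz zS
      by (intro continuous_on_compose2[of "S \<times> UNIV" "\<lambda>(x, v). fderiv \<alpha> x v" "S \<times> cbox 0 1"
          "\<lambda>p. (z (fst p) (snd p), fst p - a)", simplified split_beta fst_conv snd_conv])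
        (auto simp: split_beta intro!: continuous_intros)
    then show ?thesis
      using cont_\<alpha> unfolding V_def split_beta by (intro continuous_intros)
  qed
  have d: "((\<lambda>x. \<alpha> (z x t) \<bullet> (x - a)) has_derivative blinfun_inner_right (V x t)) (at x within S)"
    if x: "x \<in> S" and t: "t \<in> cbox 0 1" for x t
  proof -
    note zx = zS[OF that]
    have "((\<lambda>x. z x t) has_derivative (\<lambda>u. t *\<^sub>R u)) (at x)"
      unfolding z_def by (auto intro!: derivative_eq_intros)
    from has_derivative_compose[OF this smooth_on_has_derivative[OF sm zx]]
    have "((\<lambda>x. \<alpha> (z x t)) has_derivative (\<lambda>u. fderiv \<alpha> (z x t) (t *\<^sub>R u))) (at x)" .
    then have "((\<lambda>x. \<alpha> (z x t) \<bullet> (x - a)) has_derivative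
        (\<lambda>u. \<alpha> (z x t) \<bullet> u + fderiv \<alpha> (z x t) (t *\<^sub>R u) \<bullet> (x - a))) (at x)"
      by (rule has_derivative_inner[THEN has_derivative_eq_rhs])
        (auto intro!: derivative_eq_intros)
    \<comment> \<open>Closedness enters here: it moves \<open>u\<close> out of the derivative, so
      that the integrand has a gradient.\<close>
    moreover have "fderiv \<alpha> (z x t) (t *\<^sub>R u) \<bullet> (x - a) = t *\<^sub>R fderiv \<alpha> (z x t) (x - a) \<bullet> u" for u
      using sym[OF zx, of u "x - a"] linear_scale[OF smooth_on_linear_fderiv[OF sm zx]] by simp
    ultimately have "((\<lambda>x. \<alpha> (z x t) \<bullet> (x - a)) has_derivative blinfun_inner_right (V x t)) (at x)"
      by (elim has_derivative_eq_rhs) (simp add: V_def inner_add_left fun_eq_iff)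
    then show ?thesis by (rule has_derivative_at_withinI)
  qed
  have dl: "(l has_derivative (\<lambda>u. \<alpha> x \<bullet> u)) (at x)" if x: "x \<in> S" for x
  proof -
    have ci: "continuous_on (cbox 0 1) (\<lambda>t. \<alpha> (z x t) \<bullet> (x - a))" if "x \<in> S" for x
    proof -
      have "continuous_on (cbox 0 1) (\<lambda>t. \<alpha> (z x t))"
        using that
        by (intro continuous_on_compose2[OF cont_\<alpha>, of "cbox 0 1" "\<lambda>t. (x, t)", simplified split_conv])
          (auto intro!: continuous_intros)
      then show ?thesis by (intro continuous_intros)
    qed
    have cV: "continuous_on (cbox 0 1) (V x)"
      using x
      by (intro continuous_on_compose2[OF cont_V, of "cbox 0 1" "\<lambda>t. (x, t)", simplified split_conv])
        (auto intro!: continuous_intros)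
    have "(l has_derivative integral (cbox 0 1) (\<lambda>t. blinfun_inner_right (V x t))) (at x within S)"
      unfolding l_def
      by (rule leibniz_rule[OF d integrable_continuous[OF ci] _ x S(2)])
        (use bounded_linear.continuous_on[OF bounded_linear_blinfun_inner_right cont_V]
          in \<open>auto simp: split_beta\<close>)
    \<comment> \<open>The fundamental theorem of calculus for
      \<open>t *\<^sub>R \<alpha> (z x t)\<close>, which is 0 at \<open>t = 0\<close> and
      \<open>\<alpha> x\<close> at \<open>t = 1\<close>.\<close>
    moreover have "integral (cbox 0 1) (\<lambda>t. blinfun_inner_right (V x t)) = blinfun_inner_right (\<alpha> x)"
    proof -
      have "((\<lambda>t. t *\<^sub>R \<alpha> (z x t)) has_vector_derivative V x t) (at t within {0..1})"
        if t: "t \<in> {0..1}" for t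
      proof -
        have zx: "z x t \<in> S" using zS[OF x] t by simp
        have "((\<lambda>t. z x t) has_derivative (\<lambda>s. s *\<^sub>R (x - a))) (at t)"
          unfolding z_def by (auto intro!: derivative_eq_intros)
        from has_derivative_compose[OF this smooth_on_has_derivative[OF sm zx]]
        have "((\<lambda>t. \<alpha> (z x t)) has_derivative (\<lambda>s. fderiv \<alpha> (z x t) (s *\<^sub>R (x - a)))) (at t)" .
        then have "((\<lambda>t. t *\<^sub>R \<alpha> (z x t)) has_derivative
            (\<lambda>s. t *\<^sub>R fderiv \<alpha> (z x t) (s *\<^sub>R (x - a)) + s *\<^sub>R \<alpha> (z x t))) (at t)"
          by (auto intro!: derivative_eq_intros)
        then have "((\<lambda>t. t *\<^sub>R \<alpha> (z x t)) has_vector_derivative V x t) (at t)"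
          unfolding has_vector_derivative_def V_def
          by (elim has_derivative_eq_rhs)
            (simp add: fun_eq_iff linear_scale[OF smooth_on_linear_fderiv[OF sm zx]] scaleR_add_right
              mult.commute)
        then show ?thesis by (rule has_vector_derivative_at_within)
      qed
      from fundamental_theorem_of_calculus[OF _ this]
      have "(V x has_integral \<alpha> x) (cbox 0 1)"
        by (simp add: z_def)
      then have "((\<lambda>t. blinfun_inner_right (V x t)) has_integral blinfun_inner_right (\<alpha> x)) (cbox 0 1)"
        by (drule_tac has_integral_linear[OF _ bounded_linear_blinfun_inner_right]) (simp add: comp_def)
      then show ?thesis by (rule integral_unique)
    qed
    ultimately show ?thesis
      using at_within_open[OF x S(1)] by (simp add: blinfun_inner_right.rep_eq)
  qed
  moreover have "smooth_on S l"
    by (rule smooth_on_has_derivativeI[OF S(1) dl])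
      (auto intro!: smooth_on_linear_comp[OF S(1) bounded_linear_inner_left sm])
  ultimately show ?thesis by blast
qed

subsection \<open>The inverse function theorem for fibred maps\<close>

lemma smooth_on_prod:
  fixes f :: "'i \<Rightarrow> 'a::euclidean_space \<Rightarrow> real"
  assumes "open S" "\<And>i. i \<in> I \<Longrightarrow> smooth_on S (f i)"
  shows "smooth_on S (\<lambda>x. \<Prod>i\<in>I. f i x)"
  using assms(2)
  by (induction I rule: infinite_finite_induct)
    (auto simp: smooth_on_const intro!: smooth_on_bilinear[OF assms(1) bounded_bilinear_mult])

lemma smooth_on_vec_lambda:
  fixes f :: "'n::finite \<Rightarrow> 'a::euclidean_space \<Rightarrow> real"
  assumes "open S" "\<And>i. smooth_on S (f i)"
  shows "smooth_on S (\<lambda>x. \<chi> i. f i x)"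
proof -
  have "smooth_on S (\<lambda>x. \<Sum>i\<in>UNIV. f i x *\<^sub>R (axis i 1 :: real^'n))"
    by (intro smooth_on_sum smooth_on_bilinear[OF assms(1) bounded_bilinear_scaleR] assms smooth_on_const)
  moreover have "(\<Sum>i\<in>UNIV. f i x *\<^sub>R (axis i 1 :: real^'n)) = (\<chi> i. f i x)" for x
    by (simp add: vec_eq_iff axis_def if_distrib cong: if_cong)
  ultimately show ?thesis by simp
qed

lemma smooth_on_det:
  fixes A :: "'a::euclidean_space \<Rightarrow> real^'n^'n"
  assumes "open S" "\<And>i j. smooth_on S (\<lambda>x. A x $ i $ j)"
  shows "smooth_on S (\<lambda>x. det (A x))"
  unfolding det_def
  by (intro smooth_on_sum smooth_on_bilinear[OF assms(1) bounded_bilinear_mult] smooth_on_prod assms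
      smooth_on_const)

lemma smooth_on_divide:
  fixes f g :: "'a::euclidean_space \<Rightarrow> real"
  assumes "open S" "smooth_on S f" "smooth_on S g" "\<And>x. x \<in> S \<Longrightarrow> g x \<noteq> 0"
  shows "smooth_on S (\<lambda>x. f x / g x)"
proof -
  have "open {x::real. x \<noteq> 0}"
    by (rule open_Collect_neq) (auto intro: continuous_intros)
  then have "smooth_on S (\<lambda>x. inverse (g x))"
    using assms Ck_on_inverse
    by (intro smooth_on_compose[of S "{x. x \<noteq> 0}" g inverse]) (auto simp: smooth_on_def)
  then show ?thesis
    unfolding divide_inverse by (intro smooth_on_bilinear[OF assms(1) bounded_bilinear_mult] assms)
qed

text \<open>The derivative of \<open>F\<close> is block triangular with the identity on the base, so
  it is injective as soon as the fibre block is. The inverse function theorem gives a differentiable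
  inverse \<open>g\<close>; its smoothness is bootstrapped from the fact that the derivative of
  \<open>g\<close> at \<open>z\<close> is a smooth function of \<open>g z\<close>.\<close>

lemma fibred_inverse_function_theorem:
  fixes f :: "(real^'n) \<times> (real^'n) \<Rightarrow> real^'n"
  assumes S: "open S" and sm: "smooth_on S f" and y0: "y0 \<in> S"
    and inj: "\<And>b. fderiv f y0 (0, b) = 0 \<Longrightarrow> b = 0"
  defines "F \<equiv> \<lambda>y. (fst y, f y)"
  shows "\<exists>U V g. open U \<and> y0 \<in> U \<and> U \<subseteq> S \<and> open V \<and> F ` U = V \<and> g ` V = U \<and>
    (\<forall>y\<in>U. g (F y) = y) \<and> (\<forall>z\<in>V. F (g z) = z) \<and> smooth_on V g"
proof -
  define A where "A y = (\<chi> i j. fderiv f y (0, axis j 1) $ i)" for y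
  have A: "A y *v b = fderiv f y (0, b)" if "y \<in> S" for y b
  proof -
    have "bounded_linear (\<lambda>b::real^'n. (0::real^'n, b))"
      by (intro bounded_linear_intros)
    then have "linear (\<lambda>b. fderiv f y (0, b))"
      using linear_compose[of "\<lambda>b. (0, b)", OF bounded_linear.linear smooth_on_linear_fderiv[OF sm that]]
      by (simp add: comp_def)
    then have "matrix (\<lambda>b. fderiv f y (0, b)) *v b = fderiv f y (0, b)"
      by (simp add: matrix_works)
    then show ?thesis by (simp add: A_def matrix_def)
  qed
  have smA: "smooth_on S (\<lambda>y. A y $ i $ j)" for i j
    unfolding A_def using smooth_on_linear_comp[OF S bounded_linear_vec_nth smooth_on_fderiv[OF sm]] by simp
  note smdet = smooth_on_det[of S A, OF S smA]
  \<comment> \<open>On this open set the quotients of Cramer's rule are defined and smooth.\<close>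
  define T where "T = {y \<in> S. det (A y) \<noteq> 0}"
  have "T = S \<inter> (\<lambda>y. det (A y)) -` {x. x \<noteq> 0}"
    by (auto simp: T_def)
  moreover have "open {x::real. x \<noteq> 0}"
    by (rule open_Collect_neq) (auto intro: continuous_intros)
  ultimately have T: "open T"
    using continuous_open_preimage[OF smooth_on_continuous[OF smdet] S] by metis
  have TS: "T \<subseteq> S" by (auto simp: T_def)
  have "inj ((*v) (A y0))"
    unfolding linear_inj_iff_eq_0[OF matrix_vector_mul_linear] using inj A[OF y0] by simp
  then have "det (A y0) \<noteq> 0"
    by (simp flip: invertible_det_nz add: invertible_left_inverse matrix_left_invertible_injective)
  then have y0T: "y0 \<in> T" using y0 by (simp add: T_def)
  have dF: "(F has_derivative (\<lambda>v. (fst v, fderiv f y v))) (at y)" if "y \<in> S" for y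
    unfolding F_def
    by (rule has_derivative_Pair[OF has_derivative_fst[OF has_derivative_ident]
          smooth_on_has_derivative[OF sm that]])
  have bl: "bounded_linear (\<lambda>v. (fst v, fderiv f y v))" if "y \<in> S" for y
    using dF[OF that] by (rule has_derivative_bounded_linear)
  define F' where "F' y = Blinfun (\<lambda>v. (fst v, fderiv f y v))" for y
  have F': "blinfun_apply (F' y) = (\<lambda>v. (fst v, fderiv f y v))" if "y \<in> S" for y
    unfolding F'_def using bl[OF that] by (rule bounded_linear_Blinfun_apply)
  have contF': "continuous_on T F'"
  proof (rule continuous_on_blinfun_componentwise)
    fix i :: "(real^'n) \<times> (real^'n)"
    have "continuous_on T (\<lambda>y. (fst i, fderiv f y i))"
      by (intro continuous_intros continuous_on_subset[OF _ TS] smooth_on_continuous smooth_on_fderiv sm)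
    then show "continuous_on T (\<lambda>y. blinfun_apply (F' y) i)"
      by (rule continuous_on_eq) (metis F' TS subsetD)
  qed
  have "inj (blinfun_apply (F' y0))"
    unfolding linear_inj_iff_eq_0[OF bounded_linear.linear[OF blinfun.bounded_linear_right]]
    using inj by (auto simp: F'[OF y0] zero_prod_def) 
  then obtain h where h: "linear h" "h \<circ> blinfun_apply (F' y0) = id"
    using linear_injective_left_inverse[OF bounded_linear.linear[OF blinfun.bounded_linear_right]] by blast
  have Bl: "Blinfun h o\<^sub>L F' y0 = id_blinfun"
    using h by (intro blinfun_eqI)
      (simp add: bounded_linear_Blinfun_apply linear_conv_bounded_linear pointfree_idE)
  have dF': "(F has_derivative blinfun_apply (F' y)) (at y)" if "y \<in> T" for y
    unfolding F'[OF subsetD[OF TS that]] by (rule dF[OF subsetD[OF TS that]])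
  obtain U V g g' where U: "open U" "U \<subseteq> T" "y0 \<in> U" "open V" "F y0 \<in> V" "homeomorphism U V F g"
    and g': "\<And>z. z \<in> V \<Longrightarrow> (g has_derivative g' z) (at z)"
      "\<And>z. z \<in> V \<Longrightarrow> g' z = inv (blinfun_apply (F' (g z)))"
      "\<And>z. z \<in> V \<Longrightarrow> bij (blinfun_apply (F' (g z)))"
    by (rule inverse_function_theorem[OF T dF' contF' y0T Bl]) (assumption, blast intro: that)
  have gV: "g z \<in> T" if "z \<in> V" for z
    using U that by (auto simp: homeomorphism_def)
  \<comment> \<open>The solution of the linear system with derivative of \<open>F\<close> at
    \<open>y\<close> and right side \<open>w\<close>: the base part is read off, and the fibre part
    solves \<open>A y *v b = snd w - fderiv f y (fst w, 0)\<close> by Cramer's rule.\<close>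
  define \<Phi> where "\<Phi> w y = (fst w, (\<chi> k. det (\<chi> i j. if j = k then (snd w - fderiv f y (fst w, 0)) $ i
      else A y $ i $ j) / det (A y)))" for w y
  have sm\<Phi>: "smooth_on T (\<Phi> w)" for w
  proof -
    have "smooth_on T (\<lambda>y. (\<chi> i j. if j = k then (snd w - fderiv f y (fst w, 0)) $ i
      else A y $ i $ j) $ i $ j)" for i j k
      using smA[of i j]
      by (cases "j = k")
        (auto intro!: smooth_on_subset[OF _ TS] smooth_on_diff smooth_on_const S
          smooth_on_linear_comp[OF S bounded_linear_vec_nth] smooth_on_fderiv sm simp flip: vector_minus_component)
    then show ?thesis
      unfolding \<Phi>_def
      by (intro smooth_on_Pair smooth_on_vec_lambda smooth_on_divide smooth_on_det T smooth_on_const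
          smooth_on_subset[OF smdet TS]) (auto simp: T_def)
  qed
  have g'\<Phi>: "g' z w = \<Phi> w (g z)" if "z \<in> V" for z w
  proof -
    have gS: "g z \<in> S" using gV[OF that] TS by blast
    define v where "v = g' z w"
    have "blinfun_apply (F' (g z)) v = w"
      unfolding v_def g'(2)[OF that] using g'(3)[OF that] by (simp add: bij_is_surj surj_f_inv_f)
    then have "fst v = fst w" and v2: "fderiv f (g z) v = snd w"
      by (auto simp: F'[OF gS])
    then have "v = (fst w, 0) + (0, snd v)"
      by (simp add: prod_eq_iff)
    then have "fderiv f (g z) (fst w, 0) + fderiv f (g z) (0, snd v) = snd w"
      using v2 linear_add[OF smooth_on_linear_fderiv[OF sm gS], of "(fst w, 0)" "(0, snd v)"] by simp
    then have "A (g z) *v snd v = snd w - fderiv f (g z) (fst w, 0)"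
      using A[OF gS] by (simp add: algebra_simps)
    moreover have "det (A (g z)) \<noteq> 0"
      using gV[OF that] by (simp add: T_def)
    ultimately have "snd v = (\<chi> k. det (\<chi> i j. if j = k then (snd w - fderiv f (g z) (fst w, 0)) $ i
      else A (g z) $ i $ j) / det (A (g z)))"
      using cramer by blast
    then show ?thesis
      using \<open>fst v = fst w\<close> by (simp add: \<Phi>_def prod_eq_iff v_def)
  qed
  \<comment> \<open>If \<open>g\<close> is of class C^k, so is its derivative
    \<open>\<Phi> w (g z)\<close>, hence \<open>g\<close> is of class C^(k+1).\<close>
  have "Ck_on k V g" for k
  proof (induction k)
    case 0
    then show ?case using U by (simp add: homeomorphism_def)
  next
    case (Suc k)
    show ?case
    proof (rule Ck_on_Suc_has_derivativeI[OF U(4) g'(1)])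
      show "Ck_on k V (\<lambda>z. g' z w)" for w
        by (rule Ck_on_cong[OF U(4) _ Ck_on_compose[OF U(4) T _ Suc smooth_onD[OF sm\<Phi>[of w]]]])
          (use gV g'\<Phi> in auto)
    qed
  qed
  then have "smooth_on V g" by (simp add: smooth_on_def)
  then show ?thesis
    using U TS unfolding homeomorphism_def by (metis (no_types, lifting) order_trans)
qed

section \<open>Smooth atlases\<close>

abbreviation cimg :: "('p, 'e, 'i) manifold \<Rightarrow> 'i \<Rightarrow> 'e set" where
  "cimg M i \<equiv> cmap M i ` cdom M i"

abbreviation overlap :: "('p, 'e, 'i) manifold \<Rightarrow> 'i \<Rightarrow> 'i \<Rightarrow> 'e set" where
  "overlap M i j \<equiv> cmap M i ` (cdom M i \<inter> cdom M j)"

text \<open>The part of \<open>smooth_manifold\<close> that does not concern the Hausdorff property and countability; it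
  passes to tangent and cotangent bundles by chart computations alone.\<close>

locale smooth_atlas =
  fixes M :: "('p, 'e::euclidean_space, 'i) manifold"
  assumes cover: "(\<Union>i\<in>idx M. cdom M i) = pts M"
    and inj_cmap: "i \<in> idx M \<Longrightarrow> inj_on (cmap M i) (cdom M i)"
    and open_overlap: "i \<in> idx M \<Longrightarrow> j \<in> idx M \<Longrightarrow> open (overlap M i j)"
    and smooth_transition: "i \<in> idx M \<Longrightarrow> j \<in> idx M \<Longrightarrow>
      smooth_on (overlap M i j) (transition M i j)"

lemma smooth_manifold_imp_atlas: "smooth_manifold M \<Longrightarrow> smooth_atlas M"
  unfolding smooth_manifold_def smooth_atlas_def by blast

context smooth_atlas
begin

lemma cdom_subset: "i \<in> idx M \<Longrightarrow> cdom M i \<subseteq> pts M"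
  using cover by blast

lemma ex_chart: "p \<in> pts M \<Longrightarrow> \<exists>i. i \<in> charts_at M p"
  using cover by (auto simp: charts_at_def)

lemma chart_at_mem: "p \<in> pts M \<Longrightarrow> chart_at M p \<in> charts_at M p"
  unfolding chart_at_def by (rule someI_ex[OF ex_chart])

lemma open_cimg: "i \<in> idx M \<Longrightarrow> open (cimg M i)"
  using open_overlap[of i i] by simp

lemma cinv_cmap: "i \<in> idx M \<Longrightarrow> p \<in> cdom M i \<Longrightarrow> cinv M i (cmap M i p) = p"
  unfolding cinv_def by (rule inv_into_f_f[OF inj_cmap])

lemma cmap_cinv: "y \<in> cimg M i \<Longrightarrow> cmap M i (cinv M i y) = y"
  unfolding cinv_def by (rule f_inv_into_f)

lemma cinv_mem: "y \<in> cimg M i \<Longrightarrow> cinv M i y \<in> cdom M i"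
  unfolding cinv_def by (rule inv_into_into)

lemma cinv_image:
  assumes "S \<subseteq> cimg M i"
  shows "cinv M i ` S \<subseteq> cdom M i" "cmap M i ` cinv M i ` S = S"
proof -
  show "cinv M i ` S \<subseteq> cdom M i" using assms cinv_mem by blast
  have "(\<lambda>y. cmap M i (cinv M i y)) ` S = (\<lambda>y. y) ` S"
    using assms by (intro image_cong) (auto simp: cmap_cinv[OF subsetD[OF assms]])
  then show "cmap M i ` cinv M i ` S = S" by (simp add: image_image)
qed

lemma image_Int_cdom:
  "i \<in> idx M \<Longrightarrow> cmap M i ` (S \<inter> T \<inter> cdom M i) = cmap M i ` (S \<inter> cdom M i) \<inter> cmap M i ` (T \<inter> cdom M i)"
  using inj_cmap[of i] by (auto simp: inj_on_def)

lemma transition_cmap: "i \<in> idx M \<Longrightarrow> p \<in> cdom M i \<Longrightarrow> transition M i j (cmap M i p) = cmap M j p"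
  by (simp add: transition_def cinv_cmap)

text \<open>\<open>topology\<close> can be unfolded once the predicate is known to be a topology;
  closure under intersections rests on the injectivity of the charts.\<close>

lemma openin_iff: "openin (mtop M) W \<longleftrightarrow> W \<subseteq> pts M \<and> (\<forall>i\<in>idx M. open (cmap M i ` (W \<inter> cdom M i)))"
proof -
  have "istopology (\<lambda>W. W \<subseteq> pts M \<and> (\<forall>i\<in>idx M. open (cmap M i ` (W \<inter> cdom M i))))"
    unfolding istopology_def
  proof (intro conjI allI impI)
    fix S T
    assume "S \<subseteq> pts M \<and> (\<forall>i\<in>idx M. open (cmap M i ` (S \<inter> cdom M i)))"
      and "T \<subseteq> pts M \<and> (\<forall>i\<in>idx M. open (cmap M i ` (T \<inter> cdom M i)))"
    then show "S \<inter> T \<subseteq> pts M" "\<forall>i\<in>idx M. open (cmap M i ` (S \<inter> T \<inter> cdom M i))"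
      by (auto simp: image_Int_cdom)
  next
    fix K
    assume *: "\<forall>S\<in>K. S \<subseteq> pts M \<and> (\<forall>i\<in>idx M. open (cmap M i ` (S \<inter> cdom M i)))"
    have "cmap M i ` (\<Union>K \<inter> cdom M i) = (\<Union>S\<in>K. cmap M i ` (S \<inter> cdom M i))" for i
      by blast
    then show "\<Union>K \<subseteq> pts M" "\<forall>i\<in>idx M. open (cmap M i ` (\<Union>K \<inter> cdom M i))"
      using * by auto
  qed
  then show ?thesis
    by (simp add: mtop_def topology_inverse')
qed

lemma openin_cdom: "i \<in> idx M \<Longrightarrow> openin (mtop M) (cdom M i)"
  unfolding openin_iff using cdom_subset open_overlap by (metis Int_commute)

lemma openin_pts: "openin (mtop M) (pts M)"
  unfolding openin_iff using open_cimg cdom_subset by (simp add: Int_absorb1)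

lemma transition_self: "i \<in> idx M \<Longrightarrow> y \<in> cimg M i \<Longrightarrow> transition M i i y = y"
  by (auto simp: transition_cmap)

lemma has_derivative_transition:
  assumes "i \<in> charts_at M p" "j \<in> charts_at M p"
  shows "(transition M i j has_derivative fderiv (transition M i j) (cmap M i p)) (at (cmap M i p))"
  using assms by (intro smooth_on_has_derivative[OF smooth_transition]) (auto simp: charts_at_def)

lemma fderiv_transition_self:
  assumes "i \<in> charts_at M p"
  shows "fderiv (transition M i i) (cmap M i p) v = v"
proof -
  have "fderiv (transition M i i) (cmap M i p) = fderiv (\<lambda>y. y) (cmap M i p)"
    using assms by (intro fderiv_cong_open[OF open_cimg]) (auto simp: charts_at_def transition_self)
  then show ?thesis by simp
qed

text \<open>The cocycle identity, by the chain rule. It is what lets a vector be prescribed by its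
  component in a single chart.\<close>

lemma fderiv_transition_trans:
  assumes "i \<in> charts_at M p" "j \<in> charts_at M p" "k \<in> charts_at M p"
  shows "fderiv (transition M j k) (cmap M j p) (fderiv (transition M i j) (cmap M i p) v)
    = fderiv (transition M i k) (cmap M i p) v"
proof -
  have ij: "i \<in> idx M" "j \<in> idx M" "k \<in> idx M" "p \<in> cdom M i" "p \<in> cdom M j" "p \<in> cdom M k"
    using assms by (auto simp: charts_at_def)
  have "fderiv (transition M i k) (cmap M i p) = fderiv (\<lambda>y. transition M j k (transition M i j y)) (cmap M i p)"
  proof (rule fderiv_cong_open)
    show "open (overlap M i j)"
      using open_overlap ij by blast
  qed (use ij in \<open>auto simp: transition_cmap\<close>)
  also have "\<dots> = (\<lambda>v. fderiv (transition M j k) (cmap M j p) (fderiv (transition M i j) (cmap M i p) v))"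
    using has_derivative_compose[OF has_derivative_transition[OF assms(1,2)]]
      has_derivative_transition[OF assms(2,3)] ij
    by (intro fderiv_eqI) (simp add: transition_cmap)
  finally show ?thesis by simp
qed

lemma linear_fderiv_transition:
  "i \<in> charts_at M p \<Longrightarrow> j \<in> charts_at M p \<Longrightarrow> linear (fderiv (transition M i j) (cmap M i p))"
  using has_derivative_transition has_derivative_linear by blast

end

subsection \<open>Open subsets\<close>

lemma open_sub_simps [simp]:
  "pts (open_sub M U) = pts M \<inter> U" "idx (open_sub M U) = idx M"
  "cdom (open_sub M U) i = cdom M i \<inter> U" "cmap (open_sub M U) = cmap M"
  by (simp_all add: open_sub_def)

lemma euclid_simps [simp]:
  "pts (euclid V) = V" "idx (euclid V) = {()}" "cdom (euclid V) i = V" "cmap (euclid V) i y = y"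
  by (simp_all add: euclid_def)

lemma open_sub_euclid: "open_sub (euclid UNIV) V = euclid V"
  by (simp add: open_sub_def euclid_def)

lemma charts_at_euclid [simp]: "y \<in> V \<Longrightarrow> charts_at (euclid V) y = {()}"
  by (auto simp: charts_at_def)

lemma chart_at_euclid [simp]: "chart_at (euclid V) y = ()"
  by (rule unit_eq)

lemma cinv_euclid: "y \<in> V \<Longrightarrow> cinv (euclid V) i y = y"
  unfolding cinv_def by (rule inv_into_f_eq) (auto simp: inj_on_def)

lemma smooth_atlas_euclid:
  assumes "open V"
  shows "smooth_atlas (euclid V)"
proof -
  have "smooth_on V (transition (euclid V) i j)" for i j
    by (rule smooth_on_cong[OF assms _ smooth_on_ident]) (simp add: transition_def cinv_euclid)
  then show ?thesis
    using assms by unfold_locales (auto simp: inj_on_def)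
qed

lemma charts_at_open_sub: "p \<in> U \<Longrightarrow> charts_at (open_sub M U) p = charts_at M p"
  by (simp add: charts_at_def)

text \<open>\<open>cinv\<close> is an \<open>inv_into\<close> on the chart domain, so shrinking the
  domain gives a formally different function; injectivity of the chart gives agreement on the
  smaller image.\<close>

lemma (in smooth_atlas) cinv_open_sub:
  assumes "i \<in> idx M" "y \<in> cmap M i ` (cdom M i \<inter> U)"
  shows "cinv (open_sub M U) i y = cinv M i y"
proof -
  obtain p where p: "p \<in> cdom M i" "p \<in> U" "y = cmap M i p"
    using assms by blast
  have "inj_on (cmap M i) (cdom M i \<inter> U)"
    using inj_cmap[OF assms(1)] by (rule inj_on_subset) auto
  then have "cinv (open_sub M U) i y = p"
    using p by (simp add: cinv_def)
  then show ?thesis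
    using p assms by (simp add: cinv_cmap)
qed

text \<open>Openness is asked of the trace on \<open>pts M\<close>, since \<open>U\<close> is later
  a preimage under \<open>fst\<close>, which also contains pairs that are not tangent
  vectors.\<close>

lemma (in smooth_atlas) atlas_open_sub:
  assumes U: "openin (mtop M) (pts M \<inter> U)"
  shows "smooth_atlas (open_sub M U)"
proof
  show "(\<Union>i\<in>idx (open_sub M U). cdom (open_sub M U) i) = pts (open_sub M U)"
    using cover by auto
next
  fix i assume "i \<in> idx (open_sub M U)"
  then show "inj_on (cmap (open_sub M U) i) (cdom (open_sub M U) i)"
    using inj_cmap[of i] by (auto intro: inj_on_subset)
next
  fix i j assume ij: "i \<in> idx (open_sub M U)" "j \<in> idx (open_sub M U)"
  let ?O = "cmap M i ` (cdom M i \<inter> cdom M j \<inter> U)"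
  have "?O = cmap M i ` (cdom M j \<inter> (pts M \<inter> U) \<inter> cdom M i)"
    using cdom_subset ij by (intro arg_cong[where f = "image (cmap M i)"]) auto
  also have "\<dots> = overlap M i j \<inter> cmap M i ` (pts M \<inter> U \<inter> cdom M i)"
    using ij by (subst image_Int_cdom) (auto simp: Int_commute)
  finally have o: "open ?O"
    using U open_overlap ij unfolding openin_iff by auto
  have eq: "overlap (open_sub M U) i j = ?O"
    by (rule image_cong) auto
  show "open (overlap (open_sub M U) i j)"
    using o unfolding eq .
  show "smooth_on (overlap (open_sub M U) i j)
      (transition (open_sub M U) i j)"
    unfolding eq
  proof (rule smooth_on_cong[OF o])
    show "smooth_on ?O (transition M i j)"
      using ij by (auto intro!: smooth_on_subset[OF smooth_transition])
    show "transition M i j y = transition (open_sub M U) i j y" if "y \<in> ?O" for y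
      using that ij cinv_open_sub[of i y U] by (auto simp: transition_def)
  qed
qed

subsection \<open>Smooth maps\<close>

text \<open>\<open>smooth_map\<close> quantifies over all pairs of charts. One pair per point
  suffices, because any other local representative is the given one composed with transition maps on
  both sides.\<close>

lemma smooth_mapI:
  assumes M: "smooth_atlas M" and N: "smooth_atlas N" and pts: "\<And>p. p \<in> pts M \<Longrightarrow> f p \<in> pts N"
    and rep: "\<And>p. p \<in> pts M \<Longrightarrow> \<exists>i j V. i \<in> charts_at M p \<and> j \<in> charts_at N (f p) \<and> open V \<and>
      cmap M i p \<in> V \<and> V \<subseteq> cimg M i \<and> f ` cinv M i ` V \<subseteq> cdom N j \<and>
      smooth_on V (local_rep M N f i j)"
  shows "smooth_map M N f"
  unfolding smooth_map_def
proof (intro conjI ballI)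
  show "f ` pts M \<subseteq> pts N" using pts by blast
  interpret M: smooth_atlas M by fact
  interpret N: smooth_atlas N by fact
  fix p i' j'
  assume p: "p \<in> pts M" and i': "i' \<in> charts_at M p" and j': "j' \<in> charts_at N (f p)"
  obtain i j V where i: "i \<in> charts_at M p" and j: "j \<in> charts_at N (f p)" and V: "open V"
    "cmap M i p \<in> V" "V \<subseteq> cimg M i" "f ` cinv M i ` V \<subseteq> cdom N j"
    and sm: "smooth_on V (local_rep M N f i j)"
    using rep[OF p] by blast
  have idx: "i \<in> idx M" "i' \<in> idx M" "j \<in> idx N" "j' \<in> idx N"
    and pc: "p \<in> cdom M i" "p \<in> cdom M i'" "f p \<in> cdom N j" "f p \<in> cdom N j'"
    using i i' j j' by (auto simp: charts_at_def)
  let ?On = "overlap N j j'" and ?Om = "overlap M i' i"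
  \<comment> \<open>\<open>V1\<close> is the part of \<open>V\<close> that is sent into the overlap
    of the two target charts, and \<open>V'\<close> is the same region seen in the source chart
    \<open>i'\<close>.\<close>
  define V1 where "V1 = V \<inter> local_rep M N f i j -` ?On"
  define V' where "V' = ?Om \<inter> transition M i' i -` V1"
  have V1: "open V1"
    unfolding V1_def by (rule continuous_open_preimage[OF smooth_on_continuous[OF sm] V(1)])
      (use N.open_overlap idx in blast)
  have oV': "open V'"
    unfolding V'_def
    by (rule continuous_open_preimage[OF smooth_on_continuous[OF M.smooth_transition] _ V1])
      (use M.open_overlap idx in blast)+
  have pV': "cmap M i' p \<in> V'"
    using pc idx V by (auto simp: V'_def V1_def M.transition_cmap local_rep_def M.cinv_cmap)
  \<comment> \<open>Membership in \<open>V1\<close> concerns only coordinates of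
    \<open>f p'\<close>; injectivity of the chart \<open>j\<close> is needed to conclude that the
    point \<open>f p'\<close> itself lies in the domain of \<open>j'\<close>.\<close>
  have V'p: "\<exists>p'. y = cmap M i' p' \<and> p' \<in> cdom M i \<and> p' \<in> cdom M i' \<and> f p' \<in> cdom N j
      \<and> f p' \<in> cdom N j' \<and> cmap M i p' \<in> V \<and> cmap M i p' \<in> V1" if y: "y \<in> V'" for y
  proof -
    obtain p' where p': "y = cmap M i' p'" "p' \<in> cdom M i" "p' \<in> cdom M i'" "cmap M i p' \<in> V1"
      using y idx by (auto simp: V'_def M.transition_cmap)
    then have "f p' \<in> cdom N j" "cmap M i p' \<in> V"
      using V(4) idx by (force simp: V1_def M.cinv_cmap)+
    moreover obtain q where "q \<in> cdom N j" "q \<in> cdom N j'" "cmap N j (f p') = cmap N j q"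
      using p' idx by (auto simp: V1_def local_rep_def M.cinv_cmap)
    ultimately have "f p' = q"
      using N.inj_cmap[OF idx(3)] by (auto simp: inj_on_def)
    then show ?thesis
      using p' \<open>q \<in> cdom N j'\<close> \<open>f p' \<in> cdom N j\<close> \<open>cmap M i p' \<in> V\<close> by blast
  qed
  have "smooth_on V' (local_rep M N f i' j')"
  proof (rule smooth_on_cong[OF oV'])
    have "smooth_on V1 (\<lambda>y. transition N j j' (local_rep M N f i j y))"
      by (rule smooth_on_compose[OF V1 N.open_overlap[OF idx(3,4)] _ smooth_on_subset[OF sm]
            N.smooth_transition[OF idx(3,4)]]) (auto simp: V1_def)
    then show "smooth_on V' (\<lambda>y. transition N j j' (local_rep M N f i j (transition M i' i y)))"
      by (intro smooth_on_compose[OF oV' V1, where f = "transition M i' i"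
            and g = "\<lambda>y. transition N j j' (local_rep M N f i j y)"]
          smooth_on_subset[OF M.smooth_transition[OF idx(2,1)]]) (auto simp: V'_def)
    show "transition N j j' (local_rep M N f i j (transition M i' i y)) = local_rep M N f i' j' y"
      if "y \<in> V'" for y
      using V'p[OF that] idx
      by (auto simp: local_rep_def M.cinv_cmap M.transition_cmap N.transition_cmap)
  qed
  moreover have "V' \<subseteq> cmap M i' ` cdom M i'"
    by (auto simp: V'_def)
  moreover have "f ` cinv M i' ` V' \<subseteq> cdom N j'"
    using V'p idx by (fastforce simp: M.cinv_cmap)
  ultimately show "\<exists>V. open V \<and> cmap M i' p \<in> V \<and> V \<subseteq> cmap M i' ` cdom M i' \<and>
      f ` cinv M i' ` V \<subseteq> cdom N j' \<and> smooth_on V (local_rep M N f i' j')"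
    using oV' pV' by blast
qed

lemma smooth_map_local_rep:
  assumes f: "smooth_map M N f" and idx: "i \<in> idx M" "j \<in> idx N"
    and dom: "cdom M i \<subseteq> pts M" "\<And>p. p \<in> cdom M i \<Longrightarrow> f p \<in> cdom N j"
  shows "smooth_on (cimg M i) (local_rep M N f i j)"
proof (rule smooth_on_local)
  fix y assume "y \<in> cimg M i"
  then obtain p where p: "p \<in> cdom M i" "y = cmap M i p" by blast
  then have "p \<in> pts M" "i \<in> charts_at M p" "j \<in> charts_at N (f p)"
    using dom idx by (auto simp: charts_at_def)
  from f[unfolded smooth_map_def, THEN conjunct2, rule_format, OF this]
  show "\<exists>V. open V \<and> y \<in> V \<and> smooth_on V (local_rep M N f i j)"
    unfolding p by (elim exE conjE) (intro exI conjI)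
qed

lemma diffeomorphism_chartI:
  assumes M: "smooth_atlas M" and N: "smooth_atlas N" and idx: "i \<in> idx M" "j \<in> idx N"
    and U: "openin (mtop M) U" "U \<subseteq> cdom M i" and V: "openin (mtop N) V" "V \<subseteq> cdom N j" and fU: "f ` U = V"
    and r: "smooth_on (cmap M i ` U) r" "\<And>p. p \<in> U \<Longrightarrow> cmap N j (f p) = r (cmap M i p)"
    and s: "smooth_on (cmap N j ` V) s" "\<And>p. p \<in> U \<Longrightarrow> s (r (cmap M i p)) = cmap M i p"
  shows "diffeomorphism (open_sub M U) (open_sub N V) f"
proof -
  interpret M: smooth_atlas M by fact
  interpret N: smooth_atlas N by fact
  have sub: "U \<subseteq> pts M" "V \<subseteq> pts N"
    using U(1)[unfolded M.openin_iff] V(1)[unfolded N.openin_iff] by simp_all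
  then have eq: "pts M \<inter> U = U" "pts N \<inter> V = V" "cdom M i \<inter> U = U" "cdom N j \<inter> V = V"
    using U V by auto
  interpret MU: smooth_atlas "open_sub M U" by (rule M.atlas_open_sub) (simp add: eq U)
  interpret NV: smooth_atlas "open_sub N V" by (rule N.atlas_open_sub) (simp add: eq V)
  have oU: "open (cmap M i ` U)" using MU.open_cimg[of i] idx by (simp add: eq)
  have oV: "open (cmap N j ` V)" using NV.open_cimg[of j] idx by (simp add: eq)
  have inj: "inj_on f U"
  proof (rule inj_onI)
    fix p q assume pq: "p \<in> U" "q \<in> U" "f p = f q"
    then have "cmap M i p = cmap M i q" using r(2) s(2) by metis
    then show "p = q" using M.inj_cmap[OF idx(1)] U(2) pq by (meson inj_onD subsetD)
  qed
  let ?g = "inv_into U f"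
  have g: "?g (f p) = p" if "p \<in> U" for p using inj that by (rule inv_into_f_f)
  have cM: "cinv (open_sub M U) i (cmap M i p) = p" if "p \<in> U" for p
    using MU.cinv_cmap[of i p] idx that eq by auto
  have cN: "cinv (open_sub N V) j (cmap N j q) = q" if "q \<in> V" for q
    using NV.cinv_cmap[of j q] idx that eq by auto
  have "smooth_map (open_sub M U) (open_sub N V) f"
  proof (rule smooth_mapI[OF MU.smooth_atlas_axioms NV.smooth_atlas_axioms])
    fix p assume "p \<in> pts (open_sub M U)"
    then have p: "p \<in> U" by simp
    then show "f p \<in> pts (open_sub N V)" using fU eq by auto
    have "smooth_on (cmap M i ` U) (local_rep (open_sub M U) (open_sub N V) f i j)"
      by (rule smooth_on_cong[OF oU _ r(1)]) (auto simp: local_rep_def cM r(2))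
    then show "\<exists>i j W. i \<in> charts_at (open_sub M U) p \<and> j \<in> charts_at (open_sub N V) (f p) \<and> open W \<and>
      cmap (open_sub M U) i p \<in> W \<and> W \<subseteq> cimg (open_sub M U) i \<and>
      f ` cinv (open_sub M U) i ` W \<subseteq> cdom (open_sub N V) j \<and>
      smooth_on W (local_rep (open_sub M U) (open_sub N V) f i j)"
      using oU p idx fU eq cM
      by (intro exI[of _ i] exI[of _ j] exI[of _ "cmap M i ` U"]) (auto simp: charts_at_def)
  qed
  moreover have "smooth_map (open_sub N V) (open_sub M U) ?g"
  proof (rule smooth_mapI[OF NV.smooth_atlas_axioms MU.smooth_atlas_axioms])
    fix q assume "q \<in> pts (open_sub N V)"
    then have q: "q \<in> V" by simp
    then show "?g q \<in> pts (open_sub M U)" using fU eq g by auto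
    have "smooth_on (cmap N j ` V) (local_rep (open_sub N V) (open_sub M U) ?g j i)"
    proof (rule smooth_on_cong[OF oV _ s(1)])
      fix y assume "y \<in> cmap N j ` V"
      then obtain p where p: "p \<in> U" "y = cmap N j (f p)" using fU by blast
      then have "cinv (open_sub N V) j y = f p" using cN fU by blast
      then show "s y = local_rep (open_sub N V) (open_sub M U) ?g j i y"
        using p g r(2) s(2) by (simp add: local_rep_def)
    qed
    then show "\<exists>j i W. j \<in> charts_at (open_sub N V) q \<and> i \<in> charts_at (open_sub M U) (?g q) \<and> open W \<and>
      cmap (open_sub N V) j q \<in> W \<and> W \<subseteq> cimg (open_sub N V) j \<and>
      ?g ` cinv (open_sub N V) j ` W \<subseteq> cdom (open_sub M U) i \<and>
      smooth_on W (local_rep (open_sub N V) (open_sub M U) ?g j i)"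
      using oV q idx fU eq cN g
      by (intro exI[of _ i] exI[of _ j] exI[of _ "cmap N j ` V"]) (auto simp: charts_at_def)
  qed
  moreover have "bij_betw f U V" using inj fU by (simp add: bij_betw_def)
  ultimately show ?thesis
    unfolding diffeomorphism_def by (simp add: eq)
qed

section \<open>Tangent and cotangent bundles\<close>

lemma tangent_bundle_simps [simp]:
  "x \<in> pts (tangent_bundle M) \<longleftrightarrow> fst x \<in> pts M \<and> snd x \<in> tangent_space M (fst x)"
  "idx (tangent_bundle M) = idx M"
  "x \<in> cdom (tangent_bundle M) i \<longleftrightarrow> fst x \<in> cdom M i \<and> snd x \<in> tangent_space M (fst x)"
  "cmap (tangent_bundle M) i x = (cmap M i (fst x), snd x i)"
  by (auto simp: tangent_bundle_def split: prod.splits)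

lemma cotangent_bundle_simps [simp]:
  "x \<in> pts (cotangent_bundle M) \<longleftrightarrow> fst x \<in> pts M \<and> snd x \<in> cotangent_space M (fst x)"
  "idx (cotangent_bundle M) = idx M"
  "x \<in> cdom (cotangent_bundle M) i \<longleftrightarrow> fst x \<in> cdom M i \<and> snd x \<in> cotangent_space M (fst x)"
  "cmap (cotangent_bundle M) i x = (cmap M i (fst x), snd x i)"
  by (auto simp: cotangent_bundle_def split: prod.splits)

lemma charts_at_tangent_bundle:
  "snd x \<in> tangent_space M (fst x) \<Longrightarrow> charts_at (tangent_bundle M) x = charts_at M (fst x)"
  by (simp add: charts_at_def)

lemma charts_at_cotangent_bundle:
  "snd x \<in> cotangent_space M (fst x) \<Longrightarrow> charts_at (cotangent_bundle M) x = charts_at M (fst x)"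
  by (simp add: charts_at_def)

text \<open>The sum is the adjoint of \<open>f\<close> applied to \<open>a\<close>. Covectors are
  moved by it, and for a functional with \<open>a = 1\<close> it is the gradient.\<close>

lemma inner_sum_Basis:
  fixes f :: "'a::euclidean_space \<Rightarrow> 'b::euclidean_space"
  assumes "linear f"
  shows "(\<Sum>b\<in>Basis. (a \<bullet> f b) *\<^sub>R b) \<bullet> w = a \<bullet> f w"
  by (subst linear_eq_sum_Basis[OF assms, of w]) (simp add: inner_sum_left inner_sum_right inner_commute mult.commute)

section \<open>Fibres, chart images and transition maps of the two bundles\<close>

context smooth_atlas
begin

abbreviation T where "T \<equiv> tangent_bundle M"
abbreviation C where "C \<equiv> cotangent_bundle M"

lemma tangent_space_transition:
  assumes "v \<in> tangent_space M p" "i \<in> charts_at M p" "j \<in> charts_at M p"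
  shows "v j = fderiv (transition M i j) (cmap M i p) (v i)"
  using assms(1)[unfolded tangent_space_def mem_Collect_eq, THEN conjunct1, rule_format, OF assms(2,3)] .

lemma tangent_space_zero: "v \<in> tangent_space M p \<Longrightarrow> i \<notin> charts_at M p \<Longrightarrow> v i = 0"
  by (metis (mono_tags, lifting) tangent_space_def mem_Collect_eq)

lemma tangent_space_eqI:
  assumes "v \<in> tangent_space M p" "w \<in> tangent_space M p" "i \<in> charts_at M p" "v i = w i"
  shows "v = w"
proof
  fix j show "v j = w j"
    using assms tangent_space_zero[of v p j] tangent_space_zero[of w p j]
      tangent_space_transition[of v p i j] tangent_space_transition[of w p i j]
    by (cases "j \<in> charts_at M p") simp_all
qed

text \<open>With \<open>tangent_space_eqI\<close>, this identifies the fibre with the model space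
  through the chart \<open>i\<close>. The components in the other charts are forced, and are
  consistent by the cocycle identity.\<close>

lemma ex_tangent_vector:
  assumes i: "i \<in> charts_at M p"
  shows "\<exists>v\<in>tangent_space M p. v i = e"
proof -
  define v where "v j = (if j \<in> charts_at M p then fderiv (transition M i j) (cmap M i p) e else 0)" for j
  have "v \<in> tangent_space M p"
    unfolding tangent_space_def v_def using i by (auto simp: fderiv_transition_trans)
  moreover have "v i = e" using i by (simp add: v_def fderiv_transition_self)
  ultimately show ?thesis by blast
qed

lemma cotangent_space_transition:
  assumes "\<alpha> \<in> cotangent_space M p" "i \<in> charts_at M p" "j \<in> charts_at M p"
  shows "\<alpha> i \<bullet> w = \<alpha> j \<bullet> fderiv (transition M i j) (cmap M i p) w"
  using assms(1)[unfolded cotangent_space_def mem_Collect_eq, THEN conjunct1, rule_format, OF assms(2,3)] .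

lemma cotangent_space_zero: "\<alpha> \<in> cotangent_space M p \<Longrightarrow> i \<notin> charts_at M p \<Longrightarrow> \<alpha> i = 0"
  by (metis (mono_tags, lifting) cotangent_space_def mem_Collect_eq)

text \<open>The defining relation of covectors only fixes pairings; it is solved for the component
  by the adjoint of the inverse transition.\<close>

lemma cotangent_space_transition_sum:
  assumes "\<alpha> \<in> cotangent_space M p" "i \<in> charts_at M p" "j \<in> charts_at M p"
  shows "\<alpha> j = (\<Sum>b\<in>Basis. (\<alpha> i \<bullet> fderiv (transition M j i) (cmap M j p) b) *\<^sub>R b)"
  by (rule vector_eq_rdot[THEN iffD1])
    (simp add: inner_sum_Basis[OF linear_fderiv_transition[OF assms(3,2)]]
      cotangent_space_transition[OF assms(1,3,2)])

lemma cotangent_space_eqI: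
  assumes "\<alpha> \<in> cotangent_space M p" "\<beta> \<in> cotangent_space M p" "i \<in> charts_at M p" "\<alpha> i = \<beta> i"
  shows "\<alpha> = \<beta>"
proof
  fix j show "\<alpha> j = \<beta> j"
  proof (cases "j \<in> charts_at M p")
    case True
    then show ?thesis
      using assms cotangent_space_transition_sum[of \<alpha> p i j] cotangent_space_transition_sum[of \<beta> p i j]
      by simp
  next
    case False
    then show ?thesis
      using assms cotangent_space_zero[of \<alpha> p j] cotangent_space_zero[of \<beta> p j] by simp
  qed
qed

lemma ex_covector:
  assumes i: "i \<in> charts_at M p"
  shows "\<exists>\<alpha>\<in>cotangent_space M p. \<alpha> i = a"
proof -
  define \<alpha> where "\<alpha> j = (if j \<in> charts_at M p
    then (\<Sum>b\<in>Basis. (a \<bullet> fderiv (transition M j i) (cmap M j p) b) *\<^sub>R b) else 0)" for j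
  have "\<alpha> \<in> cotangent_space M p"
    unfolding cotangent_space_def \<alpha>_def using i
    by (auto simp: fderiv_transition_trans inner_sum_Basis linear_fderiv_transition)
  moreover have "\<alpha> i = a" using i by (simp add: \<alpha>_def fderiv_transition_self euclidean_representation)
  ultimately show ?thesis by blast
qed

text \<open>Every model vector is a component, so the fibre direction is filled. The set
  \<open>S\<close> is a parameter in order to cover chart images, overlaps and preimages of open
  sets at once.\<close>

lemma image_cmap_tangent_bundle:
  assumes "i \<in> idx M"
  shows "cmap T i ` {x \<in> cdom T i. fst x \<in> S}
    = cmap M i ` (cdom M i \<inter> S) \<times> UNIV"
proof -
  have "(cmap M i p, e) \<in> cmap T i ` {x \<in> cdom T i. fst x \<in> S}"
    if p: "p \<in> cdom M i" "p \<in> S" for p e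
  proof -
    obtain v where "v \<in> tangent_space M p" "v i = e"
      using ex_tangent_vector[of i p e] p assms by (auto simp: charts_at_def)
    then show ?thesis
      using p by (intro image_eqI[of _ _ "(p, v)"]) auto
  qed
  then show ?thesis by auto
qed

lemma image_cmap_cotangent_bundle:
  assumes "i \<in> idx M"
  shows "cmap C i ` {x \<in> cdom C i. fst x \<in> S}
    = cmap M i ` (cdom M i \<inter> S) \<times> UNIV"
proof -
  have "(cmap M i p, e) \<in> cmap C i ` {x \<in> cdom C i. fst x \<in> S}"
    if p: "p \<in> cdom M i" "p \<in> S" for p e
  proof -
    obtain v where "v \<in> cotangent_space M p" "v i = e"
      using ex_covector[of i p e] p assms by (auto simp: charts_at_def)
    then show ?thesis
      using p by (intro image_eqI[of _ _ "(p, v)"]) auto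
  qed
  then show ?thesis by auto
qed

lemma cimg_tangent_bundle:
  "i \<in> idx M \<Longrightarrow> cimg T i = cimg M i \<times> UNIV"
  using image_cmap_tangent_bundle[of i UNIV] by (simp del: tangent_bundle_simps(3,4))

lemma cimg_cotangent_bundle:
  "i \<in> idx M \<Longrightarrow> cimg C i = cimg M i \<times> UNIV"
  using image_cmap_cotangent_bundle[of i UNIV] by (simp del: cotangent_bundle_simps(3,4))

lemma inj_cmap_tangent_bundle:
  assumes "i \<in> idx M"
  shows "inj_on (cmap T i) (cdom T i)"
proof (rule inj_onI)
  fix x y assume *: "x \<in> cdom T i" "y \<in> cdom T i"
    "cmap T i x = cmap T i y"
  then have "fst x = fst y" using inj_cmap[OF assms] by (auto simp: inj_on_def)
  moreover have "snd x = snd y"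
    using * \<open>fst x = fst y\<close> assms by (intro tangent_space_eqI[of _ "fst x" _ i]) (auto simp: charts_at_def)
  ultimately show "x = y" by (simp add: prod_eq_iff)
qed

lemma inj_cmap_cotangent_bundle:
  assumes "i \<in> idx M"
  shows "inj_on (cmap C i) (cdom C i)"
proof (rule inj_onI)
  fix x y assume *: "x \<in> cdom C i" "y \<in> cdom C i"
    "cmap C i x = cmap C i y"
  then have "fst x = fst y" using inj_cmap[OF assms] by (auto simp: inj_on_def)
  moreover have "snd x = snd y"
    using * \<open>fst x = fst y\<close> assms by (intro cotangent_space_eqI[of _ "fst x" _ i]) (auto simp: charts_at_def)
  ultimately show "x = y" by (simp add: prod_eq_iff)
qed

lemma cinv_tangent_bundle:
  assumes "i \<in> idx M" "x \<in> cdom T i"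
  shows "cinv T i (cmap M i (fst x), snd x i) = x"
  using inv_into_f_f[OF inj_cmap_tangent_bundle assms(2)] assms(1) by (simp add: cinv_def)

lemma cinv_cotangent_bundle:
  assumes "i \<in> idx M" "x \<in> cdom C i"
  shows "cinv C i (cmap M i (fst x), snd x i) = x"
  using inv_into_f_f[OF inj_cmap_cotangent_bundle assms(2)] assms(1) by (simp add: cinv_def)

lemma overlap_tangent_bundle:
  assumes "i \<in> idx M"
  shows "overlap T i j
    = overlap M i j \<times> UNIV"
proof -
  have "cdom T i \<inter> cdom T j
    = {x \<in> cdom T i. fst x \<in> cdom M j}"
    by auto
  then show ?thesis
    using image_cmap_tangent_bundle[OF assms] by presburger
qed

lemma overlap_cotangent_bundle:
  assumes "i \<in> idx M"
  shows "overlap C i j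
    = overlap M i j \<times> UNIV"
proof -
  have "cdom C i \<inter> cdom C j
    = {x \<in> cdom C i. fst x \<in> cdom M j}"
    by auto
  then show ?thesis
    using image_cmap_cotangent_bundle[OF assms] by presburger
qed

lemma transition_tangent_bundle:
  assumes "i \<in> idx M" "j \<in> idx M" "y \<in> overlap M i j \<times> UNIV"
  shows "transition T i j y
    = (transition M i j (fst y), fderiv (transition M i j) (fst y) (snd y))"
proof -
  obtain x where x: "x \<in> cdom T i" "x \<in> cdom T j"
    "y = (cmap M i (fst x), snd x i)"
    using assms(3) unfolding overlap_tangent_bundle[OF assms(1), symmetric] by auto
  then have "transition T i j y = (cmap M j (fst x), snd x j)"
    using assms by (simp add: transition_def cinv_tangent_bundle)
  also have "snd x j = fderiv (transition M i j) (cmap M i (fst x)) (snd x i)"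
    using x assms by (intro tangent_space_transition) (auto simp: charts_at_def)
  finally show ?thesis
    using x assms by (simp add: transition_cmap)
qed

text \<open>The momentum is moved by the adjoint of the derivative of the inverse transition, taken
  at the target point.\<close>

lemma transition_cotangent_bundle:
  assumes "i \<in> idx M" "j \<in> idx M" "y \<in> overlap M i j \<times> UNIV"
  shows "transition C i j y = (transition M i j (fst y),
    \<Sum>b\<in>Basis. (snd y \<bullet> fderiv (transition M j i) (transition M i j (fst y)) b) *\<^sub>R b)"
proof -
  obtain x where x: "x \<in> cdom C i" "x \<in> cdom C j"
    "y = (cmap M i (fst x), snd x i)"
    using assms(3) unfolding overlap_cotangent_bundle[OF assms(1), symmetric] by auto
  then have "transition C i j y = (cmap M j (fst x), snd x j)"
    using assms by (simp add: transition_def cinv_cotangent_bundle)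
  also have "snd x j = (\<Sum>b\<in>Basis. (snd x i \<bullet> fderiv (transition M j i) (cmap M j (fst x)) b) *\<^sub>R b)"
    using x assms by (intro cotangent_space_transition_sum) (auto simp: charts_at_def)
  finally show ?thesis
    using x assms by (simp add: transition_cmap)
qed

lemma atlas_tangent_bundle: "smooth_atlas T"
proof
  show "(\<Union>i\<in>idx T. cdom T i) = pts T"
    using cover by (intro set_eqI) auto
next
  fix i assume "i \<in> idx T"
  then show "inj_on (cmap T i) (cdom T i)"
    by (simp add: inj_cmap_tangent_bundle)
next
  fix i j assume ij: "i \<in> idx T" "j \<in> idx T"
  let ?O = "overlap M i j"
  have o: "open (?O \<times> (UNIV :: 'e set))"
    using open_overlap ij by (auto intro: open_Times)
  then show "open (overlap T i j)"
    using ij overlap_tangent_bundle by simp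
  have "smooth_on (?O \<times> UNIV) (\<lambda>y. (transition M i j (fst y), fderiv (transition M i j) (fst y) (snd y)))"
    using ij
    by (intro smooth_on_Pair o smooth_on_compose[OF o open_overlap _ smooth_on_fst smooth_transition]
        smooth_on_fderiv_apply[OF o open_overlap smooth_transition] smooth_on_fst smooth_on_snd) auto
  then have "smooth_on (?O \<times> UNIV) (transition T i j)"
    by (rule smooth_on_cong[OF o, rotated]) (use ij transition_tangent_bundle in auto)
  then show "smooth_on (overlap T i j)
      (transition T i j)"
    using ij overlap_tangent_bundle by simp
qed

lemma atlas_cotangent_bundle: "smooth_atlas C"
proof
  show "(\<Union>i\<in>idx C. cdom C i) = pts C"
    using cover by (intro set_eqI) auto
next
  fix i assume "i \<in> idx C"
  then show "inj_on (cmap C i) (cdom C i)"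
    by (simp add: inj_cmap_cotangent_bundle)
next
  fix i j assume ij: "i \<in> idx C" "j \<in> idx C"
  then have ij': "i \<in> idx M" "j \<in> idx M" by simp_all
  let ?O = "overlap M i j"
  have o: "open (?O \<times> (UNIV :: 'e set))"
    using open_overlap ij by (auto intro: open_Times)
  then show "open (overlap C i j)"
    using ij overlap_cotangent_bundle by simp
  have t: "smooth_on (?O \<times> UNIV) (\<lambda>y :: 'e \<times> 'e. transition M i j (fst y))"
    by (rule smooth_on_compose[OF o open_overlap[OF ij'] _ smooth_on_fst smooth_transition[OF ij']]) auto
  have m: "(\<lambda>y :: 'e \<times> 'e. transition M i j (fst y)) ` (?O \<times> UNIV) \<subseteq> overlap M j i"
    using ij' by (auto simp: transition_cmap)
  have "smooth_on (?O \<times> UNIV) (\<lambda>y. (transition M i j (fst y),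
      \<Sum>b\<in>Basis. (snd y \<bullet> fderiv (transition M j i) (transition M i j (fst y)) b) *\<^sub>R b))"
    using smooth_on_fderiv_apply[OF o open_overlap[OF ij'(2,1)] smooth_transition[OF ij'(2,1)] t
        smooth_on_const m]
    by (intro smooth_on_Pair o t smooth_on_sum smooth_on_linear_comp[OF o bounded_linear_scaleR_left]
        smooth_on_bilinear[OF o bounded_bilinear_inner] smooth_on_snd)
  then have "smooth_on (?O \<times> UNIV) (transition C i j)"
    by (rule smooth_on_cong[OF o, rotated]) (use ij transition_cotangent_bundle in auto)
  then show "smooth_on (overlap C i j)
      (transition C i j)"
    using ij overlap_cotangent_bundle by simp
qed

end

section \<open>One-forms and Lagrangian submanifolds\<close>

definition form_rep ::
  "('p, 'e, 'i) manifold \<Rightarrow> ('p \<Rightarrow> 'p \<times> ('i \<Rightarrow> 'e)) \<Rightarrow> 'i \<Rightarrow> 'e \<Rightarrow> 'e" where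
  "form_rep M \<mu> i y = snd (\<mu> (cinv M i y)) i"

text \<open>Vanishing at \<open>y\<close> of the exterior derivative of the 1-form with coefficients
  \<open>m\<close>, covectors being identified with vectors by the inner product.\<close>

definition symmetric_derivative :: "('a::euclidean_space \<Rightarrow> 'a) \<Rightarrow> 'a \<Rightarrow> bool" where
  "symmetric_derivative m y \<longleftrightarrow> (\<forall>u w. fderiv m y u \<bullet> w = fderiv m y w \<bullet> u)"

section \<open>One-forms in charts, closedness, and the geometry of the image of a form\<close>

context smooth_atlas
begin

lemma one_formD:
  assumes "one_form M \<mu>" "p \<in> pts M"
  shows "fst (\<mu> p) = p" "snd (\<mu> p) \<in> cotangent_space M p" "\<mu> p \<in> pts (cotangent_bundle M)"
proof -
  show "fst (\<mu> p) = p" using assms by (simp add: one_form_def)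
  moreover show "\<mu> p \<in> pts (cotangent_bundle M)"
    using assms unfolding one_form_def smooth_map_def by blast
  ultimately show "snd (\<mu> p) \<in> cotangent_space M p" by simp
qed

lemma local_rep_one_form:
  assumes "one_form M \<mu>" "i \<in> idx M" "y \<in> cimg M i"
  shows "local_rep M (cotangent_bundle M) \<mu> i i y = (y, form_rep M \<mu> i y)"
  using assms one_formD(1)[OF assms(1)] cdom_subset[OF assms(2)]
  by (auto simp: local_rep_def form_rep_def cinv_cmap)

lemma smooth_form_rep:
  assumes "one_form M \<mu>" "i \<in> idx M"
  shows "smooth_on (cimg M i) (form_rep M \<mu> i)"
proof (rule smooth_on_cong[OF open_cimg[OF assms(2)]])
  have "smooth_map M (cotangent_bundle M) \<mu>"
    using assms by (simp add: one_form_def)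
  then have "smooth_on (cimg M i) (local_rep M (cotangent_bundle M) \<mu> i i)"
    using assms(2) one_formD(1,2)[OF assms(1)] cdom_subset[OF assms(2)]
    by (intro smooth_map_local_rep) (auto simp: subset_iff)
  then show "smooth_on (cimg M i) (\<lambda>y. snd (local_rep M (cotangent_bundle M) \<mu> i i y))"
    by (intro smooth_on_linear_comp[OF open_cimg[OF assms(2)] bounded_linear_snd])
qed (simp add: local_rep_one_form[OF assms])

lemma one_formI:
  assumes "\<And>p. p \<in> pts M \<Longrightarrow> fst (\<mu> p) = p" "\<And>p. p \<in> pts M \<Longrightarrow> snd (\<mu> p) \<in> cotangent_space M p"
    and "\<And>i. i \<in> idx M \<Longrightarrow> smooth_on (cimg M i) (form_rep M \<mu> i)"
  shows "one_form M \<mu>"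
proof -
  have "smooth_map M (cotangent_bundle M) \<mu>"
  proof (rule smooth_mapI[OF smooth_atlas_axioms atlas_cotangent_bundle])
    fix p assume p: "p \<in> pts M"
    then show "\<mu> p \<in> pts (cotangent_bundle M)" using assms by simp
    obtain i where i: "i \<in> charts_at M p" using ex_chart[OF p] by blast
    then have ii: "i \<in> idx M" "p \<in> cdom M i" by (auto simp: charts_at_def)
    have "smooth_on (cimg M i) (local_rep M (cotangent_bundle M) \<mu> i i)"
    proof (rule smooth_on_cong[OF open_cimg[OF ii(1)]])
      show "smooth_on (cimg M i) (\<lambda>y. (y, form_rep M \<mu> i y))"
        using assms(3) ii open_cimg by (intro smooth_on_Pair smooth_on_ident) auto
      show "(y, form_rep M \<mu> i y) = local_rep M (cotangent_bundle M) \<mu> i i y"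
        if "y \<in> cimg M i" for y
        using that assms(1) cdom_subset[OF ii(1)] ii
        by (auto simp: local_rep_def form_rep_def cinv_cmap)
    qed
    then show "\<exists>i j V. i \<in> charts_at M p \<and> j \<in> charts_at (cotangent_bundle M) (\<mu> p) \<and> open V \<and>
      cmap M i p \<in> V \<and> V \<subseteq> cimg M i \<and> \<mu> ` cinv M i ` V \<subseteq> cdom (cotangent_bundle M) j \<and>
      smooth_on V (local_rep M (cotangent_bundle M) \<mu> i j)"
      using i ii assms(1,2) p cdom_subset[OF ii(1)] open_cimg[OF ii(1)]
      by (intro exI[of _ i] exI[of _ "cimg M i"])
        (auto simp: charts_at_cotangent_bundle cinv_cmap)
  qed
  then show ?thesis using assms(1) by (simp add: one_form_def)
qed

lemma form_rep_cmap: "i \<in> idx M \<Longrightarrow> p \<in> cdom M i \<Longrightarrow> form_rep M \<mu> i (cmap M i p) = snd (\<mu> p) i"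
  by (simp add: form_rep_def cinv_cmap)

lemma form_rep_transition:
  assumes "one_form M \<mu>" "i \<in> charts_at M p" "j \<in> charts_at M p"
  shows "form_rep M \<mu> i (cmap M i p) \<bullet> u
    = form_rep M \<mu> j (cmap M j p) \<bullet> fderiv (transition M i j) (cmap M i p) u"
proof -
  have "p \<in> pts M" using assms(2) cdom_subset by (auto simp: charts_at_def)
  then show ?thesis
    using cotangent_space_transition[OF one_formD(2)[OF assms(1)] assms(2,3)] assms(2,3)
    by (simp add: form_rep_cmap charts_at_def)
qed

text \<open>The second derivatives of the transition map contribute a symmetric term only.\<close>

lemma symmetric_derivative_chart:
  assumes \<mu>: "one_form M \<mu>" and i: "i \<in> charts_at M p" and j: "j \<in> charts_at M p"
    and sym: "symmetric_derivative (form_rep M \<mu> j) (cmap M j p)"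
  shows "symmetric_derivative (form_rep M \<mu> i) (cmap M i p)"
proof -
  have ij: "i \<in> idx M" "j \<in> idx M" "p \<in> cdom M i" "p \<in> cdom M j"
    using i j by (auto simp: charts_at_def)
  let ?m = "form_rep M \<mu>" and ?t = "transition M i j" and ?y = "cmap M i p"
  let ?O = "overlap M i j"
  have O: "open ?O" "?y \<in> ?O" and smt: "smooth_on ?O ?t"
    using open_overlap smooth_transition ij by auto
  have dj: "(?m j has_derivative fderiv (?m j) (?t ?y)) (at (?t ?y))"
    using ij by (intro smooth_on_has_derivative[OF smooth_form_rep[OF \<mu>]]) (auto simp: transition_cmap)
  have di: "(?m i has_derivative fderiv (?m i) ?y) (at ?y)"
    using ij by (intro smooth_on_has_derivative[OF smooth_form_rep[OF \<mu>]]) auto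
  have *: "fderiv (?m i) ?y w \<bullet> u = fderiv (?m j) (?t ?y) (fderiv ?t ?y w) \<bullet> fderiv ?t ?y u
      + ?m j (?t ?y) \<bullet> fderiv (\<lambda>z. fderiv ?t z u) ?y w" for u w
  proof -
    have "((\<lambda>z. ?m j (?t z)) has_derivative (\<lambda>w. fderiv (?m j) (?t ?y) (fderiv ?t ?y w))) (at ?y)"
      using has_derivative_compose[OF smooth_on_has_derivative[OF smt O(2)] dj] .
    then have "((\<lambda>z. ?m j (?t z) \<bullet> fderiv ?t z u) has_derivative
        (\<lambda>w. ?m j (?t ?y) \<bullet> fderiv (\<lambda>z. fderiv ?t z u) ?y w
          + fderiv (?m j) (?t ?y) (fderiv ?t ?y w) \<bullet> fderiv ?t ?y u)) (at ?y)"
      by (intro has_derivative_inner smooth_on_has_derivative[OF smooth_on_fderiv[OF smt] O(2)])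
    moreover have "?m j (?t z) \<bullet> fderiv ?t z u = ?m i z \<bullet> u" if z: "z \<in> ?O" for z
    proof -
      obtain q where "q \<in> cdom M i" "q \<in> cdom M j" "z = cmap M i q" using z by blast
      then show ?thesis
        using form_rep_transition[OF \<mu>, of i q j u] ij by (simp add: charts_at_def transition_cmap)
    qed
    ultimately have "((\<lambda>z. ?m i z \<bullet> u) has_derivative
        (\<lambda>w. ?m j (?t ?y) \<bullet> fderiv (\<lambda>z. fderiv ?t z u) ?y w
          + fderiv (?m j) (?t ?y) (fderiv ?t ?y w) \<bullet> fderiv ?t ?y u)) (at ?y)"
      by (rule has_derivative_transform_within_open[OF _ O])
    moreover have "((\<lambda>z. ?m i z \<bullet> u) has_derivative (\<lambda>w. fderiv (?m i) ?y w \<bullet> u)) (at ?y)"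
      by (intro bounded_linear.has_derivative[OF bounded_linear_inner_left] di)
    ultimately have "(\<lambda>w. fderiv (?m i) ?y w \<bullet> u) = (\<lambda>w. ?m j (?t ?y) \<bullet> fderiv (\<lambda>z. fderiv ?t z u) ?y w
          + fderiv (?m j) (?t ?y) (fderiv ?t ?y w) \<bullet> fderiv ?t ?y u)"
      by (rule has_derivative_unique[rotated])
    from fun_cong[OF this, of w] show ?thesis by (simp only: add.commute)
  qed
  have ty: "?t ?y = cmap M j p" using ij by (simp add: transition_cmap)
  show ?thesis
    unfolding symmetric_derivative_def
    using sym[folded ty] * second_derivative_symmetric[OF O(1) smt O(2)]
    unfolding symmetric_derivative_def by simp
qed

text \<open>\<open>ext_deriv\<close> looks only at the chart \<open>chart_at M p\<close>. Arbitrary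
  components are realised by tangent vectors, which gives symmetry in that chart, and the change of
  charts carries it to all others.\<close>

lemma closed_form_iff:
  assumes \<mu>: "one_form M \<mu>"
  shows "closed_form M \<mu> \<longleftrightarrow>
    (\<forall>i\<in>idx M. \<forall>y\<in>cimg M i. symmetric_derivative (form_rep M \<mu> i) y)"
proof -
  have e: "ext_deriv M \<mu> p u w = fderiv (form_rep M \<mu> (chart_at M p)) (cmap M (chart_at M p) p)
      (u (chart_at M p)) \<bullet> w (chart_at M p) - fderiv (form_rep M \<mu> (chart_at M p))
      (cmap M (chart_at M p) p) (w (chart_at M p)) \<bullet> u (chart_at M p)" for p u w
    by (simp add: ext_deriv_def Let_def form_rep_def[abs_def])
  have at: "(\<forall>u\<in>tangent_space M p. \<forall>w\<in>tangent_space M p. ext_deriv M \<mu> p u w = 0) \<longleftrightarrow>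
      symmetric_derivative (form_rep M \<mu> (chart_at M p)) (cmap M (chart_at M p) p)" if p: "p \<in> pts M" for p
  proof
    assume *: "\<forall>u\<in>tangent_space M p. \<forall>w\<in>tangent_space M p. ext_deriv M \<mu> p u w = 0"
    show "symmetric_derivative (form_rep M \<mu> (chart_at M p)) (cmap M (chart_at M p) p)"
      unfolding symmetric_derivative_def
    proof (intro allI)
      fix a b
      obtain u w where "u \<in> tangent_space M p" "u (chart_at M p) = a"
        "w \<in> tangent_space M p" "w (chart_at M p) = b"
        using ex_tangent_vector[OF chart_at_mem[OF p]] by metis
      then show "fderiv (form_rep M \<mu> (chart_at M p)) (cmap M (chart_at M p) p) a \<bullet> b
          = fderiv (form_rep M \<mu> (chart_at M p)) (cmap M (chart_at M p) p) b \<bullet> a"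
        using * unfolding e by auto
    qed
  qed (auto simp: e symmetric_derivative_def)
  show ?thesis
  proof
    assume *: "closed_form M \<mu>"
    show "\<forall>i\<in>idx M. \<forall>y\<in>cimg M i. symmetric_derivative (form_rep M \<mu> i) y"
    proof clarify
      fix i p assume ip: "i \<in> idx M" "p \<in> cdom M i"
      then have p: "p \<in> pts M" using cdom_subset by blast
      show "symmetric_derivative (form_rep M \<mu> i) (cmap M i p)"
        by (rule symmetric_derivative_chart[OF \<mu> _ chart_at_mem[OF p]])
          (use * at[OF p] p ip in \<open>auto simp: closed_form_def charts_at_def\<close>)
    qed
  next
    assume *: "\<forall>i\<in>idx M. \<forall>y\<in>cimg M i. symmetric_derivative (form_rep M \<mu> i) y"
    show "closed_form M \<mu>"
      unfolding closed_form_def using at chart_at_mem * by (auto simp: charts_at_def)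
  qed
qed

text \<open>In a chart the Liouville form is the linear map from (q, p) to (p, 0), so it is its own
  derivative and minus its exterior derivative is the wedge product of dq and dp.\<close>

lemma canonical_symplectic_eq:
  assumes z: "z \<in> pts (cotangent_bundle M)" and c: "c = chart_at (cotangent_bundle M) z"
  shows "canonical_symplectic M z u w = snd (w c) \<bullet> fst (u c) - snd (u c) \<bullet> fst (w c)"
proof -
  interpret C: smooth_atlas "cotangent_bundle M" by (rule atlas_cotangent_bundle)
  let ?C = "cotangent_bundle M"
  have c': "c \<in> idx ?C" "z \<in> cdom ?C c"
    using C.chart_at_mem[OF z] c by (auto simp: charts_at_def)
  have "fderiv (\<lambda>y. snd (liouville_form (cinv ?C c y)) c) (cmap ?C c z) = fderiv (\<lambda>y. (snd y, 0)) (cmap ?C c z)"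
  proof (rule fderiv_cong_open[OF C.open_cimg[OF c'(1)]])
    show "cmap ?C c z \<in> cimg ?C c" using c' by blast
    fix y assume "y \<in> cimg ?C c"
    then obtain x where "x \<in> cdom ?C c" "y = cmap ?C c x" by blast
    then show "snd (liouville_form (cinv ?C c y)) c = (snd y, 0)"
      using C.cinv_cmap[OF c'(1)] by (simp add: liouville_form_def)
  qed
  also have "\<dots> = (\<lambda>v. (snd v, 0))"
    by (intro fderiv_eqI bounded_linear_imp_has_derivative bounded_linear_intros)
  finally show ?thesis
    by (simp add: canonical_symplectic_def ext_deriv_def c[symmetric] Let_def inner_prod_def)
qed

text \<open>A curve in the image satisfies p = m(q) in the chart; differentiating at time 0 places
  its velocity in the graph of the derivative of m.\<close>

lemma tangent_to_image:
  assumes \<mu>: "one_form M \<mu>" and p: "p \<in> pts M" and c: "c \<in> charts_at M p"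
    and u: "u \<in> tangent_to (cotangent_bundle M) (\<mu> ` pts M) (\<mu> p)"
  shows "snd (u c) = fderiv (form_rep M \<mu> c) (cmap M c p) (fst (u c))"
proof -
  let ?C = "cotangent_bundle M" and ?m = "form_rep M \<mu> c"
  have ci: "c \<in> idx M" "p \<in> cdom M c" using c by (auto simp: charts_at_def)
  obtain e \<gamma> where e: "e > 0" and sm: "smooth_map (euclid {-e<..<e::real}) ?C \<gamma>"
    and im: "\<gamma> ` {-e<..<e} \<subseteq> \<mu> ` pts M" and \<gamma>0: "\<gamma> 0 = \<mu> p"
    and u: "u = snd (tangent_map (euclid {-e<..<e}) ?C \<gamma> (0, \<lambda>_. 1))"
    using u unfolding tangent_to_def by blast
  let ?R = "local_rep (euclid {-e<..<e}) ?C \<gamma> () c"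
  have cC: "c \<in> charts_at ?C (\<mu> p)"
    using c one_formD[OF \<mu> p] by (simp add: charts_at_cotangent_bundle)
  have uc: "u c = fderiv ?R 0 1"
    using cC \<gamma>0 by (simp add: u tangent_map_def)
  have 0: "0 \<in> pts (euclid {-e<..<e})" "() \<in> charts_at (euclid {-e<..<e}) 0" using e by simp_all
  obtain V where V: "open V" "0 \<in> V" "V \<subseteq> {-e<..<e}" "\<gamma> ` cinv (euclid {-e<..<e}) () ` V \<subseteq> cdom ?C c"
    and smR: "smooth_on V ?R"
    using sm[unfolded smooth_map_def, THEN conjunct2, rule_format, OF 0, of c] cC \<gamma>0 by auto
  have R: "?R t = (fst (?R t), ?m (fst (?R t))) \<and> fst (?R t) \<in> cimg M c" if t: "t \<in> V" for t
  proof -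
    have t': "t \<in> {-e<..<e}" using V t by blast
    then obtain p' where p': "p' \<in> pts M" "\<gamma> t = \<mu> p'" using im by blast
    have "\<gamma> t \<in> cdom ?C c"
      using V(4) t cinv_euclid[OF t', of "()"] by (force simp del: cotangent_bundle_simps)
    then have "p' \<in> cdom M c" using one_formD[OF \<mu> p'(1)] p' by simp
    then show ?thesis
      using p' one_formD[OF \<mu> p'(1)] ci t' by (simp add: local_rep_def cinv_euclid form_rep_cmap)
  qed
  have R0: "fst (?R 0) = cmap M c p"
    using e \<gamma>0 one_formD[OF \<mu> p] by (simp add: local_rep_def cinv_euclid)
  have dR: "(?R has_derivative fderiv ?R 0) (at 0)"
    using smooth_on_has_derivative[OF smR V(2)] .
  have dm: "(?m has_derivative fderiv ?m (cmap M c p)) (at (fst (?R 0)))"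
    unfolding R0 using ci by (intro smooth_on_has_derivative[OF smooth_form_rep[OF \<mu>]]) auto
  have "((\<lambda>t. ?m (fst (?R t))) has_derivative (\<lambda>s. fderiv ?m (cmap M c p) (fst (fderiv ?R 0 s)))) (at 0)"
    using has_derivative_compose[OF has_derivative_fst[OF dR] dm] .
  then have "((\<lambda>t. snd (?R t)) has_derivative (\<lambda>s. fderiv ?m (cmap M c p) (fst (fderiv ?R 0 s)))) (at 0)"
    by (rule has_derivative_transform_within_open[OF _ V(1,2)]) (metis R snd_conv)
  from has_derivative_unique[OF this has_derivative_snd[OF dR]] show ?thesis
    unfolding uc by metis
qed

text \<open>Conversely, each vector of that graph is a velocity: a short straight line in the chart
  of the base, lifted by the form, is a smooth curve in the image.\<close>

lemma ex_tangent_to_image: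
  assumes \<mu>: "one_form M \<mu>" and p: "p \<in> pts M" and c: "c \<in> charts_at M p"
  shows "\<exists>u\<in>tangent_to (cotangent_bundle M) (\<mu> ` pts M) (\<mu> p).
    u c = (a, fderiv (form_rep M \<mu> c) (cmap M c p) a)"
proof -
  let ?C = "cotangent_bundle M" and ?m = "form_rep M \<mu> c" and ?y = "cmap M c p"
  have ci: "c \<in> idx M" "p \<in> cdom M c" using c by (auto simp: charts_at_def)
  have "open ((\<lambda>t::real. ?y + t *\<^sub>R a) -` (cimg M c))"
    by (intro open_vimage[OF open_cimg[OF ci(1)]] continuous_intros)
  moreover have "0 \<in> (\<lambda>t::real. ?y + t *\<^sub>R a) -` (cimg M c)" using ci by simp
  ultimately obtain e where e: "e > 0" "ball 0 e \<subseteq> (\<lambda>t::real. ?y + t *\<^sub>R a) -` (cimg M c)"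
    by (meson open_contains_ball)
  define I where "I = {-e<..<e}"
  have I: "open I" "0 \<in> I" and img: "\<And>t. t \<in> I \<Longrightarrow> ?y + t *\<^sub>R a \<in> cimg M c"
    using e by (auto simp: I_def subset_eq dist_real_def abs_less_iff)
  define \<gamma> where "\<gamma> t = \<mu> (cinv M c (?y + t *\<^sub>R a))" for t
  let ?R = "local_rep (euclid I) ?C \<gamma> () c"
  have cin: "cinv M c (?y + t *\<^sub>R a) \<in> cdom M c" "cinv M c (?y + t *\<^sub>R a) \<in> pts M" if "t \<in> I" for t
    using cinv_mem[OF img[OF that]] cdom_subset[OF ci(1)] by auto
  have \<gamma>dom: "\<gamma> t \<in> cdom ?C c" if "t \<in> I" for t
    using cin[OF that] one_formD[OF \<mu>, of "cinv M c (?y + t *\<^sub>R a)"] by (simp add: \<gamma>_def)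
  have R: "?R t = (?y + t *\<^sub>R a, ?m (?y + t *\<^sub>R a))" if "t \<in> I" for t
    using that cin[OF that] one_formD[OF \<mu>, of "cinv M c (?y + t *\<^sub>R a)"] cmap_cinv[OF img[OF that]]
    by (simp add: local_rep_def cinv_euclid \<gamma>_def form_rep_def)
  have sml: "smooth_on I (\<lambda>t. ?y + t *\<^sub>R a)"
    by (intro smooth_on_add smooth_on_const I smooth_on_linear bounded_linear_scaleR_left)
  have smR: "smooth_on I ?R"
  proof (rule smooth_on_cong[OF I(1)])
    show "smooth_on I (\<lambda>t. (?y + t *\<^sub>R a, ?m (?y + t *\<^sub>R a)))"
      using img by (intro smooth_on_Pair I sml
          smooth_on_compose[OF I(1) open_cimg[OF ci(1)] _ sml smooth_form_rep[OF \<mu> ci(1)]]) auto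
  qed (simp add: R)
  have "smooth_map (euclid I) ?C \<gamma>"
  proof (rule smooth_mapI[OF smooth_atlas_euclid[OF I(1)] atlas_cotangent_bundle])
    fix t assume "t \<in> pts (euclid I)"
    then have t: "t \<in> I" by simp
    show "\<gamma> t \<in> pts ?C" using \<gamma>dom[OF t] cdom_subset[OF ci(1)] by auto
    show "\<exists>i j V. i \<in> charts_at (euclid I) t \<and> j \<in> charts_at ?C (\<gamma> t) \<and> open V \<and> cmap (euclid I) i t \<in> V \<and>
      V \<subseteq> cimg (euclid I) i \<and> \<gamma> ` cinv (euclid I) i ` V \<subseteq> cdom ?C j \<and>
      smooth_on V (local_rep (euclid I) ?C \<gamma> i j)"
      using t \<gamma>dom ci I smR
      by (intro exI[of _ "()"] exI[of _ c] exI[of _ I]) (auto simp: charts_at_def cinv_euclid)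
  qed
  moreover have "\<gamma> ` I \<subseteq> \<mu> ` pts M" using cin by (auto simp: \<gamma>_def)
  moreover have \<gamma>0: "\<gamma> 0 = \<mu> p" using ci by (simp add: \<gamma>_def cinv_cmap)
  ultimately have "snd (tangent_map (euclid I) ?C \<gamma> (0, \<lambda>_. 1)) \<in> tangent_to ?C (\<mu> ` pts M) (\<mu> p)"
    unfolding tangent_to_def I_def using e(1) by blast
  moreover have "snd (tangent_map (euclid I) ?C \<gamma> (0, \<lambda>_. 1)) c = (a, fderiv ?m ?y a)"
  proof -
    have "c \<in> charts_at ?C (\<mu> p)"
      using c one_formD[OF \<mu> p] by (simp add: charts_at_cotangent_bundle)
    then have "snd (tangent_map (euclid I) ?C \<gamma> (0, \<lambda>_. 1)) c = fderiv ?R 0 1"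
      by (simp add: tangent_map_def \<gamma>0)
    moreover have "fderiv ?R 0 = (\<lambda>s. (s *\<^sub>R a, fderiv ?m ?y (s *\<^sub>R a)))"
    proof (rule fderiv_eqI)
      have l: "((\<lambda>t. ?y + t *\<^sub>R a) has_derivative (\<lambda>s. s *\<^sub>R a)) (at 0)"
        by (auto intro!: derivative_eq_intros)
      have "(?m has_derivative fderiv ?m ?y) (at (?y + 0 *\<^sub>R a))"
        using ci by (auto intro!: smooth_on_has_derivative[OF smooth_form_rep[OF \<mu>]])
      from has_derivative_Pair[OF l has_derivative_compose[OF l this]]
      show "(?R has_derivative (\<lambda>s. (s *\<^sub>R a, fderiv ?m ?y (s *\<^sub>R a)))) (at 0)"
        by (rule has_derivative_transform_within_open[OF _ I]) (simp add: R)
    qed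
    ultimately show ?thesis by simp
  qed
  ultimately show ?thesis by blast
qed

text \<open>The shear \<open>r\<close> from (q, p) to (q, p - m(q)) maps the chart image onto itself
  and straightens the graph of m to p = 0; the opposite shear \<open>s\<close> inverts it.\<close>

lemma submanifold_image:
  assumes \<mu>: "one_form M \<mu>"
  shows "submanifold (cotangent_bundle M) DIM('e) (\<mu> ` pts M)"
  unfolding submanifold_def
proof (intro conjI ballI)
  let ?C = "cotangent_bundle M"
  interpret C: smooth_atlas ?C by (rule atlas_cotangent_bundle)
  show "\<mu> ` pts M \<subseteq> pts ?C" using one_formD(3)[OF \<mu>] by blast
  fix x assume "x \<in> \<mu> ` pts M"
  then obtain p where p: "p \<in> pts M" "x = \<mu> p" by blast
  obtain i where i: "i \<in> idx M" "p \<in> cdom M i" using ex_chart[OF p(1)] by (auto simp: charts_at_def)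
  let ?m = "form_rep M \<mu> i"
  define B where "B = cimg M i"
  define V where "V = B \<times> (UNIV :: 'e set)"
  define W where "W = (UNIV :: 'e set) \<times> {0 :: 'e}"
  define r where "r y = (fst y, snd y - ?m (fst y))" for y
  define s where "s y = (fst y, snd y + ?m (fst y))" for y
  let ?\<psi> = "\<lambda>z. r (cmap ?C i z)"
  have B: "open B" using open_cimg[OF i(1)] by (simp add: B_def)
  have V: "open V" unfolding V_def by (intro open_Times B open_UNIV)
  have imV: "cimg ?C i = V" using cimg_cotangent_bundle[OF i(1)] by (simp add: V_def B_def)
  have smm: "smooth_on V (\<lambda>y. ?m (fst y))"
    by (rule smooth_on_compose[OF V B _ smooth_on_fst]) (use smooth_form_rep[OF \<mu> i(1)] in \<open>auto simp: V_def B_def\<close>)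
  have smr: "smooth_on V r" and sms: "smooth_on V s"
    unfolding r_def s_def by (intro smooth_on_Pair smooth_on_diff smooth_on_add V smm smooth_on_fst smooth_on_snd)+
  have rV: "r ` V = V"
  proof
    show "V \<subseteq> r ` V"
    proof
      fix y assume "y \<in> V"
      then show "y \<in> r ` V" by (intro image_eqI[of _ _ "s y"]) (auto simp: r_def s_def V_def)
    qed
  qed (auto simp: r_def V_def)
  have \<psi>im: "?\<psi> ` cdom ?C i = V" using rV imV by (metis image_image)
  have "diffeomorphism (open_sub ?C (cdom ?C i)) (open_sub (euclid UNIV) V) ?\<psi>"
    by (rule diffeomorphism_chartI[where i = i and j = "()" and r = r and s = s])
      (use i C.openin_cdom smr sms imV \<psi>im V in
        \<open>auto simp: smooth_atlas_euclid smooth_atlas.openin_iff[OF smooth_atlas_euclid] C.smooth_atlas_axioms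
          r_def s_def simp del: cotangent_bundle_simps(3,4)\<close>)
  then have "diffeomorphism (open_sub ?C (cdom ?C i)) (euclid V) ?\<psi>"
    by (simp add: open_sub_euclid)
  moreover have "openin (mtop ?C) (cdom ?C i)" using C.openin_cdom i by simp
  moreover have "x \<in> cdom ?C i" using i p one_formD[OF \<mu> p(1)] by simp
  moreover have "subspace W" unfolding W_def by (intro subspace_Times) auto
  moreover have "dim W = DIM('e)" unfolding W_def by (subst dim_Times) auto
  moreover have "?\<psi> ` (\<mu> ` pts M \<inter> cdom ?C i) = V \<inter> W"
  proof
    show "?\<psi> ` (\<mu> ` pts M \<inter> cdom ?C i) \<subseteq> V \<inter> W"
      using one_formD[OF \<mu>] i by (auto simp: r_def V_def W_def B_def form_rep_cmap)
    show "V \<inter> W \<subseteq> ?\<psi> ` (\<mu> ` pts M \<inter> cdom ?C i)"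
    proof
      fix y assume "y \<in> V \<inter> W"
      then obtain q where q: "q \<in> cdom M i" "y = (cmap M i q, 0)" by (auto simp: V_def W_def B_def)
      moreover have "q \<in> pts M" using q cdom_subset[OF i(1)] by blast
      ultimately show "y \<in> ?\<psi> ` (\<mu> ` pts M \<inter> cdom ?C i)"
        using one_formD[OF \<mu>, of q] i by (intro image_eqI[of _ _ "\<mu> q"]) (auto simp: r_def form_rep_cmap)
    qed
  qed
  ultimately show "\<exists>U V \<psi> W. openin (mtop ?C) U \<and> x \<in> U \<and> open (V :: ('e \<times> 'e) set) \<and>
    diffeomorphism (open_sub ?C U) (euclid V) \<psi> \<and> subspace W \<and> dim W = DIM('e) \<and>
    \<psi> ` (\<mu> ` pts M \<inter> U) = V \<inter> W"
    using V
    by (intro exI[of _ "cdom ?C i"] exI[of _ V] exI[of _ ?\<psi>] exI[of _ W] conjI)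
qed

text \<open>The dimension condition holds for every form. The tangent vectors make up the graph of
  the derivative of m, and on this graph the symplectic form measures the antisymmetric part of that
  derivative.\<close>

theorem lagrangian_image_iff_closed:
  assumes \<mu>: "one_form M \<mu>"
  shows "lagrangian_submanifold (cotangent_bundle M) (canonical_symplectic M) (\<mu> ` pts M)
    \<longleftrightarrow> closed_form M \<mu>"
proof -
  let ?C = "cotangent_bundle M" and ?N = "\<mu> ` pts M"
  interpret C: smooth_atlas ?C by (rule atlas_cotangent_bundle)
  \<comment> \<open>The symplectic form is evaluated in the chart chosen at the covector
    \<open>\<mu> p\<close>, which may differ from the one chosen at \<open>p\<close>.\<close>
  define chart where "chart p = chart_at ?C (\<mu> p)" for p
  have c: "chart p \<in> charts_at M p" if "p \<in> pts M" for p
    using C.chart_at_mem[OF one_formD(3)[OF \<mu> that]] one_formD[OF \<mu> that]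
    by (simp add: chart_def charts_at_cotangent_bundle)
  have iso: "(\<forall>u\<in>tangent_to ?C ?N (\<mu> p). \<forall>w\<in>tangent_to ?C ?N (\<mu> p). canonical_symplectic M (\<mu> p) u w = 0)
    \<longleftrightarrow> symmetric_derivative (form_rep M \<mu> (chart p)) (cmap M (chart p) p)"
    (is "?L \<longleftrightarrow> ?R") if p: "p \<in> pts M" for p
  proof
    assume L: ?L
    show ?R
      unfolding symmetric_derivative_def
    proof (intro allI)
      fix a b
      obtain u where u: "u \<in> tangent_to ?C ?N (\<mu> p)"
        "u (chart p) = (a, fderiv (form_rep M \<mu> (chart p)) (cmap M (chart p) p) a)"
        using ex_tangent_to_image[OF \<mu> p c[OF p], of a] by blast
      obtain w where w: "w \<in> tangent_to ?C ?N (\<mu> p)"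
        "w (chart p) = (b, fderiv (form_rep M \<mu> (chart p)) (cmap M (chart p) p) b)"
        using ex_tangent_to_image[OF \<mu> p c[OF p], of b] by blast
      show "fderiv (form_rep M \<mu> (chart p)) (cmap M (chart p) p) a \<bullet> b =
        fderiv (form_rep M \<mu> (chart p)) (cmap M (chart p) p) b \<bullet> a"
        using L[rule_format, OF u(1) w(1)] canonical_symplectic_eq[OF one_formD(3)[OF \<mu> p] chart_def, of u w] u(2) w(2)
        by simp
    qed
  next
    assume ?R
    then show ?L
      using canonical_symplectic_eq[OF one_formD(3)[OF \<mu> p] chart_def] tangent_to_image[OF \<mu> p c[OF p]]
      by (auto simp: symmetric_derivative_def)
  qed
  have "lagrangian_submanifold ?C (canonical_symplectic M) ?N \<longleftrightarrow>
    (\<forall>p\<in>pts M. symmetric_derivative (form_rep M \<mu> (chart p)) (cmap M (chart p) p))"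
    unfolding lagrangian_submanifold_def using submanifold_image[OF \<mu>] iso by (auto simp: DIM_prod)
  also have "\<dots> \<longleftrightarrow> closed_form M \<mu>"
    unfolding closed_form_iff[OF \<mu>]
  proof (intro iffI ballI)
    fix i y assume *: "\<forall>p\<in>pts M. symmetric_derivative (form_rep M \<mu> (chart p)) (cmap M (chart p) p)"
      and i: "i \<in> idx M" "y \<in> cimg M i"
    then obtain p where p: "p \<in> cdom M i" "y = cmap M i p" by blast
    then have "p \<in> pts M" using cdom_subset[OF i(1)] by blast
    then show "symmetric_derivative (form_rep M \<mu> i) y"
      using symmetric_derivative_chart[OF \<mu> _ c, of i p] * i p by (auto simp: charts_at_def)
  next
    fix p assume "p \<in> pts M" "\<forall>i\<in>idx M. \<forall>y\<in>cimg M i. symmetric_derivative (form_rep M \<mu> i) y"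
    then show "symmetric_derivative (form_rep M \<mu> (chart p)) (cmap M (chart p) p)"
      using c[of p] by (auto simp: charts_at_def)
  qed
  finally show ?thesis .
qed

end

section \<open>Primitives of closed one-forms\<close>

text \<open>The equation dL = \<mu> over \<open>W\<close>, written with
  \<open>has_derivative\<close> so that it includes differentiability of \<open>L\<close>; only the
  points of \<open>W\<close> in \<open>pts M\<close> count.\<close>

definition primitive_on ::
  "('p, 'e::euclidean_space, 'i) manifold \<Rightarrow> ('p \<Rightarrow> 'p \<times> ('i \<Rightarrow> 'e)) \<Rightarrow> 'p set \<Rightarrow> ('p \<Rightarrow> real) \<Rightarrow> bool" where
  "primitive_on M \<mu> W L \<longleftrightarrow> (\<forall>p\<in>pts M \<inter> W. \<forall>i\<in>charts_at M p.
    ((\<lambda>y. L (cinv M i y)) has_derivative (\<lambda>u. snd (\<mu> p) i \<bullet> u)) (at (cmap M i p)))"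

section \<open>Existence, uniqueness and smoothness of primitives\<close>

context smooth_atlas
begin

lemma openin_cinv_image:
  assumes i: "i \<in> idx M" and S: "open S" "S \<subseteq> cimg M i"
  shows "openin (mtop M) (cinv M i ` S)"
  unfolding openin_iff
proof (intro conjI ballI)
  show "cinv M i ` S \<subseteq> pts M" using cinv_mem S cdom_subset[OF i] by blast
  fix j assume j: "j \<in> idx M"
  have "cmap M j ` (cinv M i ` S \<inter> cdom M j) = overlap M j i \<inter> transition M j i -` S"
  proof (intro equalityI subsetI)
    fix z assume "z \<in> cmap M j ` (cinv M i ` S \<inter> cdom M j)"
    then obtain y where "y \<in> S" "cinv M i y \<in> cdom M j" "z = cmap M j (cinv M i y)" by blast
    then show "z \<in> overlap M j i \<inter> transition M j i -` S"
      using S(2) j cinv_mem[of y i] cmap_cinv[of y i] by (auto simp: transition_cmap)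
  next
    fix z assume "z \<in> overlap M j i \<inter> transition M j i -` S"
    then obtain p where "p \<in> cdom M j" "p \<in> cdom M i" "z = cmap M j p" "cmap M i p \<in> S"
      using j by (auto simp: transition_cmap)
    then show "z \<in> cmap M j ` (cinv M i ` S \<inter> cdom M j)"
      using i by (intro image_eqI[of _ _ p]) (auto intro!: image_eqI[of _ _ "cmap M i p"] simp: cinv_cmap)
  qed
  then show "open (cmap M j ` (cinv M i ` S \<inter> cdom M j))"
    using continuous_open_preimage[OF smooth_on_continuous[OF smooth_transition[OF j i]]
        open_overlap[OF j i] S(1)] by simp
qed

lemma cinv_image_iff:
  assumes "i \<in> idx M" "S \<subseteq> cimg M i"
  shows "p \<in> cinv M i ` S \<longleftrightarrow> p \<in> cdom M i \<and> cmap M i p \<in> S"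
proof
  assume "p \<in> cinv M i ` S"
  then obtain y where y: "y \<in> S" "p = cinv M i y" by blast
  then show "p \<in> cdom M i \<and> cmap M i p \<in> S"
    using assms(2) cinv_mem[of y i] cmap_cinv[of y i] by auto
next
  assume "p \<in> cdom M i \<and> cmap M i p \<in> S"
  then show "p \<in> cinv M i ` S"
    by (intro image_eqI[of _ _ "cmap M i p"]) (simp_all add: cinv_cmap[OF assms(1)])
qed

lemma open_image_Int:
  "openin (mtop M) W \<Longrightarrow> i \<in> idx M \<Longrightarrow> open (cmap M i ` (cdom M i \<inter> W))"
  unfolding openin_iff by (metis Int_commute)

lemma smooth_functionI:
  assumes "\<And>p. p \<in> pts M \<Longrightarrow> \<exists>i V. i \<in> charts_at M p \<and> open V \<and> cmap M i p \<in> V \<and>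
    V \<subseteq> cimg M i \<and> smooth_on V (\<lambda>y. h (cinv M i y))"
  shows "smooth_function M h"
  unfolding smooth_function_def
proof (rule smooth_mapI[OF smooth_atlas_axioms smooth_atlas_euclid])
  fix p assume "p \<in> pts M"
  from assms[OF this] obtain i V where "i \<in> charts_at M p" "open V" "cmap M i p \<in> V"
    "V \<subseteq> cimg M i" "smooth_on V (\<lambda>y. h (cinv M i y))" by blast
  then show "\<exists>i j V. i \<in> charts_at M p \<and> j \<in> charts_at (euclid UNIV) (h p) \<and> open V \<and> cmap M i p \<in> V \<and>
      V \<subseteq> cimg M i \<and> h ` cinv M i ` V \<subseteq> cdom (euclid UNIV) j \<and>
      smooth_on V (local_rep M (euclid UNIV) h i j)"
    by (intro exI[of _ i] exI[of _ "()"] exI[of _ V]) (auto simp: local_rep_def comp_def)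
qed auto

lemma smooth_function_cinv:
  assumes "smooth_function M h" "i \<in> idx M"
  shows "smooth_on (cimg M i) (\<lambda>y. h (cinv M i y))"
  using smooth_map_local_rep[of M "euclid UNIV" h i "()"] assms cdom_subset
  by (simp add: smooth_function_def local_rep_def comp_def)

lemma primitive_onD:
  assumes "primitive_on M \<mu> W L" "i \<in> idx M" "p \<in> cdom M i" "p \<in> W"
  shows "((\<lambda>y. L (cinv M i y)) has_derivative (\<lambda>u. form_rep M \<mu> i (cmap M i p) \<bullet> u)) (at (cmap M i p))"
  using assms cdom_subset[OF assms(2)] by (auto simp: primitive_on_def form_rep_cmap charts_at_def)

lemma primitive_on_smooth_on:
  assumes \<mu>: "one_form M \<mu>" and L: "primitive_on M \<mu> W L" and W: "openin (mtop M) (pts M \<inter> W)"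
    and i: "i \<in> idx M"
  shows "smooth_on (cmap M i ` (cdom M i \<inter> W)) (\<lambda>y. L (cinv M i y))"
proof -
  have "cdom M i \<inter> W = cdom M i \<inter> (pts M \<inter> W)" using cdom_subset[OF i] by blast
  then have o: "open (cmap M i ` (cdom M i \<inter> W))" using open_image_Int[OF W i] by simp
  show ?thesis
  proof (rule smooth_on_has_derivativeI[OF o])
    show "((\<lambda>y. L (cinv M i y)) has_derivative (\<lambda>u. form_rep M \<mu> i y \<bullet> u)) (at y)"
      if "y \<in> cmap M i ` (cdom M i \<inter> W)" for y
      using primitive_onD[OF L i] that by auto
    show "smooth_on (cmap M i ` (cdom M i \<inter> W)) (\<lambda>y. form_rep M \<mu> i y \<bullet> u)" for u
      by (intro smooth_on_linear_comp[OF o bounded_linear_inner_left]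
          smooth_on_subset[OF smooth_form_rep[OF \<mu> i]]) auto
  qed
qed

lemma primitive_on_smooth_function:
  assumes \<mu>: "one_form M \<mu>" and L: "primitive_on M \<mu> W L" and W: "openin (mtop M) (pts M \<inter> W)"
  shows "smooth_function (open_sub M W) L"
proof -
  interpret MW: smooth_atlas "open_sub M W" by (rule atlas_open_sub[OF W])
  show ?thesis
  proof (rule MW.smooth_functionI)
    fix p assume "p \<in> pts (open_sub M W)"
    then have p: "p \<in> pts M" "p \<in> W" by auto
    then obtain i where i: "i \<in> charts_at M p" using ex_chart by blast
    then have ii: "i \<in> idx M" "p \<in> cdom M i" by (auto simp: charts_at_def)
    have o: "open (cmap M i ` (cdom M i \<inter> W))" using MW.open_cimg[of i] ii by simp
    have "smooth_on (cmap M i ` (cdom M i \<inter> W)) (\<lambda>y. L (cinv (open_sub M W) i y))"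
      by (rule smooth_on_cong[OF o _ primitive_on_smooth_on[OF \<mu> L W ii(1)]]) (simp add: cinv_open_sub[OF ii(1)])
    then show "\<exists>i V. i \<in> charts_at (open_sub M W) p \<and> open V \<and> cmap (open_sub M W) i p \<in> V \<and>
      V \<subseteq> cimg (open_sub M W) i \<and> smooth_on V (\<lambda>y. L (cinv (open_sub M W) i y))"
      using ii p o by (intro exI[of _ i] exI[of _ "cmap M i ` (cdom M i \<inter> W)"]) (auto simp: charts_at_def)
  qed
qed

lemma has_derivative_change_chart:
  assumes i: "i \<in> charts_at M p" and j: "j \<in> charts_at M p"
    and L: "((\<lambda>y. L (cinv M i y)) has_derivative D) (at (cmap M i p))"
  shows "((\<lambda>y. L (cinv M j y)) has_derivative (\<lambda>u. D (fderiv (transition M j i) (cmap M j p) u))) (at (cmap M j p))"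
proof -
  have ij: "i \<in> idx M" "j \<in> idx M" "p \<in> cdom M i" "p \<in> cdom M j"
    using i j by (auto simp: charts_at_def)
  have "((\<lambda>y. L (cinv M i (transition M j i y))) has_derivative
      (\<lambda>u. D (fderiv (transition M j i) (cmap M j p) u))) (at (cmap M j p))"
    using has_derivative_compose[OF has_derivative_transition[OF j i], of "\<lambda>y. L (cinv M i y)" D] L ij
    by (simp add: transition_cmap)
  then show ?thesis
    by (rule has_derivative_transform_within_open[OF _ open_overlap[OF ij(2,1)]])
      (use ij in \<open>auto simp: transition_cmap cinv_cmap\<close>)
qed

text \<open>One chart per point suffices, since the differential of \<open>L\<close> and the
  components of \<mu> change charts by the same rule.\<close>

lemma primitive_onI:
  assumes \<mu>: "one_form M \<mu>"
    and "\<And>p. p \<in> pts M \<Longrightarrow> p \<in> W \<Longrightarrow> \<exists>i\<in>charts_at M p.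
      ((\<lambda>y. L (cinv M i y)) has_derivative (\<lambda>u. form_rep M \<mu> i (cmap M i p) \<bullet> u)) (at (cmap M i p))"
  shows "primitive_on M \<mu> W L"
  unfolding primitive_on_def
proof (intro ballI)
  fix p j assume p: "p \<in> pts M \<inter> W" and j: "j \<in> charts_at M p"
  then obtain i where i: "i \<in> charts_at M p" and
    d: "((\<lambda>y. L (cinv M i y)) has_derivative (\<lambda>u. form_rep M \<mu> i (cmap M i p) \<bullet> u)) (at (cmap M i p))"
    using assms(2) by blast
  have "snd (\<mu> p) j \<bullet> u = form_rep M \<mu> i (cmap M i p) \<bullet> fderiv (transition M j i) (cmap M j p) u" for u
    using form_rep_transition[OF \<mu> j i] j by (simp add: form_rep_cmap charts_at_def)
  then show "((\<lambda>y. L (cinv M j y)) has_derivative (\<lambda>u. snd (\<mu> p) j \<bullet> u)) (at (cmap M j p))"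
    using has_derivative_change_chart[OF i j d] by simp
qed

lemma ex_primitive_chart:
  assumes \<mu>: "one_form M \<mu>" and cl: "closed_form M \<mu>" and i: "i \<in> idx M"
    and S: "open S" "convex S" "S \<subseteq> cimg M i"
  shows "\<exists>L. primitive_on M \<mu> (cinv M i ` S) L"
proof -
  have "symmetric_derivative (form_rep M \<mu> i) y" if "y \<in> S" for y
    using cl S(3) i that unfolding closed_form_iff[OF \<mu>] by blast
  then obtain l where l: "\<And>y. y \<in> S \<Longrightarrow> (l has_derivative (\<lambda>u. form_rep M \<mu> i y \<bullet> u)) (at y)"
    using poincare_lemma[OF S(1,2) smooth_on_subset[OF smooth_form_rep[OF \<mu> i] S(3)]]
    unfolding symmetric_derivative_def by blast
  have "primitive_on M \<mu> (cinv M i ` S) (\<lambda>p. l (cmap M i p))"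
  proof (rule primitive_onI[OF \<mu>])
    fix p assume "p \<in> cinv M i ` S"
    then have p: "p \<in> cdom M i" "cmap M i p \<in> S" using cinv_image_iff[OF i S(3)] by auto
    have "((\<lambda>y. l (cmap M i (cinv M i y))) has_derivative (\<lambda>u. form_rep M \<mu> i (cmap M i p) \<bullet> u)) (at (cmap M i p))"
      by (rule has_derivative_transform_within_open[OF l[OF p(2)] S(1) p(2)])
        (use S(3) cmap_cinv in \<open>auto simp: subset_iff\<close>)
    then show "\<exists>i'\<in>charts_at M p. ((\<lambda>y. l (cmap M i (cinv M i' y))) has_derivative
        (\<lambda>u. form_rep M \<mu> i' (cmap M i' p) \<bullet> u)) (at (cmap M i' p))"
      using i p by (auto simp: charts_at_def)
  qed
  then show ?thesis by blast
qed

text \<open>The difference of the primitives has derivative zero along the convex set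
  \<open>S\<close>. \<open>S\<close> may be a ball times all velocities or a single fibre, and both
  cases are used.\<close>

lemma primitive_on_unique:
  assumes L: "primitive_on M \<mu> W L" "primitive_on M \<mu> W' L'" and i: "i \<in> idx M"
    and S: "convex S" "S \<subseteq> cimg M i" "cinv M i ` S \<subseteq> W \<inter> W'"
  shows "\<exists>c. \<forall>p\<in>cinv M i ` S. L p - L' p = c"
proof -
  have "((\<lambda>y. L (cinv M i y) - L' (cinv M i y)) has_derivative (\<lambda>_. 0)) (at y within S)" if "y \<in> S" for y
  proof -
    have p: "cinv M i y \<in> cdom M i" "cmap M i (cinv M i y) = y" "cinv M i y \<in> W" "cinv M i y \<in> W'"
      using that S cinv_mem[of y i] cmap_cinv[of y i] by auto
    have "((\<lambda>y. L (cinv M i y) - L' (cinv M i y)) has_derivative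
        (\<lambda>u. form_rep M \<mu> i y \<bullet> u - form_rep M \<mu> i y \<bullet> u)) (at y)"
      using primitive_onD[OF L(1) i p(1,3)] primitive_onD[OF L(2) i p(1,4)] p(2)
      by (intro has_derivative_diff) auto
    then show ?thesis by (simp add: has_derivative_at_withinI)
  qed
  from has_derivative_zero_constant[OF S(1) this] show ?thesis by blast
qed

text \<open>Where the form is dL, its derivative is the second derivative of \<open>L\<close>, which
  is symmetric.\<close>

lemma primitive_on_imp_symmetric:
  assumes \<mu>: "one_form M \<mu>" and L: "primitive_on M \<mu> W L" and W: "openin (mtop M) (pts M \<inter> W)"
    and i: "i \<in> idx M" and p: "p \<in> cdom M i" "p \<in> W"
  shows "symmetric_derivative (form_rep M \<mu> i) (cmap M i p)"
proof -
  let ?l = "\<lambda>y. L (cinv M i y)" and ?O = "cmap M i ` (cdom M i \<inter> W)" and ?y = "cmap M i p"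
  have "cdom M i \<inter> W = cdom M i \<inter> (pts M \<inter> W)" using cdom_subset[OF i] by blast
  then have o: "open ?O" "?y \<in> ?O" using open_image_Int[OF W i] p by auto
  have sm: "smooth_on ?O ?l" by (rule primitive_on_smooth_on[OF \<mu> L W i])
  have dl: "fderiv ?l y u = form_rep M \<mu> i y \<bullet> u" if "y \<in> ?O" for y u
    using fderiv_eqI[OF primitive_onD[OF L i]] that by auto
  have "(form_rep M \<mu> i has_derivative fderiv (form_rep M \<mu> i) ?y) (at ?y)"
    by (rule smooth_on_has_derivative[OF smooth_form_rep[OF \<mu> i]]) (use p in auto)
  from fderiv_eqI[OF bounded_linear.has_derivative[OF bounded_linear_inner_left this]]
  have "fderiv (\<lambda>y. form_rep M \<mu> i y \<bullet> u) ?y w = fderiv (form_rep M \<mu> i) ?y w \<bullet> u" for u w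
    by simp
  moreover have "fderiv (\<lambda>y. form_rep M \<mu> i y \<bullet> u) ?y = fderiv (\<lambda>y. fderiv ?l y u) ?y" for u
    by (rule fderiv_cong_open[OF o]) (simp add: dl)
  ultimately show ?thesis
    unfolding symmetric_derivative_def using second_derivative_symmetric[OF o(1) sm o(2)] by metis
qed

end

section \<open>Fibre preserving maps from the tangent to the cotangent bundle\<close>

text \<open>The joint derivative exists by smoothness and is the sum of its two partial derivatives,
  found by freezing \<open>v\<close> and by freezing \<open>q\<close>; in \<open>v\<close> the map
  is linear.\<close>

lemma has_derivative_fderiv_apply:
  assumes S: "open S" and sm: "smooth_on S t" and q: "q \<in> S"
  shows "((\<lambda>y. fderiv t (fst y) (snd y)) has_derivative
    (\<lambda>u. fderiv (\<lambda>z. fderiv t z v) q (fst u) + fderiv t q (snd u))) (at (q, v))"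
proof -
  let ?G = "\<lambda>y. fderiv t (fst y) (snd y)"
  have "smooth_on (S \<times> UNIV) ?G"
    by (intro smooth_on_fderiv_apply[OF _ S sm smooth_on_fst smooth_on_snd] open_Times S) auto
  then have d: "(?G has_derivative fderiv ?G (q, v)) (at (q, v))"
    by (rule smooth_on_has_derivative) (use q in auto)
  have "((\<lambda>z. ?G (z, v)) has_derivative (\<lambda>a. fderiv ?G (q, v) (a, 0))) (at q)"
    by (rule has_derivative_compose[of "\<lambda>z. (z, v)" "\<lambda>a. (a, 0)" q UNIV ?G, OF _ d])
      (auto intro!: derivative_eq_intros)
  from fderiv_eqI[OF this] have 1: "fderiv (\<lambda>z. fderiv t z v) q a = fderiv ?G (q, v) (a, 0)" for a
    by simp
  have "((\<lambda>w. ?G (q, w)) has_derivative (\<lambda>b. fderiv ?G (q, v) (0, b))) (at v)"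
    by (rule has_derivative_compose[of "\<lambda>w. (q, w)" "\<lambda>b. (0, b)" v UNIV ?G, OF _ d])
      (auto intro!: derivative_eq_intros)
  then have "fderiv (\<lambda>w. ?G (q, w)) v = (\<lambda>b. fderiv ?G (q, v) (0, b))"
    by (rule fderiv_eqI)
  moreover have "((\<lambda>w. fderiv t q w) has_derivative fderiv t q) (at v)"
    by (rule bounded_linear_imp_has_derivative[OF has_derivative_bounded_linear[OF
          smooth_on_has_derivative[OF sm q]]])
  then have "fderiv (\<lambda>w. ?G (q, w)) v = fderiv t q"
    by (simp add: fderiv_eqI)
  ultimately have 2: "fderiv ?G (q, v) (0, b) = fderiv t q b" for b
    by (simp add: fun_eq_iff)
  have split: "fderiv ?G (q, v) u = fderiv ?G (q, v) (fst u, 0) + fderiv ?G (q, v) (0, snd u)" for u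
    using linear_add[OF has_derivative_linear[OF d], of "(fst u, 0)" "(0, snd u)"] by simp
  have "fderiv ?G (q, v) = (\<lambda>u. fderiv (\<lambda>z. fderiv t z v) q (fst u) + fderiv t q (snd u))"
    by (rule ext) (subst split, simp only: 1 2)
  then show ?thesis
    using d by simp
qed

definition fibre_rep ::
  "('p, 'e::euclidean_space, 'i) manifold \<Rightarrow> ('p \<times> ('i \<Rightarrow> 'e) \<Rightarrow> 'p \<times> ('i \<Rightarrow> 'e)) \<Rightarrow> 'i \<Rightarrow> 'e \<times> 'e \<Rightarrow> 'e" where
  "fibre_rep M F i y = snd (F (cinv (tangent_bundle M) i y)) i"

locale sode_atlas = smooth_atlas M for M :: "('p, 'e::euclidean_space, 'i) manifold" +
  fixes \<Gamma> :: "'p \<times> ('i \<Rightarrow> 'e) \<Rightarrow> ('p \<times> ('i \<Rightarrow> 'e)) \<times> ('i \<Rightarrow> 'e \<times> 'e)"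
  assumes sode: "sode M \<Gamma>"
begin

sublocale T: smooth_atlas T by (rule atlas_tangent_bundle)
sublocale C: smooth_atlas C by (rule atlas_cotangent_bundle)

lemma sodeD:
  assumes "x \<in> pts T"
  shows "fst (\<Gamma> x) = x" "snd (\<Gamma> x) \<in> tangent_space T x" "fst (snd (\<Gamma> x) i) = snd x i"
proof -
  have vf: "vector_field T \<Gamma>" and ve: "vertical_endo (\<Gamma> x) = liouville_field x"
    using sode assms by (simp_all add: sode_def del: tangent_bundle_simps)
  show 1: "fst (\<Gamma> x) = x" using vf assms by (simp add: vector_field_def del: tangent_bundle_simps)
  have "\<Gamma> x \<in> pts (tangent_bundle T)"
    using vf assms unfolding vector_field_def smooth_map_def by blast
  then show "snd (\<Gamma> x) \<in> tangent_space T x"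
    using 1 by (simp only: tangent_bundle_simps(1))
  show "fst (snd (\<Gamma> x) i) = snd x i"
    using ve by (auto simp: vertical_endo_def liouville_field_def split_beta fun_eq_iff)
qed

lemma cdomT_pts: "i \<in> idx M \<Longrightarrow> x \<in> cdom T i \<Longrightarrow> x \<in> pts T"
  using T.cdom_subset[of i] by auto

lemma charts_at_T: "x \<in> pts T \<Longrightarrow> charts_at T x = charts_at M (fst x)"
  by (simp add: charts_at_tangent_bundle)

lemma smooth_sode_rep:
  assumes "i \<in> idx M"
  shows "smooth_on (cimg T i) (\<lambda>y. snd (\<Gamma> (cinv T i y)) i)"
proof -
  have "smooth_map T (tangent_bundle T) \<Gamma>"
    using sode by (simp add: sode_def vector_field_def)
  then have "smooth_on (cimg T i) (local_rep T (tangent_bundle T) \<Gamma> i i)"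
  proof (rule smooth_map_local_rep)
    show "\<Gamma> x \<in> cdom (tangent_bundle T) i" if "x \<in> cdom T i" for x
      using that sodeD[OF cdomT_pts[OF assms that]] by (simp only: tangent_bundle_simps(3))
  qed (use assms T.cdom_subset[of i] in auto)
  then have "smooth_on (cimg T i) (\<lambda>y. snd (local_rep T (tangent_bundle T) \<Gamma> i i y))"
    using T.open_cimg[of i] assms by (intro smooth_on_linear_comp[OF _ bounded_linear_snd]) auto
  then show ?thesis
    by (simp add: local_rep_def)
qed

text \<open>The derivative of the tangent lift of a transition map. Its second derivative term, with
  the velocity \<open>snd x i\<close> in the inner slot, is the one that \<open>mu_covector\<close>
  has to reproduce.\<close>

lemma fderiv_transition_T:
  assumes x: "x \<in> pts T" and i: "i \<in> charts_at M (fst x)" and j: "j \<in> charts_at M (fst x)"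
  shows "fderiv (transition T i j) (cmap T i x) (a, b) =
    (fderiv (transition M i j) (cmap M i (fst x)) a,
     fderiv (\<lambda>z. fderiv (transition M i j) z (snd x i)) (cmap M i (fst x)) a
       + fderiv (transition M i j) (cmap M i (fst x)) b)"
proof -
  let ?O = "overlap M i j" and ?t = "transition M i j" and ?q = "cmap M i (fst x)"
  have ij: "i \<in> idx M" "j \<in> idx M" "fst x \<in> cdom M i" "fst x \<in> cdom M j"
    using i j by (auto simp: charts_at_def)
  have o: "open ?O" and sm: "smooth_on ?O ?t" and q: "?q \<in> ?O"
    using open_overlap smooth_transition ij by auto
  have y: "cmap T i x = (?q, snd x i)" by simp
  have "((\<lambda>y. (?t (fst y), fderiv ?t (fst y) (snd y))) has_derivative
      (\<lambda>u. (fderiv ?t ?q (fst u), fderiv (\<lambda>z. fderiv ?t z (snd x i)) ?q (fst u) + fderiv ?t ?q (snd u))))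
      (at (?q, snd x i))"
    using has_derivative_compose[OF has_derivative_fst[OF has_derivative_ident], of ?t "fderiv ?t ?q" "(?q, snd x i)"]
      smooth_on_has_derivative[OF sm q]
    by (intro has_derivative_Pair has_derivative_fderiv_apply[OF o sm q]) simp
  then have "(transition T i j has_derivative
      (\<lambda>u. (fderiv ?t ?q (fst u), fderiv (\<lambda>z. fderiv ?t z (snd x i)) ?q (fst u) + fderiv ?t ?q (snd u))))
      (at (?q, snd x i))"
    by (rule has_derivative_transform_within_open[of _ _ _ _ "?O \<times> UNIV"])
      (use o q ij in \<open>auto intro: open_Times simp: transition_tangent_bundle\<close>)
  from fderiv_eqI[OF this] show ?thesis unfolding y by simp
qed

end

section \<open>The one-form associated with a fibre preserving map\<close>

locale sode_fibre_map = sode_atlas M \<Gamma> for M :: "('p, 'e::euclidean_space, 'i) manifold" and \<Gamma> +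
  fixes F :: "'p \<times> ('i \<Rightarrow> 'e) \<Rightarrow> 'p \<times> ('i \<Rightarrow> 'e)"
  assumes smooth_F: "smooth_map T C F" and fibred: "x \<in> pts T \<Longrightarrow> fst (F x) = fst x"
begin

abbreviation \<mu> where "\<mu> \<equiv> mu_form M \<Gamma> F"

lemma F_covector: "x \<in> pts T \<Longrightarrow> snd (F x) \<in> cotangent_space M (fst x)"
proof -
  assume x: "x \<in> pts T"
  have "F x \<in> pts C" using smooth_F x unfolding smooth_map_def by blast
  then show ?thesis using fibred[OF x] by simp
qed

lemma F_cdom: "i \<in> idx M \<Longrightarrow> x \<in> cdom T i \<Longrightarrow> F x \<in> cdom C i"
  using F_covector[OF cdomT_pts] fibred[OF cdomT_pts] by simp

lemma smooth_fibre_rep: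
  assumes "i \<in> idx M"
  shows "smooth_on (cimg T i) (fibre_rep M F i)"
proof -
  have "smooth_on (cimg T i) (local_rep T C F i i)"
    using smooth_F by (rule smooth_map_local_rep)
      (use assms T.cdom_subset[of i] F_cdom[OF assms] in \<open>auto simp del: cotangent_bundle_simps(3)\<close>)
  then have "smooth_on (cimg T i) (\<lambda>y. snd (local_rep T C F i i y))"
    using T.open_cimg[of i] assms by (intro smooth_on_linear_comp[OF _ bounded_linear_snd]) auto
  then show ?thesis
    by (simp add: local_rep_def fibre_rep_def[abs_def])
qed

lemma fibre_rep_cmap: "i \<in> idx M \<Longrightarrow> x \<in> cdom T i \<Longrightarrow> fibre_rep M F i (cmap T i x) = snd (F x) i"
  unfolding fibre_rep_def by (subst T.cinv_cmap) auto

lemma local_rep_F: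
  assumes "i \<in> idx M" "y \<in> cimg T i"
  shows "local_rep T C F i i y = (fst y, fibre_rep M F i y)"
proof -
  obtain x where x: "x \<in> cdom T i" "y = cmap T i x" using assms by blast
  then show ?thesis
    using fibred[OF cdomT_pts[OF assms(1) x(1)]] T.cinv_cmap[of i x] assms(1)
    by (simp add: local_rep_def fibre_rep_def)
qed

lemma fibre_rep_transition:
  assumes x: "x \<in> pts T" and i: "i \<in> charts_at M (fst x)" and j: "j \<in> charts_at M (fst x)"
  shows "fibre_rep M F i (cmap T i x) \<bullet> a
    = fibre_rep M F j (cmap T j x) \<bullet> fderiv (transition M i j) (cmap M i (fst x)) a"
proof -
  have "i \<in> idx M" "j \<in> idx M" "x \<in> cdom T i" "x \<in> cdom T j"
    using x i j by (auto simp: charts_at_def)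
  then show ?thesis
    using cotangent_space_transition[OF F_covector[OF x] i j] by (simp only: fibre_rep_cmap)
qed

text \<open>\<open>tangent_map\<close> uses one source chart for all target charts. The
  representative from \<open>c\<close> to \<open>j\<close> factors through the transition from
  \<open>c\<close> to \<open>j\<close>, which carries the components of \<Gamma> in \<open>c\<close>
  to those in \<open>j\<close>, so \<open>c\<close> drops out.\<close>

lemma mu_form_eq:
  assumes x: "x \<in> pts T"
  shows "\<mu> x = (x, \<lambda>j. if j \<in> charts_at M (fst x)
    then (fderiv (fibre_rep M F j) (cmap T j x) (snd (\<Gamma> x) j), snd (F x) j) else 0)"
proof -
  define c where "c = chart_at T x"
  have c: "c \<in> charts_at M (fst x)"
    using T.chart_at_mem[OF x] charts_at_T[OF x] by (simp add: c_def)
  then have cT: "c \<in> idx T" "x \<in> cdom T c" "c \<in> charts_at T x"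
    using x by (auto simp: charts_at_def)
  have W: "fderiv (local_rep T C F c j) (cmap T c x) (snd (\<Gamma> x) c)
      = (snd x j, fderiv (fibre_rep M F j) (cmap T j x) (snd (\<Gamma> x) j))"
    if j: "j \<in> charts_at M (fst x)" for j
  proof -
    have jT: "j \<in> idx T" "j \<in> idx M" "x \<in> cdom T j" "j \<in> charts_at T x"
      using x j by (auto simp: charts_at_def)
    have "((\<lambda>y. (fst y, fibre_rep M F j y)) has_derivative
        (\<lambda>u. (fst u, fderiv (fibre_rep M F j) (cmap T j x) u))) (at (cmap T j x))"
      using jT
      by (intro has_derivative_Pair has_derivative_fst has_derivative_ident
          smooth_on_has_derivative[OF smooth_fibre_rep]) auto
    then have "(local_rep T C F j j has_derivative
        (\<lambda>u. (fst u, fderiv (fibre_rep M F j) (cmap T j x) u))) (at (cmap T j x))"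
      by (rule has_derivative_transform_within_open[OF _ T.open_cimg[OF jT(1)]])
        (use jT local_rep_F in \<open>auto simp del: tangent_bundle_simps\<close>)
    then have "((\<lambda>y. local_rep T C F j j (transition T c j y)) has_derivative
        (\<lambda>u. (fst (fderiv (transition T c j) (cmap T c x) u),
          fderiv (fibre_rep M F j) (cmap T j x) (fderiv (transition T c j) (cmap T c x) u)))) (at (cmap T c x))"
      using has_derivative_compose[OF T.has_derivative_transition[OF cT(3) jT(4)], of "local_rep T C F j j"]
      by (simp add: T.transition_cmap[OF cT(1,2)] del: tangent_bundle_simps)
    then have "(local_rep T C F c j has_derivative
        (\<lambda>u. (fst (fderiv (transition T c j) (cmap T c x) u),
          fderiv (fibre_rep M F j) (cmap T j x) (fderiv (transition T c j) (cmap T c x) u)))) (at (cmap T c x))"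
      by (rule has_derivative_transform_within_open[OF _ T.open_overlap[OF cT(1) jT(1)]])
        (use cT jT in \<open>auto simp: local_rep_def T.transition_cmap T.cinv_cmap simp del: tangent_bundle_simps\<close>)
    from fderiv_eqI[OF this] show ?thesis
      using T.tangent_space_transition[OF sodeD(2)[OF x] cT(3) jT(4)] sodeD(3)[OF x, of j] by simp
  qed
  have ch: "charts_at C (F x) = charts_at M (fst x)"
    using F_covector[OF x] fibred[OF x] by (simp add: charts_at_cotangent_bundle)
  have "\<Gamma> x = (x, snd (\<Gamma> x))" using sodeD(1)[OF x] by (simp add: prod_eq_iff)
  then have "\<mu> x = tulczyjew (tangent_map T C F (x, snd (\<Gamma> x)))"
    unfolding mu_form_def comp_def by metis
  also have "tangent_map T C F (x, snd (\<Gamma> x)) = (F x, \<lambda>j. if j \<in> charts_at M (fst x)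
      then (snd x j, fderiv (fibre_rep M F j) (cmap T j x) (snd (\<Gamma> x) j)) else 0)"
    unfolding tangent_map_def split_conv c_def[symmetric] ch using W by (simp cong: if_cong)
  also have "tulczyjew \<dots> = (x, \<lambda>j. if j \<in> charts_at M (fst x)
    then (fderiv (fibre_rep M F j) (cmap T j x) (snd (\<Gamma> x) j), snd (F x) j) else 0)"
    \<comment> \<open>The normalisation to 0 off the charts matters: the base point produced by
      \<open>tulczyjew\<close> is equal to \<open>x\<close>, and its momentum part to the stated
      one, at all indices.\<close>
    using x fibred[OF x] tangent_space_zero[of "snd x" "fst x"] cotangent_space_zero[OF F_covector[OF x]]
    by (auto simp: tulczyjew_def split_beta prod_eq_iff fun_eq_iff)
  finally show ?thesis .
qed

lemma form_rep_mu:
  assumes i: "i \<in> idx M" and y: "y \<in> cimg T i"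
  shows "form_rep T \<mu> i y = (fderiv (fibre_rep M F i) y (snd (\<Gamma> (cinv T i y)) i), fibre_rep M F i y)"
proof -
  have x: "cinv T i y \<in> cdom T i" "cmap T i (cinv T i y) = y"
    using T.cinv_mem[OF y] T.cmap_cinv[OF y] by auto
  then have "i \<in> charts_at M (fst (cinv T i y))"
    using i by (simp add: charts_at_def)
  then show ?thesis
    using x(2)
    by (simp add: form_rep_def mu_form_eq[OF cdomT_pts[OF i x(1)]] fibre_rep_def del: tangent_bundle_simps)
qed

lemma snd_sode_rep:
  assumes i: "i \<in> idx M" and y: "y \<in> cimg T i"
  shows "snd (\<Gamma> (cinv T i y)) i = (snd y, snd (snd (\<Gamma> (cinv T i y)) i))"
proof -
  have "cinv T i y \<in> cdom T i" "cmap T i (cinv T i y) = y"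
    using T.cinv_mem[OF y] T.cmap_cinv[OF y] by auto
  then show ?thesis
    using sodeD(3)[OF cdomT_pts[OF i], of "cinv T i y" i] by (auto simp: prod_eq_iff)
qed

text \<open>The transformation law of f is paired with a fixed \<open>a\<close> and differentiated
  along \<Gamma>. This produces the second derivative of the transition in the directions
  \<open>a\<close> and velocity, as does the lifted transition, with the two slots
  interchanged.\<close>

lemma mu_covector:
  assumes x: "x \<in> pts T"
  shows "snd (\<mu> x) \<in> cotangent_space T x"
proof -
  have ij: "snd (\<mu> x) i \<bullet> w = snd (\<mu> x) j \<bullet> fderiv (transition T i j) (cmap T i x) w"
    if i: "i \<in> charts_at M (fst x)" and j: "j \<in> charts_at M (fst x)" for i j w
  proof -
    obtain a b where w: "w = (a, b)" by (cases w)
    let ?f = "fibre_rep M F" and ?y = "cmap T i x" and ?z = "cmap T j x" and ?q = "cmap M i (fst x)"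
    let ?t = "transition M i j" and ?X = "snd (\<Gamma> x)"
    have xi: "i \<in> idx M" "j \<in> idx M" "i \<in> idx T" "j \<in> idx T" "x \<in> cdom T i" "x \<in> cdom T j"
      "i \<in> charts_at T x" "j \<in> charts_at T x" "fst x \<in> cdom M i" "fst x \<in> cdom M j"
      using x i j by (auto simp: charts_at_def)
    let ?O = "overlap M i j"
    have o: "open ?O" and sm: "smooth_on ?O ?t" and q: "?q \<in> ?O"
      using open_overlap smooth_transition xi by auto
    have f: "(?f k has_derivative fderiv (?f k) (cmap T k x)) (at (cmap T k x))"
      if "k \<in> idx M" "x \<in> cdom T k" for k
      using that by (intro smooth_on_has_derivative[OF smooth_fibre_rep]) (auto simp del: tangent_bundle_simps)
    have "((\<lambda>y. ?f j (transition T i j y)) has_derivative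
        (\<lambda>u. fderiv (?f j) ?z (fderiv (transition T i j) ?y u))) (at ?y)"
      using has_derivative_compose[OF T.has_derivative_transition[OF xi(7,8)], of "?f j"] f[OF xi(2,6)]
      by (simp add: T.transition_cmap[OF xi(3,5)] del: tangent_bundle_simps)
    moreover have "((\<lambda>y. fderiv ?t (fst y) a) has_derivative
        (\<lambda>u. fderiv (\<lambda>z. fderiv ?t z a) ?q (fst u))) (at ?y)"
      using has_derivative_compose[OF has_derivative_fst[OF has_derivative_ident], of "\<lambda>z. fderiv ?t z a"
          "fderiv (\<lambda>z. fderiv ?t z a) ?q" ?y]
        smooth_on_has_derivative[OF smooth_on_fderiv[OF sm] q, of a] by simp
    ultimately have "((\<lambda>y. ?f j (transition T i j y) \<bullet> fderiv ?t (fst y) a) has_derivative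
        (\<lambda>u. ?f j (transition T i j ?y) \<bullet> fderiv (\<lambda>z. fderiv ?t z a) ?q (fst u)
          + fderiv (?f j) ?z (fderiv (transition T i j) ?y u) \<bullet> fderiv ?t (fst ?y) a)) (at ?y)"
      by (rule has_derivative_inner)
    then have "((\<lambda>y. ?f i y \<bullet> a) has_derivative
        (\<lambda>u. ?f j (transition T i j ?y) \<bullet> fderiv (\<lambda>z. fderiv ?t z a) ?q (fst u)
          + fderiv (?f j) ?z (fderiv (transition T i j) ?y u) \<bullet> fderiv ?t (fst ?y) a)) (at ?y)"
    proof (rule has_derivative_transform_within_open[OF _ T.open_overlap[OF xi(3,4)]])
      show "?y \<in> overlap T i j" using xi by blast
      fix y assume "y \<in> overlap T i j"
      then obtain x' where x': "x' \<in> cdom T i" "x' \<in> cdom T j" "y = cmap T i x'" by blast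
      then have "i \<in> charts_at M (fst x')" "j \<in> charts_at M (fst x')"
        using xi by (auto simp: charts_at_def)
      then show "?f j (transition T i j y) \<bullet> fderiv ?t (fst y) a = ?f i y \<bullet> a"
        using fibre_rep_transition[OF cdomT_pts[OF xi(1) x'(1)], of i j a] x'(3)
          T.transition_cmap[OF xi(3) x'(1), of j] by simp
    qed
    moreover have "((\<lambda>y. ?f i y \<bullet> a) has_derivative (\<lambda>u. fderiv (?f i) ?y u \<bullet> a)) (at ?y)"
      by (intro bounded_linear.has_derivative[OF bounded_linear_inner_left] f xi)
    ultimately have "(\<lambda>u. fderiv (?f i) ?y u \<bullet> a) =
        (\<lambda>u. ?f j (transition T i j ?y) \<bullet> fderiv (\<lambda>z. fderiv ?t z a) ?q (fst u)
          + fderiv (?f j) ?z (fderiv (transition T i j) ?y u) \<bullet> fderiv ?t (fst ?y) a)"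
      by (rule has_derivative_unique[rotated])
    \<comment> \<open>Evaluation along \<Gamma>: its base part is the velocity
      \<open>snd x i\<close> by the \<open>sode\<close> condition, and the lifted transition carries
      its components from \<open>i\<close> to \<open>j\<close>.\<close>
    from fun_cong[OF this, of "?X i"]
    have "fderiv (?f i) ?y (?X i) \<bullet> a = ?f j ?z \<bullet> fderiv (\<lambda>z. fderiv ?t z a) ?q (snd x i)
        + fderiv (?f j) ?z (?X j) \<bullet> fderiv ?t ?q a"
      using T.transition_cmap[OF xi(3,5), of j] sodeD(3)[OF x, of i]
        T.tangent_space_transition[OF sodeD(2)[OF x] xi(7,8)] by simp
    \<comment> \<open>Equality of mixed derivatives puts the velocity into the inner slot, as in
      \<open>fderiv_transition_T\<close>.\<close>
    also have "fderiv (\<lambda>z. fderiv ?t z a) ?q (snd x i) = fderiv (\<lambda>z. fderiv ?t z (snd x i)) ?q a"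
      by (rule second_derivative_symmetric[OF o sm q])
    finally have A: "fderiv (?f i) ?y (?X i) \<bullet> a = ?f j ?z \<bullet> fderiv (\<lambda>z. fderiv ?t z (snd x i)) ?q a
        + fderiv (?f j) ?z (?X j) \<bullet> fderiv ?t ?q a" .
    have "snd (\<mu> x) i \<bullet> w = fderiv (?f i) ?y (?X i) \<bullet> a + ?f i ?y \<bullet> b"
      using i xi fibre_rep_cmap[OF xi(1,5)] by (simp add: mu_form_eq[OF x] w del: tangent_bundle_simps)
    also have "\<dots> = fderiv (?f j) ?z (?X j) \<bullet> fderiv ?t ?q a
        + ?f j ?z \<bullet> (fderiv (\<lambda>z. fderiv ?t z (snd x i)) ?q a + fderiv ?t ?q b)"
      unfolding A fibre_rep_transition[OF x i j] by (simp add: inner_add_right)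
    also have "\<dots> = snd (\<mu> x) j \<bullet> fderiv (transition T i j) ?y w"
      using j xi fibre_rep_cmap[OF xi(2,6)]
      by (simp add: mu_form_eq[OF x] w fderiv_transition_T[OF x i j] del: tangent_bundle_simps)
    finally show ?thesis .
  qed
  show ?thesis
    unfolding cotangent_space_def mem_Collect_eq charts_at_T[OF x]
    by (intro conjI ballI allI impI ij) (simp_all add: mu_form_eq[OF x])
qed

lemma one_form_mu: "one_form T \<mu>"
proof (rule T.one_formI)
  show "fst (\<mu> x) = x" if "x \<in> pts T" for x by (simp add: mu_form_eq[OF that])
  show "snd (\<mu> x) \<in> cotangent_space T x" if "x \<in> pts T" for x by (rule mu_covector[OF that])
  fix i assume "i \<in> idx T"
  then have i: "i \<in> idx M" "i \<in> idx T" by simp_all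
  have o: "open (cimg T i)" by (rule T.open_cimg[OF i(2)])
  have "smooth_on (cimg T i)
      (\<lambda>y. (fderiv (fibre_rep M F i) y (snd (\<Gamma> (cinv T i y)) i), fibre_rep M F i y))"
    by (intro smooth_on_Pair o smooth_fibre_rep i smooth_sode_rep smooth_on_ident
        smooth_on_fderiv_apply[OF o o]) auto
  then show "smooth_on (cimg T i) (form_rep T \<mu> i)"
    by (rule smooth_on_cong[OF o, rotated]) (simp add: form_rep_mu[OF i(1)])
qed

end

subsection \<open>Local diffeomorphisms\<close>

text \<open>A local diffeomorphism is given through the charts of \<open>open_sub\<close>; this
  restores representatives in the charts of the full manifolds, where chain rules can be
  applied.\<close>

lemma smooth_map_open_subD:
  assumes M: "smooth_atlas M" and f: "smooth_map (open_sub M U) (open_sub N V) f"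
    and p: "p \<in> pts M" "p \<in> U" and i: "i \<in> charts_at M p" and j: "j \<in> charts_at N (f p)" "f p \<in> V"
  shows "\<exists>W. open W \<and> cmap M i p \<in> W \<and> W \<subseteq> cmap M i ` (cdom M i \<inter> U) \<and>
    (\<forall>y\<in>W. f (cinv M i y) \<in> cdom N j \<inter> V) \<and> smooth_on W (local_rep M N f i j)"
proof -
  interpret smooth_atlas M by fact
  have ii: "i \<in> idx M" using i by (simp add: charts_at_def)
  have "p \<in> pts (open_sub M U)" "i \<in> charts_at (open_sub M U) p" "j \<in> charts_at (open_sub N V) (f p)"
    using p i j by (simp_all add: charts_at_open_sub)
  from f[unfolded smooth_map_def, THEN conjunct2, rule_format, OF this]
  obtain W where W: "open W" "cmap M i p \<in> W" "W \<subseteq> cmap M i ` (cdom M i \<inter> U)"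
    "f ` cinv (open_sub M U) i ` W \<subseteq> cdom N j \<inter> V"
    and sm: "smooth_on W (local_rep (open_sub M U) (open_sub N V) f i j)" by auto
  have c: "cinv (open_sub M U) i y = cinv M i y" if "y \<in> W" for y
    using cinv_open_sub[OF ii] W(3) that by blast
  have "smooth_on W (local_rep M N f i j)"
    by (rule smooth_on_cong[OF W(1) _ sm]) (simp add: local_rep_def c)
  moreover have "\<forall>y\<in>W. f (cinv M i y) \<in> cdom N j \<inter> V"
    using W(4) c by (metis image_eqI subsetD)
  ultimately show ?thesis using W by blast
qed

lemma local_diffeomorphism_smooth_map:
  assumes M: "smooth_atlas M" and N: "smooth_atlas N" and f: "local_diffeomorphism M N f"
  shows "smooth_map M N f"
proof (rule smooth_mapI[OF M N])
  interpret M: smooth_atlas M by fact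
  interpret N: smooth_atlas N by fact
  fix p assume p: "p \<in> pts M"
  obtain U V where U: "p \<in> U" and d: "diffeomorphism (open_sub M U) (open_sub N V) f"
    using f p unfolding local_diffeomorphism_def by blast
  then have sm: "smooth_map (open_sub M U) (open_sub N V) f" and fp: "f p \<in> pts N" "f p \<in> V"
    using p by (auto simp: diffeomorphism_def bij_betw_def)
  then show "f p \<in> pts N" by blast
  obtain i j where ij: "i \<in> charts_at M p" "j \<in> charts_at N (f p)"
    using M.ex_chart[OF p] N.ex_chart[OF fp(1)] by blast
  obtain W where "open W" "cmap M i p \<in> W" "W \<subseteq> cmap M i ` (cdom M i \<inter> U)"
    "\<forall>y\<in>W. f (cinv M i y) \<in> cdom N j \<inter> V" "smooth_on W (local_rep M N f i j)"
    using smooth_map_open_subD[OF M sm p U ij fp(2)] by blast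
  then show "\<exists>i j W. i \<in> charts_at M p \<and> j \<in> charts_at N (f p) \<and> open W \<and> cmap M i p \<in> W \<and>
      W \<subseteq> cimg M i \<and> f ` cinv M i ` W \<subseteq> cdom N j \<and> smooth_on W (local_rep M N f i j)"
    using ij by (intro exI[of _ i] exI[of _ j] exI[of _ W]) auto
qed

text \<open>Near the point the local inverse composed with \<open>f\<close> is the identity in
  coordinates, so by the chain rule the derivative has a left inverse.\<close>

lemma local_diffeomorphism_fderiv_inj:
  assumes M: "smooth_atlas M" and N: "smooth_atlas N" and f: "local_diffeomorphism M N f"
    and p: "p \<in> pts M" and i: "i \<in> charts_at M p" and j: "j \<in> charts_at N (f p)"
    and v: "fderiv (local_rep M N f i j) (cmap M i p) v = 0"
  shows "v = 0"
proof -
  interpret M: smooth_atlas M by fact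
  interpret N: smooth_atlas N by fact
  have ij: "i \<in> idx M" "j \<in> idx N" "p \<in> cdom M i" "f p \<in> cdom N j"
    using i j by (auto simp: charts_at_def)
  obtain U V where U: "p \<in> U" and d: "diffeomorphism (open_sub M U) (open_sub N V) f"
    using f p unfolding local_diffeomorphism_def by blast
  define g where "g = inv_into (pts M \<inter> U) f"
  have sm: "smooth_map (open_sub M U) (open_sub N V) f" "smooth_map (open_sub N V) (open_sub M U) g"
    and fp: "f p \<in> pts N" "f p \<in> V" and inj: "inj_on f (pts M \<inter> U)"
    using p U d by (auto simp: diffeomorphism_def bij_betw_def g_def)
  have gf: "g (f q) = q" if "q \<in> pts M" "q \<in> U" for q
    unfolding g_def using inj that by (simp add: inv_into_f_f)
  let ?R = "local_rep M N f i j" and ?G = "local_rep N M g j i"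
  have i': "i \<in> charts_at M (g (f p))" "g (f p) \<in> U" using gf[OF p U] i U by simp_all
  obtain W where W: "open W" "cmap M i p \<in> W" "W \<subseteq> cmap M i ` (cdom M i \<inter> U)"
    "\<forall>y\<in>W. f (cinv M i y) \<in> cdom N j \<inter> V" "smooth_on W ?R"
    using smooth_map_open_subD[OF M sm(1) p U i j fp(2)] by blast
  obtain W' where W': "open W'" "cmap N j (f p) \<in> W'" "smooth_on W' ?G"
    using smooth_map_open_subD[OF N sm(2) fp j i'] by blast
  define O' where "O' = W \<inter> ?R -` W'"
  have O': "open O'"
    unfolding O'_def by (rule continuous_open_preimage[OF smooth_on_continuous[OF W(5)] W(1) W'(1)])
  have Rp: "?R (cmap M i p) = cmap N j (f p)"
    using ij by (simp add: local_rep_def M.cinv_cmap)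
  then have pO': "cmap M i p \<in> O'" using W W' by (simp add: O'_def)
  have GR: "?G (?R y) = y" if "y \<in> O'" for y
  proof -
    have y: "y \<in> W" using that by (simp add: O'_def)
    then obtain q where q: "q \<in> cdom M i" "q \<in> U" "y = cmap M i q" using W(3) by blast
    have "f q \<in> cdom N j" using W(4) y q ij by (auto simp: M.cinv_cmap)
    then show ?thesis
      using q ij gf[of q] M.cdom_subset[OF ij(1)] by (auto simp: local_rep_def M.cinv_cmap N.cinv_cmap)
  qed
  have dR: "(?R has_derivative fderiv ?R (cmap M i p)) (at (cmap M i p))"
    by (rule smooth_on_has_derivative[OF W(5,2)])
  have dG: "(?G has_derivative fderiv ?G (cmap N j (f p))) (at (?R (cmap M i p)))"
    unfolding Rp by (rule smooth_on_has_derivative[OF W'(3,2)])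
  have "((\<lambda>y. y) has_derivative (\<lambda>v. fderiv ?G (cmap N j (f p)) (fderiv ?R (cmap M i p) v))) (at (cmap M i p))"
    using has_derivative_transform_within_open[OF has_derivative_compose[OF dR dG] O' pO'] GR by simp
  then have "(\<lambda>v. fderiv ?G (cmap N j (f p)) (fderiv ?R (cmap M i p) v)) = (\<lambda>v. v)"
    by (rule has_derivative_unique[OF _ has_derivative_ident])
  from fun_cong[OF this, of v] show ?thesis
    using v linear_0[OF has_derivative_linear[OF dG]] by simp
qed

text \<open>Invertibility of the fibre derivative, stated as a kernel condition because the model
  spaces of base and fibre have the same finite dimension. It mediates between local diffeomorphisms
  and regular Lagrangians.\<close>

definition fibre_regular ::
  "('p, 'e::euclidean_space, 'i) manifold \<Rightarrow> ('p \<times> ('i \<Rightarrow> 'e) \<Rightarrow> 'p \<times> ('i \<Rightarrow> 'e)) \<Rightarrow> bool" where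
  "fibre_regular M F \<longleftrightarrow> (\<forall>x\<in>pts (tangent_bundle M). \<forall>i\<in>charts_at M (fst x). \<forall>b.
    fderiv (fibre_rep M F i) (cmap (tangent_bundle M) i x) (0, b) = 0 \<longrightarrow> b = 0)"

text \<open>The full derivative sends the vertical vector (0, b) to (0, c) with c the fibre
  derivative of b, so a fibre kernel would be a kernel of the whole.\<close>

lemma (in sode_fibre_map) local_diffeomorphism_imp_regular:
  assumes "local_diffeomorphism T C F"
  shows "fibre_regular M F"
  unfolding fibre_regular_def
proof (intro ballI allI impI)
  fix x i b
  assume x: "x \<in> pts T" and i: "i \<in> charts_at M (fst x)"
    and b: "fderiv (fibre_rep M F i) (cmap T i x) (0, b) = 0"
  have ii: "i \<in> idx M" "i \<in> idx T" "x \<in> cdom T i" "i \<in> charts_at T x" "i \<in> charts_at C (F x)"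
    using x i fibred[OF x] F_covector[OF x] by (auto simp: charts_at_def)
  have "((\<lambda>y. (fst y, fibre_rep M F i y)) has_derivative
      (\<lambda>u. (fst u, fderiv (fibre_rep M F i) (cmap T i x) u))) (at (cmap T i x))"
    using ii by (intro has_derivative_Pair has_derivative_fst has_derivative_ident
        smooth_on_has_derivative[OF smooth_fibre_rep]) (auto simp del: tangent_bundle_simps)
  then have "(local_rep T C F i i has_derivative
      (\<lambda>u. (fst u, fderiv (fibre_rep M F i) (cmap T i x) u))) (at (cmap T i x))"
    by (rule has_derivative_transform_within_open[OF _ T.open_cimg[OF ii(2)]])
      (use ii local_rep_F in \<open>auto simp del: tangent_bundle_simps\<close>)
  from fderiv_eqI[OF this] have "fderiv (local_rep T C F i i) (cmap T i x) (0, b) = 0"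
    using b by (simp add: zero_prod_def)
  from local_diffeomorphism_fderiv_inj[OF T.smooth_atlas_axioms C.smooth_atlas_axioms assms x ii(4,5) this]
  show "b = 0" by (simp add: zero_prod_def)
qed

text \<open>Coordinates are fixed to \<open>real^'n\<close> where determinants and Hessian matrices
  enter.\<close>

locale sode_vec = sode_atlas M \<Gamma> for M :: "('p, real^'n, 'i) manifold" and \<Gamma>

locale sode_fibre_map_vec = sode_vec M \<Gamma> + sode_fibre_map M \<Gamma> F
  for M :: "('p, real^'n, 'i) manifold" and \<Gamma> F
begin

lemma regular_imp_local_diffeomorphism:
  assumes reg: "fibre_regular M F"
  shows "local_diffeomorphism T C F"
  unfolding local_diffeomorphism_def
proof
  fix x assume x: "x \<in> pts T"
  obtain i where i: "i \<in> charts_at M (fst x)" using T.ex_chart[OF x] charts_at_T[OF x] by auto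
  then have ii: "i \<in> idx M" "i \<in> idx T" "i \<in> idx C" "x \<in> cdom T i"
    using x by (auto simp: charts_at_def)
  let ?f = "fibre_rep M F i" and ?D = "cimg T i"
  \<comment> \<open>Both bundles have the same chart image, and F keeps the base coordinate, so the
    coordinate image of \<open>U\<close> automatically lies in the chart of the cotangent
    bundle.\<close>
  have DC: "cimg C i = ?D"
    using cimg_tangent_bundle[OF ii(1)] cimg_cotangent_bundle[OF ii(1)] by simp
  have fst_D: "z \<in> ?D" if "y \<in> ?D" "fst z = fst y" for y z
    using that cimg_tangent_bundle[OF ii(1)] by (simp add: mem_Times_iff)
  have xD: "cmap T i x \<in> ?D" using ii(4) by (rule imageI)
  obtain U V g where UV: "open U" "cmap T i x \<in> U" "U \<subseteq> ?D" "open V"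
    "(\<lambda>y. (fst y, ?f y)) ` U = V" "g ` V = U" "\<forall>y\<in>U. g (fst y, ?f y) = y" and smg: "smooth_on V g"
    using fibred_inverse_function_theorem[OF T.open_cimg[OF ii(2)] smooth_fibre_rep[OF ii(1)] xD
      reg[unfolded fibre_regular_def, rule_format, OF x i]] by blast
  have VD: "V \<subseteq> cimg C i"
    unfolding DC using UV(3,5) fst_D by force
  have smr: "smooth_on U (\<lambda>y. (fst y, ?f y))"
    by (intro smooth_on_Pair UV smooth_on_fst smooth_on_subset[OF smooth_fibre_rep[OF ii(1)] UV(3)])
  let ?U = "cinv T i ` U" and ?V = "cinv C i ` V"
  note Uc = T.cinv_image[OF UV(3)]
  note Vc = C.cinv_image[OF VD]
  have Fc: "cmap C i (F p) = (fst (cmap T i p), ?f (cmap T i p))" if "p \<in> cdom T i" for p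
    using fibred[OF cdomT_pts[OF ii(1) that]] fibre_rep_cmap[OF ii(1) that] by simp
  have FU: "F ` ?U = ?V"
  proof -
    have eq: "F p = cinv C i (fst (cmap T i p), ?f (cmap T i p))" if "p \<in> cdom T i" for p
      using C.cinv_cmap[OF ii(3) F_cdom[OF ii(1) that]] Fc[OF that] by simp
    have "F ` ?U = (\<lambda>p. cinv C i (fst (cmap T i p), ?f (cmap T i p))) ` ?U"
      by (intro image_cong refl eq subsetD[OF Uc(1)])
    also have "\<dots> = cinv C i ` (\<lambda>y. (fst y, ?f y)) ` cmap T i ` ?U"
      by (simp add: image_image)
    finally show ?thesis unfolding Uc(2) UV(5) .
  qed
  have "diffeomorphism (open_sub T ?U) (open_sub C ?V) F"
  proof (rule diffeomorphism_chartI[OF T.smooth_atlas_axioms C.smooth_atlas_axioms ii(2,3)])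
    show "openin (mtop T) ?U" by (rule T.openin_cinv_image[OF ii(2) UV(1,3)])
    show "openin (mtop C) ?V" by (rule C.openin_cinv_image[OF ii(3) UV(4) VD])
    show "smooth_on (cmap T i ` ?U) (\<lambda>y. (fst y, ?f y))" unfolding Uc(2) by (rule smr)
    show "smooth_on (cmap C i ` ?V) g" unfolding Vc(2) by (rule smg)
    show "cmap C i (F p) = (fst (cmap T i p), ?f (cmap T i p))" if "p \<in> ?U" for p
      using Fc Uc(1) that by blast
    show "g (fst (cmap T i p), ?f (cmap T i p)) = cmap T i p" if "p \<in> ?U" for p
      using UV(7) Uc(2) that by blast
  qed (use Uc Vc FU in auto)
  moreover have "x \<in> ?U"
    using T.cinv_cmap[OF ii(2,4)] UV(2) by (metis image_eqI)
  moreover have "openin (mtop T) ?U" "openin (mtop C) ?V"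
    using T.openin_cinv_image[OF ii(2) UV(1,3)] C.openin_cinv_image[OF ii(3) UV(4) VD] by auto
  ultimately show "\<exists>U V. openin (mtop T) U \<and> x \<in> U \<and> openin (mtop C) V \<and>
      diffeomorphism (open_sub T U) (open_sub C V) F"
    by blast
qed

end

section \<open>Lagrangians and the inverse problem\<close>

lemma gradient_components:
  fixes l :: "(real^'n) \<times> (real^'n) \<Rightarrow> real"
  assumes "(l has_derivative (\<lambda>u. m \<bullet> u)) (at y)"
  shows "d_q l y = fst m" "d_v l y = snd m"
  by (simp_all add: d_q_def d_v_def fderiv_eqI[OF assms] inner_prod_def inner_axis vec_eq_iff)

lemma has_derivative_gradient:
  fixes l :: "(real^'n) \<times> (real^'n) \<Rightarrow> real"
  assumes "l differentiable (at y)"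
  shows "(l has_derivative (\<lambda>u. (d_q l y, d_v l y) \<bullet> u)) (at y)"
proof -
  define m where "m = (\<Sum>b\<in>Basis. fderiv l y b *\<^sub>R b)"
  have "fderiv l y u = m \<bullet> u" for u
    using inner_sum_Basis[OF linear_frechet_derivative[OF assms], of 1 u] by (simp add: m_def)
  then have d: "(l has_derivative (\<lambda>u. m \<bullet> u)) (at y)"
    using fderiv_works[OF assms] by (simp add: fun_eq_iff[symmetric] eq_commute)
  then show ?thesis
    by (simp add: gradient_components[OF d])
qed

lemma smooth_on_d_v:
  fixes l :: "(real^'n) \<times> (real^'n) \<Rightarrow> real"
  assumes "open S" "smooth_on S l"
  shows "smooth_on S (d_v l)"
  unfolding d_v_def by (intro smooth_on_vec_lambda smooth_on_fderiv assms)

lemma d_v_cong_fderiv: "fderiv l y = fderiv l' y \<Longrightarrow> d_v l y = d_v l' y"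
  by (simp add: d_v_def)

text \<open>In \<open>hessian_v\<close> the row is the direction of differentiation and the column
  is the momentum component, hence the transpose in the matrix of the fibre derivative.\<close>

lemma transpose_hessian_mult:
  fixes f :: "(real^'n) \<times> (real^'n) \<Rightarrow> real^'n"
  assumes S: "open S" "y \<in> S" and sm: "smooth_on S f" and l: "\<And>z. z \<in> S \<Longrightarrow> d_v l z = f z"
  shows "transpose (hessian_v l y) *v b = fderiv f y (0, b)"
proof -
  have df: "(f has_derivative fderiv f y) (at y)" by (rule smooth_on_has_derivative[OF sm S(2)])
  have "fderiv (\<lambda>z. d_v l z $ k) y = fderiv (\<lambda>z. f z $ k) y" for k
    by (rule fderiv_cong_open[OF S]) (simp add: l)
  also have "fderiv (\<lambda>z. f z $ k) y = (\<lambda>u. fderiv f y u $ k)" for k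
    by (rule fderiv_eqI[OF bounded_linear.has_derivative[OF bounded_linear_vec_nth df]])
  finally have "transpose (hessian_v l y) = matrix (\<lambda>b. fderiv f y (0, b))"
    by (simp add: hessian_v_def transpose_def matrix_def vec_eq_iff)
  moreover have "linear (\<lambda>b. fderiv f y (0, b))"
    using linear_compose[of "\<lambda>b. (0, b)", OF bounded_linear.linear has_derivative_linear[OF df]]
      bounded_linear_Pair[OF bounded_linear_zero bounded_linear_ident] by (simp add: comp_def)
  ultimately show ?thesis
    by (simp add: matrix_works)
qed

lemma invertible_iff_kernel:
  fixes A :: "real^'n^'n"
  shows "invertible A \<longleftrightarrow> (\<forall>b. A *v b = 0 \<longrightarrow> b = 0)"
  by (simp add: invertible_left_inverse matrix_left_invertible_ker)

lemma invertible_transpose_iff: "invertible (transpose A) \<longleftrightarrow> invertible (A :: real^'n^'n)"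
  by (simp add: invertible_det_nz)

lemma (in smooth_atlas) image_cmap_fst:
  "i \<in> idx M \<Longrightarrow> cmap (tangent_bundle M) i ` (cdom (tangent_bundle M) i \<inter> fst -` U)
    = cmap M i ` (cdom M i \<inter> U) \<times> UNIV"
  using image_cmap_tangent_bundle[of i U]
  by (simp add: Int_def vimage_def del: tangent_bundle_simps(3,4))

lemma (in sode_atlas) openin_fst_vimage:
  assumes U: "openin (mtop M) U"
  shows "openin (mtop T) (pts T \<inter> fst -` U)"
  unfolding T.openin_iff
proof (intro conjI ballI)
  fix i assume "i \<in> idx T"
  then have i: "i \<in> idx M" "i \<in> idx T" by simp_all
  have "pts T \<inter> fst -` U \<inter> cdom T i = cdom T i \<inter> fst -` U"
    using T.cdom_subset[OF i(2)] by blast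
  then show "open (cmap T i ` (pts T \<inter> fst -` U \<inter> cdom T i))"
    using image_cmap_fst[OF i(1), of U] open_image_Int[OF U i(1)] by (simp add: open_Times)
qed simp

context sode_vec
begin

lemma lagrangian_for_smooth:
  assumes L: "lagrangian_for M \<Gamma> U L" and U: "openin (mtop M) U" and i: "i \<in> idx M"
  shows "open (cmap T i ` (cdom T i \<inter> fst -` U))"
    "smooth_on (cmap T i ` (cdom T i \<inter> fst -` U)) (L \<circ> cinv T i)"
proof -
  let ?W = "fst -` U" and ?O = "cmap T i ` (cdom T i \<inter> fst -` U)"
  interpret TW: smooth_atlas "open_sub T ?W" by (rule T.atlas_open_sub[OF openin_fst_vimage[OF U]])
  show o: "open ?O"
    using image_cmap_fst[OF i, of U] open_image_Int[OF U i] by (simp add: open_Times)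
  have "smooth_on ?O (\<lambda>y. L (cinv (open_sub T ?W) i y))"
    using TW.smooth_function_cinv[of L i] L i by (simp add: lagrangian_for_def)
  then show "smooth_on ?O (L \<circ> cinv T i)"
    by (rule smooth_on_cong[OF o, rotated]) (use i T.cinv_open_sub in auto)
qed

end

section \<open>Primitives of \<open>\<mu>\<close> as Lagrangians for \<open>\<Gamma>\<close>, and
  conversely\<close>

context sode_fibre_map_vec
begin

text \<open>The Euler-Lagrange expression is the derivative of f at (v, a) minus that at (v,
  \<Gamma>). By linearity this is the fibre derivative of a - \<Gamma>, so the multiplier is the
  transposed Hessian.\<close>

lemma regular_primitive_imp_lagrangian_for:
  assumes reg: "fibre_regular M F" and U: "openin (mtop M) U"
    and L: "primitive_on T \<mu> (fst -` U) L"
  shows "lagrangian_for M \<Gamma> U L"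
  unfolding lagrangian_for_def
proof (intro conjI ballI)
  show "smooth_function (open_sub T (fst -` U)) L"
    by (rule T.primitive_on_smooth_function[OF one_form_mu L openin_fst_vimage[OF U]])
  fix i assume i: "i \<in> idx M"
  then have iT: "i \<in> idx T" by simp
  let ?f = "fibre_rep M F i" and ?l = "L \<circ> cinv T i"
  let ?O = "cmap T i ` (cdom T i \<inter> fst -` U)"
  have o: "open ?O"
    using image_cmap_fst[OF i, of U] open_image_Int[OF U i] by (simp add: open_Times)
  have OD: "?O \<subseteq> cimg T i" by blast
  have smf: "smooth_on ?O ?f" by (rule smooth_on_subset[OF smooth_fibre_rep[OF i] OD])
  have "(?l has_derivative (\<lambda>u. form_rep T \<mu> i y \<bullet> u)) (at y)" if "y \<in> ?O" for y
    using T.primitive_onD[OF L iT] that by (auto simp: comp_def simp del: tangent_bundle_simps)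
  from gradient_components[OF this]
  have dq: "d_q ?l y = fderiv ?f y (snd (\<Gamma> (cinv T i y)) i)" and dv: "d_v ?l y = ?f y" if "y \<in> ?O" for y
    using that form_rep_mu[OF i subsetD[OF OD that]] by simp_all
  have "invertible (hessian_v ?l y) \<and> invertible (transpose (hessian_v ?l y)) \<and>
    (\<forall>a. transpose (hessian_v ?l y) *v (a - snd (snd (\<Gamma> x) i)) = euler_lagrange ?l y a)"
    if x: "x \<in> cdom T i \<inter> fst -` U" and y: "y = cmap T i x" for x y
  proof -
    have yO: "y \<in> ?O" using x y by blast
    have xT: "x \<in> pts T" "i \<in> charts_at M (fst x)"
      using x i cdomT_pts[OF i] by (auto simp: charts_at_def)
    have xc: "cinv T i y = x" using T.cinv_cmap[OF iT] x y by blast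
    have h: "transpose (hessian_v ?l y) *v b = fderiv ?f y (0, b)" for b
      by (rule transpose_hessian_mult[OF o yO smf dv])
    have inv: "invertible (transpose (hessian_v ?l y))"
      unfolding invertible_iff_kernel h
      using reg[unfolded fibre_regular_def, rule_format, OF xT] by (simp add: y)
    have "euler_lagrange ?l y a = fderiv ?f y (0, a - snd (snd (\<Gamma> x) i))" for a
    proof -
      have lin: "linear (fderiv ?f y)" by (rule smooth_on_linear_fderiv[OF smf yO])
      have "fderiv (d_v ?l) y = fderiv ?f y" by (rule fderiv_cong_open[OF o yO dv])
      then have "euler_lagrange ?l y a = fderiv ?f y (snd y, a) - fderiv ?f y (snd (\<Gamma> x) i)"
        unfolding euler_lagrange_def dq[OF yO] xc by simp
      also have "snd (\<Gamma> x) i = (snd y, snd (snd (\<Gamma> x) i))"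
        using snd_sode_rep[OF i, of y] yO OD xc by auto
      also have "fderiv ?f y (snd y, a) - fderiv ?f y (snd y, snd (snd (\<Gamma> x) i))
          = fderiv ?f y ((snd y, a) - (snd y, snd (snd (\<Gamma> x) i)))"
        by (rule linear_diff[OF lin, symmetric])
      finally show ?thesis by (simp only: diff_Pair diff_self)
    qed
    then show ?thesis
      using inv h by (simp only: invertible_transpose_iff simp_thms)
  qed
  then show "\<exists>g. \<forall>x\<in>cdom T i \<inter> fst -` U.
      let l = L \<circ> cinv T i; y = cmap T i x in invertible (hessian_v l y) \<and> invertible (g y) \<and>
        (\<forall>a. g y *v (a - snd (snd (\<Gamma> x) i)) = euler_lagrange l y a)"
    unfolding Let_def by (intro exI[of _ "\<lambda>y. transpose (hessian_v ?l y)"]) blast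
qed

text \<open>Here F is required to be the Legendre map of \<open>L\<close> over \<open>U\<close>
  only, because it will be glued from the Legendre maps of several Lagrangians.\<close>

lemma lagrangian_for_imp_primitive:
  assumes L: "lagrangian_for M \<Gamma> U L" and U: "openin (mtop M) U"
    and F: "\<And>i x. i \<in> idx M \<Longrightarrow> x \<in> cdom T i \<Longrightarrow> fst x \<in> U \<Longrightarrow>
      fibre_rep M F i (cmap T i x) = d_v (L \<circ> cinv T i) (cmap T i x)"
  shows "primitive_on T \<mu> (fst -` U) L"
    and "x \<in> pts T \<Longrightarrow> fst x \<in> U \<Longrightarrow> i \<in> charts_at M (fst x) \<Longrightarrow>
      fderiv (fibre_rep M F i) (cmap T i x) (0, b) = 0 \<Longrightarrow> b = 0"
proof -
  have main: "((\<lambda>y. L (cinv T i y)) has_derivative (\<lambda>u. form_rep T \<mu> i (cmap T i x) \<bullet> u)) (at (cmap T i x)) \<and>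
    (\<forall>b. fderiv (fibre_rep M F i) (cmap T i x) (0, b) = 0 \<longrightarrow> b = 0)"
    if x: "x \<in> pts T" "fst x \<in> U" and ix: "i \<in> charts_at M (fst x)" for x i
  proof -
    let ?f = "fibre_rep M F i" and ?l = "L \<circ> cinv T i" and ?y = "cmap T i x"
    let ?O = "cmap T i ` (cdom T i \<inter> fst -` U)"
    have i: "i \<in> idx M" "i \<in> idx T" "x \<in> cdom T i" using x ix by (auto simp: charts_at_def)
    have yO: "?y \<in> ?O" using i x by blast
    note o = lagrangian_for_smooth(1)[OF L U i(1)] and sml = lagrangian_for_smooth(2)[OF L U i(1)]
    have OD: "?O \<subseteq> cimg T i" by blast
    have smf: "smooth_on ?O ?f" by (rule smooth_on_subset[OF smooth_fibre_rep[OF i(1)] OD])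
    have dv: "d_v ?l y = ?f y" if "y \<in> ?O" for y
      using that F[OF i(1)] by auto
    obtain g where "invertible (hessian_v ?l ?y)" "invertible (g ?y)" and
      el: "\<And>a. g ?y *v (a - snd (snd (\<Gamma> x) i)) = euler_lagrange ?l ?y a"
      using L[unfolded lagrangian_for_def Let_def] i x by blast
    then have inv: "invertible (transpose (hessian_v ?l ?y))" by (simp only: invertible_transpose_iff)
    have h: "transpose (hessian_v ?l ?y) *v b = fderiv ?f ?y (0, b)" for b
      by (rule transpose_hessian_mult[OF o yO smf dv])
    have reg: "\<forall>b. fderiv ?f ?y (0, b) = 0 \<longrightarrow> b = 0"
      using inv unfolding invertible_iff_kernel h .
    have "fderiv (d_v ?l) ?y = fderiv ?f ?y" by (rule fderiv_cong_open[OF o yO dv])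
    \<comment> \<open>At the acceleration of \<Gamma> the multiplier term vanishes, which leaves the
      dq-part of the equation dL = \<mu>.\<close>
    then have "d_q ?l ?y = fderiv ?f ?y (snd ?y, snd (snd (\<Gamma> x) i))"
      using el[of "snd (snd (\<Gamma> x) i)"] by (simp add: euler_lagrange_def)
    also have "(snd ?y, snd (snd (\<Gamma> x) i)) = snd (\<Gamma> x) i"
      using sodeD(3)[OF x(1), of i] by (simp add: prod_eq_iff)
    finally have "(d_q ?l ?y, d_v ?l ?y) = form_rep T \<mu> i ?y"
      unfolding form_rep_mu[OF i(1) subsetD[OF OD yO]] T.cinv_cmap[OF i(2,3)] dv[OF yO]
      by (rule arg_cong[where f = "\<lambda>m. (m, ?f ?y)"])
    then show ?thesis
      using has_derivative_gradient[OF smooth_on_differentiable[OF sml yO]] reg by (simp add: comp_def)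
  qed
  show "primitive_on T \<mu> (fst -` U) L"
  proof (rule T.primitive_onI[OF one_form_mu])
    fix x assume x: "x \<in> pts T" "x \<in> fst -` U"
    then obtain i where "i \<in> charts_at T x" using T.ex_chart by blast
    then show "\<exists>i\<in>charts_at T x. ((\<lambda>y. L (cinv T i y)) has_derivative
        (\<lambda>u. form_rep T \<mu> i (cmap T i x) \<bullet> u)) (at (cmap T i x))"
      using main[of x i] x charts_at_T[OF x(1)] by auto
  qed
  show "b = 0" if "x \<in> pts T" "fst x \<in> U" "i \<in> charts_at M (fst x)"
    "fderiv (fibre_rep M F i) (cmap T i x) (0, b) = 0"
    using main[OF that(1-3)] that(4) by blast
qed

end

section \<open>From local Lagrangians to a closed form\<close>

context sode_vec
begin

text \<open>The Legendre maps of the local Lagrangians agree on overlaps, since locally constant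
  differences do not affect momenta; the map F glued from them makes each local Lagrangian a
  primitive of its form.\<close>

lemma locally_variational_imp_closed:
  assumes "locally_variational M \<Gamma>"
  shows "\<exists>F. local_diffeomorphism T C F \<and> (\<forall>x\<in>pts T. fst (F x) = fst x) \<and> closed_form T (mu_form M \<Gamma> F)"
proof -
  obtain \<U> L where 1: "\<forall>U\<in>\<U>. openin (mtop M) U \<and> lagrangian_for M \<Gamma> U (L U)" and cov: "\<Union>\<U> = pts M"
    and 2: "\<forall>U\<in>\<U>. \<forall>V\<in>\<U>. \<forall>q\<in>U \<inter> V. \<exists>W c. openin (mtop M) W \<and> q \<in> W \<and> W \<subseteq> U \<inter> V \<and>
      (\<forall>x\<in>pts T. fst x \<in> W \<longrightarrow> L U x - L V x = c)"
    using assms unfolding locally_variational_def by (elim exE conjE)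
  note \<U> = 1[rule_format, THEN conjunct1] and L = 1[rule_format, THEN conjunct2] and ov = 2[rule_format]
  define l where "l U i = L U \<circ> cinv T i" for U i
  let ?O = "\<lambda>i U. cmap T i ` (cdom T i \<inter> fst -` U)"
  have o: "open (?O i U)" and sml: "smooth_on (?O i U) (l U i)" if "U \<in> \<U>" "i \<in> idx M" for U i
    using lagrangian_for_smooth[OF L[OF that(1)] \<U>[OF that(1)] that(2)] by (simp_all only: l_def)
  have agree: "d_v (l U i) (cmap T i x) = d_v (l V i) (cmap T i x)"
    if U: "U \<in> \<U>" and V: "V \<in> \<U>" and i: "i \<in> idx M" and x: "x \<in> cdom T i" "fst x \<in> U" "fst x \<in> V" for U V i x
  proof (rule d_v_cong_fderiv)
    have iT: "i \<in> idx T" using i by simp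
    obtain W c where W: "openin (mtop M) W" "fst x \<in> W" "W \<subseteq> U \<inter> V"
      and c: "\<forall>x\<in>pts T. fst x \<in> W \<longrightarrow> L U x - L V x = c"
      using ov[OF U V IntI[OF x(2,3)]] by (elim exE conjE)
    have oW: "open (?O i W)"
      using image_cmap_fst[OF i, of W] open_image_Int[OF W(1) i] by (simp add: open_Times)
    have xV: "cmap T i x \<in> ?O i V" and xW: "cmap T i x \<in> ?O i W" using x W by blast+
    have "fderiv (l U i) (cmap T i x) = fderiv (\<lambda>y. l V i y + c) (cmap T i x)"
    proof (rule fderiv_cong_open[OF oW xW])
      fix y assume "y \<in> ?O i W"
      then obtain x' where x': "x' \<in> cdom T i" "fst x' \<in> W" "y = cmap T i x'" by blast
      then have "cinv T i y = x'" using T.cinv_cmap[OF iT] by blast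
      then show "l U i y = l V i y + c"
        using c[rule_format, OF cdomT_pts[OF i x'(1)] x'(2)] by (simp add: l_def)
    qed
    also have "\<dots> = fderiv (l V i) (cmap T i x)"
      by (rule fderiv_eqI)
        (use has_derivative_add[OF smooth_on_has_derivative[OF sml[OF V i] xV] has_derivative_const, of c]
          in simp)
    finally show "fderiv (l U i) (cmap T i x) = fderiv (l V i) (cmap T i x)" .
  qed
  \<comment> \<open>An arbitrary member of the cover around \<open>p\<close>; by
    \<open>agree\<close> the choice does not influence F.\<close>
  define UU where "UU p = (SOME U. U \<in> \<U> \<and> p \<in> U)" for p
  have UU: "UU p \<in> \<U>" "p \<in> UU p" if "p \<in> pts M" for p
  proof -
    have "\<exists>U. U \<in> \<U> \<and> p \<in> U" using cov that by blast
    from someI_ex[OF this] show "UU p \<in> \<U>" "p \<in> UU p" by (simp_all add: UU_def)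
  qed
  \<comment> \<open>The value 0 off the charts is the normalisation required of a covector.\<close>
  define F where "F x = (fst x, \<lambda>i. if i \<in> charts_at M (fst x) then d_v (l (UU (fst x)) i) (cmap T i x) else 0)" for x
  have F_eq: "snd (F x) i = d_v (l U i) (cmap T i x)"
    if x: "x \<in> cdom T i" "fst x \<in> U" and U: "U \<in> \<U>" and i: "i \<in> idx M" for x i U
  proof -
    have "fst x \<in> pts M" using cdomT_pts[OF i x(1)] by simp
    then show ?thesis
      using agree[OF UU(1) U i x(1) UU(2) x(2)] i x by (simp add: F_def charts_at_def)
  qed
  have fib: "fst (F x) = fst x" for x by (simp add: F_def)
  have Fcov: "snd (F x) \<in> cotangent_space M (fst x)" if x: "x \<in> pts T" for x
    unfolding cotangent_space_def mem_Collect_eq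
  proof (intro conjI ballI allI impI)
    fix i j w assume i: "i \<in> charts_at M (fst x)" and j: "j \<in> charts_at M (fst x)"
    let ?U = "UU (fst x)"
    have xM: "fst x \<in> pts M" using x by simp
    note U = UU[OF xM]
    have ij: "i \<in> idx M" "j \<in> idx M" "x \<in> cdom T i" "x \<in> cdom T j" "i \<in> charts_at T x" "j \<in> charts_at T x"
      using i j x by (auto simp: charts_at_def)
    have d: "(l ?U k has_derivative (\<lambda>u. (d_q (l ?U k) (cmap T k x), d_v (l ?U k) (cmap T k x)) \<bullet> u)) (at (cmap T k x))"
      if "k \<in> idx M" "x \<in> cdom T k" for k
      by (rule has_derivative_gradient[OF smooth_on_differentiable[OF sml[OF U(1) that(1)]]])
        (use that U(2) in blast)
    have "(l ?U i has_derivative (\<lambda>u. (d_q (l ?U j) (cmap T j x), d_v (l ?U j) (cmap T j x))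
        \<bullet> fderiv (transition T i j) (cmap T i x) u)) (at (cmap T i x))"
      using T.has_derivative_change_chart[OF ij(6,5), of "L ?U"] d[OF ij(2,4)]
      by (simp add: l_def comp_def del: tangent_bundle_simps)
    \<comment> \<open>The change of charts for dL is tested on a vertical vector (0, w), which the
      lifted transition keeps vertical; only the momenta remain in the equation.\<close>
    note e = fun_cong[OF has_derivative_unique[OF d[OF ij(1,3)] this], of "(0, w)"]
    have "cmap M i (fst x) \<in> overlap M i j" using ij by auto
    then have "fderiv (transition T i j) (cmap T i x) (0, w)
        = (0, fderiv (transition M i j) (cmap M i (fst x)) w)"
      unfolding fderiv_transition_T[OF x i j]
      by (simp add: linear_0[OF linear_fderiv_transition[OF i j]]
          linear_0[OF smooth_on_linear_fderiv[OF smooth_on_fderiv[OF smooth_transition[OF ij(1,2)]]]])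
    with e have "d_v (l ?U i) (cmap T i x) \<bullet> w
        = d_v (l ?U j) (cmap T j x) \<bullet> fderiv (transition M i j) (cmap M i (fst x)) w"
      by (simp add: inner_prod_def del: tangent_bundle_simps)
    then show "snd (F x) i \<bullet> w = snd (F x) j \<bullet> fderiv (transition M i j) (cmap M i (fst x)) w"
      using F_eq[OF ij(3) U(2,1) ij(1)] F_eq[OF ij(4) U(2,1) ij(2)] by simp
  qed (simp add: F_def)
  have FC: "F x \<in> cdom C i" if "i \<in> idx M" "x \<in> cdom T i" for x i
    using Fcov[OF cdomT_pts[OF that]] that by (simp add: fib)
  have smF: "smooth_map T C F"
  proof (rule smooth_mapI[OF T.smooth_atlas_axioms C.smooth_atlas_axioms])
    fix x assume x: "x \<in> pts T"
    then show "F x \<in> pts C" using Fcov[OF x] fib[of x] by simp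
    obtain i where i: "i \<in> charts_at M (fst x)" using T.ex_chart[OF x] charts_at_T[OF x] by auto
    let ?U = "UU (fst x)"
    have xM: "fst x \<in> pts M" using x by simp
    note U = UU[OF xM]
    have ii: "i \<in> idx M" "i \<in> idx T" "x \<in> cdom T i" "i \<in> charts_at T x" "i \<in> charts_at C (F x)"
      using i x Fcov[OF x] fib[of x] by (auto simp: charts_at_def)
    \<comment> \<open>\<open>UU\<close> may jump from point to point, but \<open>F_eq\<close> allows
      the one set chosen at \<open>x\<close> to be used for all nearby points.\<close>
    have "smooth_on (?O i ?U) (\<lambda>y. (fst y, d_v (l ?U i) y))"
      by (intro smooth_on_Pair o smooth_on_fst smooth_on_d_v sml U ii)
    then have "smooth_on (?O i ?U) (local_rep T C F i i)"
    proof (rule smooth_on_cong[OF o[OF U(1) ii(1)], rotated])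
      fix y assume "y \<in> ?O i ?U"
      then obtain x' where x': "x' \<in> cdom T i" "fst x' \<in> ?U" "y = cmap T i x'" by blast
      have c: "cinv T i y = x'" using T.cinv_cmap[OF ii(2) x'(1)] x'(3) by blast
      have "local_rep T C F i i y = (cmap M i (fst x'), snd (F x') i)"
        unfolding local_rep_def comp_def c by (simp add: fib)
      also have "\<dots> = (fst y, d_v (l ?U i) y)"
        using F_eq[OF x'(1,2) U(1) ii(1)] x'(3) by simp
      finally show "(fst y, d_v (l ?U i) y) = local_rep T C F i i y" by simp
    qed
    moreover have "F ` cinv T i ` ?O i ?U \<subseteq> cdom C i"
    proof -
      have "cinv T i ` ?O i ?U = cdom T i \<inter> fst -` ?U"
        using T.cinv_cmap[OF ii(2)] by (simp add: image_image del: tangent_bundle_simps(4))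
      then show ?thesis using FC[OF ii(1)] by blast
    qed
    moreover have "cmap T i x \<in> ?O i ?U" using ii U by blast
    ultimately show "\<exists>i j V. i \<in> charts_at T x \<and> j \<in> charts_at C (F x) \<and> open V \<and> cmap T i x \<in> V \<and>
      V \<subseteq> cimg T i \<and> F ` cinv T i ` V \<subseteq> cdom C j \<and> smooth_on V (local_rep T C F i j)"
      using ii o[OF U(1) ii(1)] by (intro exI[of _ i] exI[of _ "?O i ?U"]) blast
  qed
  interpret F: sode_fibre_map_vec M \<Gamma> F
    by unfold_locales (use smF fib in auto)
  have frep: "fibre_rep M F i (cmap T i x) = d_v (L U \<circ> cinv T i) (cmap T i x)"
    if "U \<in> \<U>" "i \<in> idx M" "x \<in> cdom T i" "fst x \<in> U" for U i x
    using F.fibre_rep_cmap[OF that(2,3)] F_eq[OF that(3,4,1,2)] by (simp add: l_def)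
  note prim = F.lagrangian_for_imp_primitive[OF L \<U> frep]
  have "fibre_regular M F"
    unfolding fibre_regular_def
  proof (intro ballI allI impI)
    fix x i b assume "x \<in> pts T" "i \<in> charts_at M (fst x)"
      "fderiv (fibre_rep M F i) (cmap T i x) (0, b) = 0"
    moreover have "fst x \<in> pts M" using \<open>x \<in> pts T\<close> by simp
    ultimately show "b = 0"
      using prim(2)[OF UU(1) UU(1) UU(1)] UU(2) by blast
  qed
  then have "local_diffeomorphism T C F" by (rule F.regular_imp_local_diffeomorphism)
  moreover have "closed_form T (mu_form M \<Gamma> F)"
    unfolding T.closed_form_iff[OF F.one_form_mu]
  proof (intro ballI)
    fix i y assume i: "i \<in> idx T" and "y \<in> cimg T i"
    then obtain x where x: "x \<in> cdom T i" "y = cmap T i x" by blast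
    have xM: "fst x \<in> pts M" using cdomT_pts[of i x] i x by simp
    note U = UU[OF xM]
    show "symmetric_derivative (form_rep T (mu_form M \<Gamma> F) i) y"
      unfolding x(2)
      by (rule T.primitive_on_imp_symmetric[OF F.one_form_mu prim(1)[OF U(1) U(1) U(1)]
            openin_fst_vimage[OF \<U>[OF U(1)]] i x(1)]) (use U in auto)
  qed
  ultimately show ?thesis using fib by blast
qed

end

section \<open>From a closed form back to Lagrangians, locally and globally\<close>

context sode_fibre_map_vec
begin

lemma fst_vimage_cinv:
  assumes "i \<in> idx M" "B \<subseteq> cimg M i"
  shows "pts T \<inter> fst -` (cinv M i ` B) = cinv T i ` (B \<times> UNIV)"
proof (intro set_eqI)
  fix x
  have "B \<times> UNIV \<subseteq> cimg T i" using assms cimg_tangent_bundle by blast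
  then show "x \<in> pts T \<inter> fst -` (cinv M i ` B) \<longleftrightarrow> x \<in> cinv T i ` (B \<times> UNIV)"
    using T.cinv_image_iff[of i "B \<times> UNIV" x] cinv_image_iff[OF assms, of "fst x"] assms cdom_subset[OF assms(1)]
    by auto
qed

lemma primitive_on_cong_pts: "pts T \<inter> W = pts T \<inter> W' \<Longrightarrow> primitive_on T \<nu> W L \<longleftrightarrow> primitive_on T \<nu> W' L"
  by (simp add: primitive_on_def)

lemma ex_local_primitive:
  assumes cl: "closed_form T \<mu>" and q: "q \<in> pts M"
  shows "\<exists>U L. openin (mtop M) U \<and> q \<in> U \<and> primitive_on T \<mu> (fst -` U) L"
proof -
  obtain i where i: "i \<in> idx M" "q \<in> cdom M i" using ex_chart[OF q] by (auto simp: charts_at_def)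
  have iT: "i \<in> idx T" using i by simp
  obtain e where e: "e > 0" "ball (cmap M i q) e \<subseteq> cimg M i"
    using open_cimg[OF i(1)] i(2) by (meson image_eqI open_contains_ball)
  let ?B = "ball (cmap M i q) e"
  have BU: "?B \<times> UNIV \<subseteq> cimg T i" using e cimg_tangent_bundle[OF i(1)] by blast
  obtain L where "primitive_on T \<mu> (cinv T i ` (?B \<times> UNIV)) L"
    using T.ex_primitive_chart[OF one_form_mu cl iT _ _ BU] by (auto simp: open_Times convex_Times)
  then have "primitive_on T \<mu> (fst -` (cinv M i ` ?B)) L"
    using fst_vimage_cinv[OF i(1) e(2)] by (subst primitive_on_cong_pts) auto
  moreover have "q \<in> cinv M i ` ?B" using cinv_image_iff[OF i(1) e(2)] i e by simp
  ultimately show ?thesis using openin_cinv_image[OF i(1) open_ball e(2)] by blast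
qed

lemma closed_imp_locally_variational:
  assumes reg: "fibre_regular M F" and cl: "closed_form T \<mu>"
  shows "locally_variational M \<Gamma>"
proof -
  \<comment> \<open>The Lagrangians are indexed by the sets of the cover, so all open sets that
    carry a primitive are taken and one primitive is chosen for each.\<close>
  define \<U> where "\<U> = {U. openin (mtop M) U \<and> (\<exists>L. primitive_on T \<mu> (fst -` U) L)}"
  define L where "L U = (SOME L. primitive_on T \<mu> (fst -` U) L)" for U
  have L: "primitive_on T \<mu> (fst -` U) (L U)" and oU: "openin (mtop M) U" if "U \<in> \<U>" for U
  proof -
    have "\<exists>L. primitive_on T \<mu> (fst -` U) L" using that by (simp add: \<U>_def)
    from someI_ex[OF this] show "primitive_on T \<mu> (fst -` U) (L U)" by (simp add: L_def)
    show "openin (mtop M) U" using that by (simp add: \<U>_def)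
  qed
  have "\<Union>\<U> = pts M"
  proof
    show "\<Union>\<U> \<subseteq> pts M" using oU unfolding openin_iff by blast
    show "pts M \<subseteq> \<Union>\<U>" using ex_local_primitive[OF cl] unfolding \<U>_def by blast
  qed
  moreover have "\<exists>W c. openin (mtop M) W \<and> q \<in> W \<and> W \<subseteq> U \<inter> V \<and> (\<forall>x\<in>pts T. fst x \<in> W \<longrightarrow> L U x - L V x = c)"
    if U: "U \<in> \<U>" and V: "V \<in> \<U>" and q: "q \<in> U \<inter> V" for U V q
  proof -
    have oUV: "openin (mtop M) (U \<inter> V)" using oU U V by blast
    then have "q \<in> pts M" using q unfolding openin_iff by blast
    then obtain i where i: "i \<in> idx M" "q \<in> cdom M i" using ex_chart by (auto simp: charts_at_def)
    have iT: "i \<in> idx T" using i by simp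
    have "cmap M i q \<in> cmap M i ` (cdom M i \<inter> (U \<inter> V))" using i(2) q by blast
    then obtain e where e: "e > 0" "ball (cmap M i q) e \<subseteq> cmap M i ` (cdom M i \<inter> (U \<inter> V))"
      by (rule openE[OF open_image_Int[OF oUV i(1)]])
    let ?B = "ball (cmap M i q) e"
    have B: "?B \<subseteq> cimg M i" using e by blast
    have BU: "?B \<times> UNIV \<subseteq> cimg T i" using B cimg_tangent_bundle[OF i(1)] by blast
    have WUV: "cinv M i ` ?B \<subseteq> U \<inter> V"
    proof
      fix p assume "p \<in> cinv M i ` ?B"
      then obtain y where "y \<in> ?B" "p = cinv M i y" by blast
      then show "p \<in> U \<inter> V" using e(2) cinv_cmap[OF i(1)] by force
    qed
    have "cinv T i ` (?B \<times> UNIV) \<subseteq> fst -` U \<inter> fst -` V"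
      using fst_vimage_cinv[OF i(1) B] WUV by blast
    from T.primitive_on_unique[OF L[OF U] L[OF V] iT _ BU this]
    obtain c where "\<forall>x\<in>cinv T i ` (?B \<times> UNIV). L U x - L V x = c"
      by (auto simp: convex_Times)
    then have "\<forall>x\<in>pts T. fst x \<in> cinv M i ` ?B \<longrightarrow> L U x - L V x = c"
      using fst_vimage_cinv[OF i(1) B] by blast
    moreover have "q \<in> cinv M i ` ?B" using cinv_image_iff[OF i(1) B] i e by simp
    ultimately show ?thesis using openin_cinv_image[OF i(1) open_ball B] WUV by blast
  qed
  ultimately show ?thesis
    unfolding locally_variational_def
    by (intro exI[of _ \<U>] exI[of _ L] conjI ballI oU regular_primitive_imp_lagrangian_for[OF reg oU L])
qed

section \<open>The pullback of \<open>\<mu>\<close> along the zero section\<close>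

definition zero_vec :: "'p \<Rightarrow> 'p \<times> ('i \<Rightarrow> real^'n)" where
  "zero_vec q = (q, \<lambda>_. 0)"

lemma zero_vec_cdom: "i \<in> idx M \<Longrightarrow> q \<in> cdom M i \<Longrightarrow> zero_vec q \<in> cdom T i"
  using linear_0[OF linear_fderiv_transition] by (auto simp: zero_vec_def tangent_space_def)

lemma zero_vec_pts:
  assumes "q \<in> pts M"
  shows "zero_vec q \<in> pts T"
proof -
  obtain i where "i \<in> idx M" "q \<in> cdom M i" using ex_chart[OF assms] by (auto simp: charts_at_def)
  then show ?thesis by (intro cdomT_pts zero_vec_cdom)
qed

lemma cmap_zero_vec: "cmap T i (zero_vec q) = (cmap M i q, 0)"
  by (simp add: zero_vec_def)

lemma cinv_zero_vec:
  assumes "i \<in> idx M" "y \<in> cimg M i"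
  shows "cinv T i (y, 0) = zero_vec (cinv M i y)"
proof -
  obtain q where q: "q \<in> cdom M i" "y = cmap M i q" using assms by blast
  then show ?thesis
    using T.cinv_cmap[of i "zero_vec q"] zero_vec_cdom[OF assms(1) q(1)] assms(1)
    by (simp add: cinv_cmap zero_vec_def)
qed

text \<open>In coordinates the zero section sends y to (y, 0) and its derivative sends a to (a, 0),
  so pulling back along it keeps the dq-component of \<mu> at zero velocity.\<close>

definition zero_pullback :: "'p \<Rightarrow> 'p \<times> ('i \<Rightarrow> real^'n)" where
  "zero_pullback q = (q, \<lambda>i. fst (snd (\<mu> (zero_vec q)) i))"

lemma form_rep_zero_pullback:
  assumes "i \<in> idx M" "y \<in> cimg M i"
  shows "form_rep M zero_pullback i y = fst (form_rep T \<mu> i (y, 0))"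
  by (simp add: form_rep_def zero_pullback_def cinv_zero_vec[OF assms])

lemma zero_section_smooth:
  assumes i: "i \<in> idx M"
  shows "smooth_on (cimg M i) (\<lambda>y. (y, 0::real^'n))"
    "(\<lambda>y. (y, 0::real^'n)) ` (cimg M i) \<subseteq> cimg T i"
  using cimg_tangent_bundle[OF i] open_cimg[OF i]
  by (auto intro!: smooth_on_Pair smooth_on_ident smooth_on_const)

lemma one_form_zero_pullback: "one_form M zero_pullback"
proof (rule one_formI)
  show "fst (zero_pullback q) = q" for q by (simp add: zero_pullback_def)
  fix q assume q: "q \<in> pts M"
  note z = zero_vec_pts[OF q]
  have ch: "charts_at T (zero_vec q) = charts_at M q"
    using charts_at_T[OF z] by (simp add: zero_vec_def)
  show "snd (zero_pullback q) \<in> cotangent_space M q"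
    unfolding cotangent_space_def mem_Collect_eq
  proof (intro conjI ballI allI impI)
    fix i assume "i \<notin> charts_at M q"
    then show "snd (zero_pullback q) i = 0"
      using T.cotangent_space_zero[OF mu_covector[OF z], of i] ch by (simp add: zero_pullback_def)
  next
    fix i j a assume i: "i \<in> charts_at M q" and j: "j \<in> charts_at M q"
    let ?t = "transition M i j"
    have ij: "i \<in> idx M" "j \<in> idx M" "q \<in> cdom M i" "q \<in> cdom M j" using i j by (auto simp: charts_at_def)
    \<comment> \<open>At zero velocity the second derivative term of the lifted transition vanishes,
      so horizontal vectors (a, 0) stay horizontal and the dq-components transform as a covector on
      the base.\<close>
    have "fderiv (\<lambda>z. fderiv ?t z 0) (cmap M i q) = fderiv (\<lambda>z. 0) (cmap M i q)"
      by (rule fderiv_cong_open[OF open_overlap[OF ij(1,2)]])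
        (use ij linear_0[OF smooth_on_linear_fderiv[OF smooth_transition[OF ij(1,2)]]] in auto)
    then have "fderiv (transition T i j) (cmap T i (zero_vec q)) (a, 0) = (fderiv ?t (cmap M i q) a, 0)"
      using fderiv_transition_T[OF z, of i j a 0] i j linear_0[OF linear_fderiv_transition[OF i j]]
      by (simp add: zero_vec_def)
    then show "snd (zero_pullback q) i \<bullet> a = snd (zero_pullback q) j \<bullet> fderiv ?t (cmap M i q) a"
      using T.cotangent_space_transition[OF mu_covector[OF z], of i j "(a, 0)"] i j ch
      by (simp add: zero_pullback_def inner_prod_def del: tangent_bundle_simps)
  qed
next
  fix i assume i: "i \<in> idx M"
  have iT: "i \<in> idx T" using i by simp
  have "smooth_on (cimg M i) (\<lambda>y. fst (form_rep T \<mu> i (y, 0)))"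
    by (intro smooth_on_linear_comp[OF open_cimg[OF i] bounded_linear_fst]
        smooth_on_compose[OF open_cimg[OF i] T.open_cimg[OF iT] zero_section_smooth(2,1)[OF i]]
        T.smooth_form_rep[OF one_form_mu iT])
  then show "smooth_on (cimg M i) (form_rep M zero_pullback i)"
    by (rule smooth_on_cong[OF open_cimg[OF i], rotated]) (simp add: form_rep_zero_pullback[OF i])
qed

text \<open>Symmetry of the derivative upstairs, restricted to vectors of the form (u, 0).\<close>

lemma closed_zero_pullback:
  assumes cl: "closed_form T \<mu>"
  shows "closed_form M zero_pullback"
  unfolding closed_form_iff[OF one_form_zero_pullback]
proof (intro ballI)
  fix i y assume i: "i \<in> idx M" and y: "y \<in> cimg M i"
  have iT: "i \<in> idx T" using i by simp
  let ?m = "form_rep T \<mu> i"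
  have y0: "(y, 0) \<in> cimg T i" using zero_section_smooth(2)[OF i] y by blast
  have sym: "symmetric_derivative ?m (y, 0)"
    using cl iT y0 unfolding T.closed_form_iff[OF one_form_mu] by blast
  have "((\<lambda>y. (y, 0::real^'n)) has_derivative (\<lambda>a. (a, 0))) (at y)"
    by (auto intro!: derivative_eq_intros)
  from has_derivative_fst[OF has_derivative_compose[OF this
        smooth_on_has_derivative[OF T.smooth_form_rep[OF one_form_mu iT] y0]]]
  have "((\<lambda>y. fst (?m (y, 0))) has_derivative (\<lambda>a. fst (fderiv ?m (y, 0) (a, 0)))) (at y)" .
  then have "(form_rep M zero_pullback i has_derivative (\<lambda>a. fst (fderiv ?m (y, 0) (a, 0)))) (at y)"
    by (rule has_derivative_transform_within_open[OF _ open_cimg[OF i] y])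
      (simp add: form_rep_zero_pullback[OF i])
  note d = fderiv_eqI[OF this]
  show "symmetric_derivative (form_rep M zero_pullback i) y"
    unfolding symmetric_derivative_def d
  proof (intro allI)
    fix u w :: "real^'n"
    show "fst (fderiv ?m (y, 0) (u, 0)) \<bullet> w = fst (fderiv ?m (y, 0) (w, 0)) \<bullet> u"
      using sym[unfolded symmetric_derivative_def, rule_format, of "(u, 0)" "(w, 0)"]
      by (simp add: inner_prod_def)
  qed
qed

text \<open>The primitive \<open>h\<close> of the pullback along the zero section fixes the constants of the local
  primitives on the fibres.\<close>

lemma closed_imp_ex_primitive:
  assumes cl: "closed_form T \<mu>" and H1: "H1_deRham_zero M"
  shows "\<exists>L. primitive_on T \<mu> (fst -` pts M) L"
proof -
  obtain h where h: "smooth_function M h" and dh: "\<And>p i u. p \<in> pts M \<Longrightarrow> i \<in> charts_at M p \<Longrightarrow>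
      snd (zero_pullback p) i \<bullet> u = fderiv (h \<circ> cinv M i) (cmap M i p) u"
    using H1 one_form_zero_pullback closed_zero_pullback[OF cl]
    unfolding H1_deRham_zero_def exact_form_def by blast
  \<comment> \<open>Two successive choices: first a neighbourhood that admits a primitive, then a
    primitive on it.\<close>
  define U where "U q = (SOME U. \<exists>K. openin (mtop M) U \<and> q \<in> U \<and> primitive_on T \<mu> (fst -` U) K)" for q
  define K where "K q = (SOME K. primitive_on T \<mu> (fst -` U q) K)" for q
  have U: "openin (mtop M) (U q)" "q \<in> U q" "primitive_on T \<mu> (fst -` U q) (K q)" if "q \<in> pts M" for q
  proof -
    have *: "\<exists>K. openin (mtop M) (U q) \<and> q \<in> U q \<and> primitive_on T \<mu> (fst -` U q) K"
      unfolding U_def by (rule someI_ex[OF ex_local_primitive[OF cl that]])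
    then show "openin (mtop M) (U q)" "q \<in> U q" by blast+
    show "primitive_on T \<mu> (fst -` U q) (K q)"
      unfolding K_def using someI_ex[of "primitive_on T \<mu> (fst -` U q)"] * by blast
  qed
  \<comment> \<open>Two local primitives differ by a constant on the fibre over
    \<open>fst x\<close>, and subtracting the value at the zero vector cancels it. Thus the
    normalised primitive can be computed with \<open>K q\<close> for any nearby
    \<open>q\<close>.\<close>
  have K_eq: "K q x - K q (zero_vec (fst x)) = K (fst x) x - K (fst x) (zero_vec (fst x))"
    if x: "x \<in> pts T" and q: "q \<in> pts M" "fst x \<in> U q" for x q
  proof -
    have xM: "fst x \<in> pts M" using x by simp
    then obtain i where i: "i \<in> idx M" "fst x \<in> cdom M i" using ex_chart by (auto simp: charts_at_def)
    then have iT: "i \<in> idx T" and xi: "x \<in> cdom T i" using x by simp_all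
    \<comment> \<open>A single fibre in coordinates, which is convex.\<close>
    let ?S = "{cmap M i (fst x)} \<times> (UNIV :: (real^'n) set)"
    have S: "?S \<subseteq> cimg T i" using cimg_tangent_bundle[OF i(1)] i by blast
    have one: "{cmap M i (fst x)} \<subseteq> cimg M i" using i by blast
    have im: "cinv T i ` ?S = pts T \<inter> fst -` {fst x}"
      using fst_vimage_cinv[OF i(1) one] cinv_cmap[OF i] by simp
    have "cinv T i ` ?S \<subseteq> fst -` U q \<inter> fst -` U (fst x)"
      unfolding im using q U(2)[OF xM] by auto
    from T.primitive_on_unique[OF U(3)[OF q(1)] U(3)[OF xM] iT _ S this]
    obtain c where c: "\<forall>z\<in>pts T \<inter> fst -` {fst x}. K q z - K (fst x) z = c"
      unfolding im by (auto simp: convex_Times)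
    have "x \<in> pts T \<inter> fst -` {fst x}" "zero_vec (fst x) \<in> pts T \<inter> fst -` {fst x}"
      using x zero_vec_pts[OF xM] by (auto simp: zero_vec_def)
    then have "K q x - K (fst x) x = c" "K q (zero_vec (fst x)) - K (fst x) (zero_vec (fst x)) = c"
      using c by blast+
    then show ?thesis by simp
  qed
  \<comment> \<open>The bracket is the normalised local primitive, which vanishes on the zero
    section; \<open>h\<close> supplies the values there.\<close>
  define L where "L x = h (fst x) + (K (fst x) x - K (fst x) (zero_vec (fst x)))" for x
  have "primitive_on T \<mu> (fst -` pts M) L"
  proof (rule T.primitive_onI[OF one_form_mu])
    fix x assume x: "x \<in> pts T"
    define q where "q = fst x"
    have q: "q \<in> pts M" using x by (simp add: q_def)
    obtain i where i: "i \<in> idx M" "q \<in> cdom M i" "i \<in> charts_at M q"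
      using ex_chart[OF q] by (auto simp: charts_at_def)
    then have iT: "i \<in> idx T" and xi: "x \<in> cdom T i" and ix: "i \<in> charts_at T x"
      using x by (simp_all add: q_def charts_at_T[OF x])
    let ?m = "form_rep T \<mu> i" and ?y = "cmap T i x"
    let ?O = "cmap T i ` (cdom T i \<inter> fst -` U q)"
    have oO: "open ?O"
      using image_cmap_fst[OF i(1), of "U q"] open_image_Int[OF U(1)[OF q] i(1)] by (simp add: open_Times)
    have yO: "?y \<in> ?O" using xi U(2)[OF q] by (auto simp: q_def)
    have y1: "fst ?y = cmap M i q" by (simp add: q_def)
    have dK: "((\<lambda>y. K q (cinv T i y)) has_derivative (\<lambda>u. ?m ?y \<bullet> u)) (at ?y)"
      by (rule T.primitive_onD[OF U(3)[OF q] iT xi]) (use U(2)[OF q] in \<open>simp add: q_def\<close>)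
    have z0: "((\<lambda>y. (fst y, 0::real^'n)) has_derivative (\<lambda>u. (fst u, 0))) (at ?y)"
      by (auto intro!: derivative_eq_intros)
    have "((\<lambda>y. K q (cinv T i y)) has_derivative (\<lambda>u. ?m (cmap T i (zero_vec q)) \<bullet> u)) (at (cmap T i (zero_vec q)))"
      by (rule T.primitive_onD[OF U(3)[OF q] iT zero_vec_cdom[OF i(1,2)]])
        (use U(2)[OF q] in \<open>simp add: zero_vec_def\<close>)
    then have dK0: "((\<lambda>y. K q (cinv T i (fst y, 0))) has_derivative (\<lambda>u. ?m (cmap M i q, 0) \<bullet> (fst u, 0))) (at ?y)"
      using has_derivative_compose[OF z0, of "\<lambda>y. K q (cinv T i y)" "\<lambda>u. ?m (cmap M i q, 0) \<bullet> u"]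
      unfolding cmap_zero_vec y1 by simp
    have "((\<lambda>y. h (cinv M i y)) has_derivative (\<lambda>a. fst (?m (cmap M i q, 0)) \<bullet> a)) (at (cmap M i q))"
    proof -
      have "(h \<circ> cinv M i has_derivative fderiv (h \<circ> cinv M i) (cmap M i q)) (at (cmap M i q))"
        using smooth_on_has_derivative[OF smooth_function_cinv[OF h i(1)], of "cmap M i q"] i(2)
        by (simp add: comp_def)
      moreover have "fderiv (h \<circ> cinv M i) (cmap M i q) = (\<lambda>a. fst (?m (cmap M i q, 0)) \<bullet> a)"
        using dh[OF q i(3)] form_rep_cmap[OF i(1,2), of zero_pullback]
          form_rep_zero_pullback[OF i(1), of "cmap M i q"] i(2) by (intro ext) simp
      ultimately show ?thesis by (simp add: comp_def)
    qed
    then have dh': "((\<lambda>y. h (cinv M i (fst y))) has_derivative (\<lambda>u. fst (?m (cmap M i q, 0)) \<bullet> fst u)) (at ?y)"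
      using has_derivative_compose[OF has_derivative_fst[OF has_derivative_ident], of "\<lambda>y. h (cinv M i y)"
          "\<lambda>a. fst (?m (cmap M i q, 0)) \<bullet> a" ?y] unfolding y1 by simp
    \<comment> \<open>Subtracting the value on the zero section removes the dq-component of \<mu> at
      zero velocity, and the differential of \<open>h\<close> puts back exactly this term.\<close>
    have "((\<lambda>y. h (cinv M i (fst y)) + (K q (cinv T i y) - K q (cinv T i (fst y, 0)))) has_derivative
        (\<lambda>u. fst (?m (cmap M i q, 0)) \<bullet> fst u + (?m ?y \<bullet> u - ?m (cmap M i q, 0) \<bullet> (fst u, 0)))) (at ?y)"
      by (intro has_derivative_add has_derivative_diff dh' dK dK0)
    then have "((\<lambda>y. h (cinv M i (fst y)) + (K q (cinv T i y) - K q (cinv T i (fst y, 0)))) has_derivative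
        (\<lambda>u. ?m ?y \<bullet> u)) (at ?y)"
      by (rule has_derivative_eq_rhs) (simp add: inner_prod_def fun_eq_iff)
    \<comment> \<open>\<open>L\<close> uses a primitive that changes with the base point;
      \<open>K_eq\<close> replaces it by the fixed \<open>K q\<close> near \<open>x\<close>, and
      only then can it be differentiated.\<close>
    then have "((\<lambda>y. L (cinv T i y)) has_derivative (\<lambda>u. ?m ?y \<bullet> u)) (at ?y)"
    proof (rule has_derivative_transform_within_open[OF _ oO yO])
      fix y assume "y \<in> ?O"
      then obtain z where z: "z \<in> cdom T i" "fst z \<in> U q" "y = cmap T i z" by blast
      have zc: "cinv T i y = z" using T.cinv_cmap[OF iT z(1)] z(3) by blast
      have zM: "fst z \<in> cdom M i" using z by simp
      have y1: "fst y = cmap M i (fst z)" using z by simp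
      have z0: "cinv T i (fst y, 0) = zero_vec (fst z)"
        unfolding y1 using cinv_zero_vec[OF i(1), of "cmap M i (fst z)"] zM cinv_cmap[OF i(1) zM] by simp
      show "h (cinv M i (fst y)) + (K q (cinv T i y) - K q (cinv T i (fst y, 0))) = L (cinv T i y)"
        unfolding zc z0 unfolding y1 cinv_cmap[OF i(1) zM] L_def
        using K_eq[OF cdomT_pts[OF i(1) z(1)] q z(2)] by simp
    qed
    then show "\<exists>i\<in>charts_at T x. ((\<lambda>y. L (cinv T i y)) has_derivative
        (\<lambda>u. form_rep T \<mu> i (cmap T i x) \<bullet> u)) (at (cmap T i x))"
      using ix by blast
  qed
  then show ?thesis by blast
qed

lemma closed_imp_variational:
  assumes "fibre_regular M F" "closed_form T \<mu>" "H1_deRham_zero M"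
  shows "variational M \<Gamma>"
  using closed_imp_ex_primitive[OF assms(2,3)]
    regular_primitive_imp_lagrangian_for[OF assms(1) openin_pts]
  unfolding variational_def by blast

end

theorem theorem4p2:
  fixes Q :: "('q, real^'n, 'i) manifold"
    and \<Gamma> :: "'q \<times> ('i \<Rightarrow> real^'n) \<Rightarrow> ('q \<times> ('i \<Rightarrow> real^'n)) \<times> ('i \<Rightarrow> (real^'n) \<times> (real^'n))"
  assumes "smooth_manifold Q" and "sode Q \<Gamma>"
  shows "(locally_variational Q \<Gamma> \<longleftrightarrow>
            (\<exists>F. local_diffeomorphism (tangent_bundle Q) (cotangent_bundle Q) F \<and>
                 (\<forall>x\<in>pts (tangent_bundle Q). fst (F x) = fst x) \<and>
                 lagrangian_submanifold (cotangent_bundle (tangent_bundle Q))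
                   (canonical_symplectic (tangent_bundle Q))
                   (mu_form Q \<Gamma> F ` pts (tangent_bundle Q)))) \<and>
         (H1_deRham_zero Q \<longrightarrow>
           (variational Q \<Gamma> \<longleftrightarrow>
            (\<exists>F. local_diffeomorphism (tangent_bundle Q) (cotangent_bundle Q) F \<and>
                 (\<forall>x\<in>pts (tangent_bundle Q). fst (F x) = fst x) \<and>
                 lagrangian_submanifold (cotangent_bundle (tangent_bundle Q))
                   (canonical_symplectic (tangent_bundle Q))
                   (mu_form Q \<Gamma> F ` pts (tangent_bundle Q)))))"
proof -
  interpret smooth_atlas Q by (rule smooth_manifold_imp_atlas[OF assms(1)])
  interpret sode_vec Q \<Gamma> by unfold_locales (rule assms(2))
  let ?lag = "\<lambda>F. lagrangian_submanifold (cotangent_bundle T) (canonical_symplectic T) (mu_form Q \<Gamma> F ` pts T)"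
  let ?P = "\<lambda>F. local_diffeomorphism T C F \<and> (\<forall>x\<in>pts T. fst (F x) = fst x)"
  \<comment> \<open>A local diffeomorphism is smooth, so any F from the existential statement fits
    the locale.\<close>
  have loc: "sode_fibre_map_vec Q \<Gamma> F" if "?P F" for F
    using that local_diffeomorphism_smooth_map[OF T.smooth_atlas_axioms C.smooth_atlas_axioms]
    by unfold_locales auto
  have lag: "?lag F \<longleftrightarrow> closed_form T (mu_form Q \<Gamma> F)" if "?P F" for F
  proof -
    interpret F: sode_fibre_map_vec Q \<Gamma> F by (rule loc[OF that])
    show ?thesis by (rule T.lagrangian_image_iff_closed[OF F.one_form_mu])
  qed
  \<comment> \<open>One argument serves both equivalences: the local diffeomorphism gives regularity
    and the Lagrangian image gives closedness.\<close>
  have bwd: "locally_variational Q \<Gamma> \<and> (H1_deRham_zero Q \<longrightarrow> variational Q \<Gamma>)"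
    if F: "?P F" and l: "?lag F" for F
  proof -
    interpret F: sode_fibre_map_vec Q \<Gamma> F by (rule loc[OF F])
    have "fibre_regular Q F" using F F.local_diffeomorphism_imp_regular by blast
    then show ?thesis
      using lag[OF F] l F.closed_imp_locally_variational F.closed_imp_variational by blast
  qed
  have fwd: "\<exists>F. ?P F \<and> ?lag F" if "locally_variational Q \<Gamma>"
    using locally_variational_imp_closed[OF that] lag by blast
  have "locally_variational Q \<Gamma> \<longleftrightarrow> (\<exists>F. ?P F \<and> ?lag F)"
    using bwd fwd by blast
  \<comment> \<open>The forward direction passes through the local notion; the vanishing of the
    first cohomology enters in the converse.\<close>
  moreover have "variational Q \<Gamma> \<longleftrightarrow> (\<exists>F. ?P F \<and> ?lag F)" if "H1_deRham_zero Q"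
    using bwd fwd variational_imp_locally_variational[OF assms(1)] that by blast
  ultimately show ?thesis
    by (simp only: conj_assoc) blast
qed

end
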